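(* Let $\alpha\in(0,1)$ and let $m, M_0, M_1, L>0$. There exists a constant $K$, depending only on $\alpha$, $m$, $M_1$ and $L$, such that the following holds. Let $\zeta_o,\zeta_b\in\mathbb{C}$ be distinct, let $\Omega_1,\Omega_2\in\mathscr{O}$ be domains with the same perimeter $L$, and let $f_1,f_2\in\mathscr{F}$ be the corresponding conformal mappings. Suppose that $\mathcal{T}(f_1),\mathcal{T}(f_2)\in\mathscr{G}_1^L$. Then, up to rotations around $\zeta_o$ (that is, after replacing $\Omega_1$ by its image under a suitable rotation of the plane about $\zeta_o$), $$d_{H}(\Omega_1,\Omega_2)\le K\,\Vert\mathcal{T}(f_1)-\mathcal{T}(f_2)\Vert_{1,0,[0,L]}^{\alpha}.$$ The functions $\mathcal{T}(f_1),\mathcal{T}(f_2)$ on the right-hand side are those of the original domains.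
   Context: $D$ is the open unit disk in $\mathbb{C}$. $\mathscr{O}$ is the set of bounded, simply connected open sets $\Omega\subseteq\mathbb{C}$ with boundary of class $C^{1,\alpha}$, with $\zeta_o\in\Omega$ and $\zeta_b\in\partial\Omega$. $\mathscr{F}$ is the set of one-to-one functions $f\in C^{1,\alpha}(\overline D,\mathbb{C})$, analytic in $D$, with $f(0)=\zeta_o$, $f(1)=\zeta_b$. Each $\Omega\in\mathscr{O}$ corresponds to the unique $f\in\mathscr{F}$ with $f(D)=\Omega$ (Riemann mapping theorem and Kellogg's theorem). For $f\in\mathscr{F}$ with $\Omega=f(D)$, let $u$ be the solution of $-\Delta u=\delta_{\zeta_o}$ in $\Omega$, $u=0$ on $\partial\Omega$. $\mathcal{T}(f)$ denotes the interior normal derivative of $u$ on $\partial\Omega$ as a function of the arclength $s\in[0,|\partial\Omega|]$, measured counterclockwise from $\zeta_b$, extended $|\partial\Omega|$-periodically to $\mathbb{R}$. Parametrically, $s=\int_0^\theta|f'(e^{it})|\,dt$ and $\mathcal{T}(f)(s)=\frac{1}{2\pi|f'(e^{i\theta})|}$, $\theta\in[0,2\pi]$. For a function $\varphi$ on an interval $I$: $\Vert\varphi\Vert_{\infty,I}=\sup_I|\varphi|$, $[\varphi]_{k,\alpha,I}=\sup_{x\ne y\in I}\frac{|\varphi^{(k)}(x)-\varphi^{(k)}(y)|}{|x-y|^\alpha}$, $\Vert\varphi\Vert_{k,0,I}=\sum_{j=0}^k\Vert\varphi^{(j)}\Vert_{\infty,I}$, $\Vert\varphi\Vert_{k,\alpha,I}=\Vert\varphi\Vert_{k,0,I}+[\varphi]_{k,\alpha,I}$.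 $\mathscr{G}_0^L$ is the set of $L$-periodic $\varphi\in C^{0,\alpha}(\mathbb{R})$ with $\varphi\ge m$ and $\Vert\varphi\Vert_{0,\alpha,[0,L]}\le M_0$; $\mathscr{G}_1^L$ is the set of $\varphi\in\mathscr{G}_0^L\cap C^{1,\alpha}(\mathbb{R})$ with $\Vert\varphi\Vert_{1,\alpha,[0,L]}\le M_1$. The Hausdorff distance is $d_H(A,B)=\max\{\rho(A,B),\rho(B,A)\}$ with $\rho(A,B)=\sup_{a\in A}\inf_{b\in B}|a-b|$; for bounded open sets it is given by the same formula (equivalently, applied to their closures). *)

theory Defs
  imports "HOL-Analysis.Analysis"
begin

section \<open>Hoelder classes\<close>

definition holder_on :: "real \<Rightarrow> 'a::real_normed_vector set \<Rightarrow> ('a \<Rightarrow> 'b::real_normed_vector) \<Rightarrow> bool" where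
  "holder_on \<alpha> S f \<longleftrightarrow> (\<exists>C. \<forall>x\<in>S. \<forall>y\<in>S. norm (f x - f y) \<le> C * norm (x - y) powr \<alpha>)"

text \<open>The derivative is the real Frechet derivative, taken within \<open>S\<close> (hence one-sided at
  boundary points of \<open>S\<close>).\<close>

definition C1_holder_on ::
    "real \<Rightarrow> 'a::real_normed_vector set \<Rightarrow> ('a \<Rightarrow> 'b::real_normed_vector) \<Rightarrow> bool" where
  "C1_holder_on \<alpha> S f \<longleftrightarrow>
     (\<exists>f' :: 'a \<Rightarrow> 'a \<Rightarrow>\<^sub>L 'b.
        (\<forall>x\<in>S. (f has_derivative blinfun_apply (f' x)) (at x within S)) \<and> holder_on \<alpha> S f')"


section \<open>The domains and the conformal mappings\<close>

text \<open>Near each of its boundary points, after a rigid motion, \<open>\<Omega>\<close> is the region below the graph of a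
  \<open>C\<^sup>1\<^sup>,\<^sup>\<alpha>\<close> function.\<close>

definition C1_holder_boundary :: "real \<Rightarrow> complex set \<Rightarrow> bool" where
  "C1_holder_boundary \<alpha> \<Omega> \<longleftrightarrow>
     (\<forall>p\<in>frontier \<Omega>. \<exists>r>0. \<exists>\<beta>. \<exists>\<psi> :: real \<Rightarrow> real. C1_holder_on \<alpha> UNIV \<psi> \<and>
        \<Omega> \<inter> ball p r = {z \<in> ball p r. Im (cis (- \<beta>) * (z - p)) < \<psi> (Re (cis (- \<beta>) * (z - p)))})"

definition class_O :: "real \<Rightarrow> complex \<Rightarrow> complex \<Rightarrow> complex set set" where
  "class_O \<alpha> \<zeta>o \<zeta>b =
     {\<Omega>. bounded \<Omega> \<and> open \<Omega> \<and> simply_connected \<Omega> \<and> C1_holder_boundary \<alpha> \<Omega> \<and>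
          \<zeta>o \<in> \<Omega> \<and> \<zeta>b \<in> frontier \<Omega>}"

definition class_F :: "real \<Rightarrow> complex \<Rightarrow> complex \<Rightarrow> (complex \<Rightarrow> complex) set" where
  "class_F \<alpha> \<zeta>o \<zeta>b =
     {f. inj_on f (cball 0 1) \<and> C1_holder_on \<alpha> (cball 0 1) f \<and> f holomorphic_on ball 0 1 \<and>
         f 0 = \<zeta>o \<and> f 1 = \<zeta>b}"


section \<open>The Dirichlet problem with a point source\<close>

text \<open>\<open>C\<^sup>\<infinity>\<close> functions: differentiable everywhere, with all directional derivatives again
  \<open>C\<^sup>\<infinity>\<close> (greatest fixed point).\<close>

coinductive smooth :: "(complex \<Rightarrow> real) \<Rightarrow> bool" where
  "(\<forall>z. \<phi> differentiable (at z)) \<Longrightarrow> (\<forall>v. smooth (\<lambda>z. frechet_derivative \<phi> (at z) v)) \<Longrightarrow> smooth \<phi>"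

definition laplacian :: "(complex \<Rightarrow> real) \<Rightarrow> complex \<Rightarrow> real" where
  "laplacian \<phi> z =
     frechet_derivative (\<lambda>w. frechet_derivative \<phi> (at w) 1) (at z) 1 +
     frechet_derivative (\<lambda>w. frechet_derivative \<phi> (at w) \<i>) (at z) \<i>"

definition test_functions :: "complex set \<Rightarrow> (complex \<Rightarrow> real) set" where
  "test_functions \<Omega> =
     {\<phi>. smooth \<phi> \<and> compact (closure {z. \<phi> z \<noteq> 0}) \<and> closure {z. \<phi> z \<noteq> 0} \<subseteq> \<Omega>}"

text \<open>\<open>-\<Delta>u = \<delta>\<^sub>\<zeta>\<^sub>o\<close> in \<open>\<Omega>\<close> in the sense of distributions, and \<open>u = 0\<close> on the boundary, attained
  continuously. The value of \<open>u\<close> at the pole \<open>\<zeta>o\<close> is irrelevant.\<close>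

definition point_source_solution :: "complex set \<Rightarrow> complex \<Rightarrow> (complex \<Rightarrow> real) \<Rightarrow> bool" where
  "point_source_solution \<Omega> \<zeta>o u \<longleftrightarrow>
     set_integrable lborel \<Omega> u \<and>
     (\<forall>\<phi>\<in>test_functions \<Omega>. - (LINT z:\<Omega>|lborel. u z * laplacian \<phi> z) = \<phi> \<zeta>o) \<and>
     continuous_on (closure \<Omega> - {\<zeta>o}) u \<and>
     (\<forall>z\<in>frontier \<Omega>. u z = 0)"

text \<open>On the domains considered, the solution is unique away from \<open>\<zeta>o\<close>.\<close>

definition green_solution :: "complex set \<Rightarrow> complex \<Rightarrow> complex \<Rightarrow> real" where
  "green_solution \<Omega> \<zeta>o = (SOME u. point_source_solution \<Omega> \<zeta>o u)"


section \<open>The interior normal derivative as a function of the arclength\<close>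

text \<open>For conformal \<open>f\<close> this parametrizes the boundary of \<open>f(D)\<close> counterclockwise, starting at
  \<open>f 1 = \<zeta>b\<close>.\<close>

definition boundary_curve :: "(complex \<Rightarrow> complex) \<Rightarrow> real \<Rightarrow> complex" where
  "boundary_curve f t = f (cis t)"

definition boundary_arclength :: "(complex \<Rightarrow> complex) \<Rightarrow> real \<Rightarrow> real" where
  "boundary_arclength f \<theta> =
     integral {0..\<theta>} (\<lambda>t. norm (vector_derivative (boundary_curve f) (at t)))"

definition perimeter :: "(complex \<Rightarrow> complex) \<Rightarrow> real" where
  "perimeter f = boundary_arclength f (2 * pi)"

text \<open>The parameter in \<open>[0, 2\<pi>)\<close> of the boundary point at arclength \<open>s\<close>, where \<open>s\<close> is first reduced
  modulo the perimeter.\<close>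

definition boundary_angle :: "(complex \<Rightarrow> complex) \<Rightarrow> real \<Rightarrow> real" where
  "boundary_angle f s =
     (THE \<theta>. 0 \<le> \<theta> \<and> \<theta> < 2 * pi \<and>
        boundary_arclength f \<theta> = s - perimeter f * of_int \<lfloor>s / perimeter f\<rfloor>)"

text \<open>As the boundary is traversed counterclockwise, the interior normal is the unit tangent turned by
  a quarter turn to the left (\<open>sgn w = w / \<bar>w\<bar>\<close>).\<close>

definition interior_normal :: "(complex \<Rightarrow> complex) \<Rightarrow> real \<Rightarrow> complex" where
  "interior_normal f \<theta> = \<i> * sgn (vector_derivative (boundary_curve f) (at \<theta>))"

definition op_T :: "(complex \<Rightarrow> complex) \<Rightarrow> real \<Rightarrow> real" where
  "op_T f s =
     (let u = green_solution (f ` ball 0 1) (f 0); \<theta> = boundary_angle f s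
      in vector_derivative (\<lambda>t. u (boundary_curve f \<theta> + of_real t * interior_normal f \<theta>))
           (at 0 within {0..}))"


section \<open>Norms and classes of periodic functions\<close>

text \<open>The suprema are real-valued, hence meaningful only when finite; this is so wherever the norms are
  used below, since membership in the respective Hoelder class is required separately.\<close>

definition sup_norm :: "real set \<Rightarrow> (real \<Rightarrow> real) \<Rightarrow> real" where
  "sup_norm I \<phi> = (SUP x\<in>I. \<bar>\<phi> x\<bar>)"

definition holder_seminorm :: "nat \<Rightarrow> real \<Rightarrow> real set \<Rightarrow> (real \<Rightarrow> real) \<Rightarrow> real" where
  "holder_seminorm k \<alpha> I \<phi> =
     (SUP (x, y) \<in> {(x, y). x \<in> I \<and> y \<in> I \<and> x \<noteq> y}.
        \<bar>(deriv ^^ k) \<phi> x - (deriv ^^ k) \<phi> y\<bar> / \<bar>x - y\<bar> powr \<alpha>)"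

definition Ck_norm :: "nat \<Rightarrow> real set \<Rightarrow> (real \<Rightarrow> real) \<Rightarrow> real" where
  "Ck_norm k I \<phi> = (\<Sum>j\<le>k. sup_norm I ((deriv ^^ j) \<phi>))"

definition Ck_holder_norm :: "nat \<Rightarrow> real \<Rightarrow> real set \<Rightarrow> (real \<Rightarrow> real) \<Rightarrow> real" where
  "Ck_holder_norm k \<alpha> I \<phi> = Ck_norm k I \<phi> + holder_seminorm k \<alpha> I \<phi>"

definition class_G0 :: "real \<Rightarrow> real \<Rightarrow> real \<Rightarrow> real \<Rightarrow> (real \<Rightarrow> real) set" where
  "class_G0 \<alpha> m M0 L =
     {\<phi>. (\<forall>s. \<phi> (s + L) = \<phi> s) \<and> holder_on \<alpha> UNIV \<phi> \<and> (\<forall>s. m \<le> \<phi> s) \<and>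
         Ck_holder_norm 0 \<alpha> {0..L} \<phi> \<le> M0}"

definition class_G1 :: "real \<Rightarrow> real \<Rightarrow> real \<Rightarrow> real \<Rightarrow> real \<Rightarrow> (real \<Rightarrow> real) set" where
  "class_G1 \<alpha> m M0 M1 L =
     {\<phi> \<in> class_G0 \<alpha> m M0 L. C1_holder_on \<alpha> UNIV \<phi> \<and> Ck_holder_norm 1 \<alpha> {0..L} \<phi> \<le> M1}"


section \<open>Hausdorff distance and rotations\<close>

definition hausdorff_excess :: "complex set \<Rightarrow> complex set \<Rightarrow> real" where
  "hausdorff_excess A B = (SUP a\<in>A. infdist a B)"

definition hausdorff_dist :: "complex set \<Rightarrow> complex set \<Rightarrow> real" where
  "hausdorff_dist A B = max (hausdorff_excess A B) (hausdorff_excess B A)"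

definition rotation_about :: "complex \<Rightarrow> real \<Rightarrow> complex \<Rightarrow> complex" where
  "rotation_about c \<beta> z = c + cis \<beta> * (z - c)"

end

theory Submission
  imports Defs "HOL-Complex_Analysis.Complex_Analysis"
begin

text \<open>Write \<open>T = 1 / (2\<pi> \<bar>f'\<bar>)\<close> on the circle as a function of arclength. If \<open>T\<^sub>1\<close> and \<open>T\<^sub>2\<close> differ by at most \<open>d\<close>, integrating
  \<open>d\<theta> = 2\<pi> T ds\<close> shows that the arclength parameters differ by \<open>O(d)\<close>, so \<open>log \<bar>f\<^sub>1' / f\<^sub>2'\<bar>\<close> is \<open>O(d)\<close> on the circle; it is also
  Lipschitz with a constant independent of \<open>d\<close>, hence Hoelder with exponent \<open>1 - \<alpha>\<close> and constant \<open>O(d\<^sup>\<alpha>)\<close>. By Privalov's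
  theorem a holomorphic logarithm of \<open>f\<^sub>1' / f\<^sub>2'\<close> is then within \<open>O(d\<^sup>\<alpha>)\<close> of its value at the origin, whose imaginary part is removed
  by a rotation.

  That the distributional Green's function is \<open>- log \<bar>f\<^sup>-\<^sup>1\<bar> / 2\<pi>\<close> follows from Weyl's lemma (test functions whose Laplacian is a
  difference of two annular kernels make radial means independent of the radius) and the maximum principle. A zero of \<open>f'\<close> on
  the circle is excluded by \<open>T \<ge> m > 0\<close>: there the normal degenerates to \<open>sgn 0 = 0\<close>, so \<open>T\<close> would vanish.\<close>

section \<open>Smooth bump functions and radial test functions\<close>

text \<open>\<open>op_T\<close> rests on a Hilbert choice among distributional solutions, so nothing
  is known about it until a solution is shown to exist and to be unique; this is why so much
  potential theory precedes the estimates. The estimates work with the single quotient Q = cis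
  \<beta> f1' / f2' because only the logarithm of the quotient has small boundary values. The angle
  \<beta> makes Q 0 positive, and the maximum modulus principle for Q and 1 / Q bounds ln (Q 0) by
  the O(d) bound on the circle; together with the oscillation bound this gives Q - 1 = O(d^\<alpha>)
  in the disc. The a priori bound d \<le> 2 M1 absorbs the linear term and the exponential factor
  into d^\<alpha>. As f1 and f2 agree at 0, integrating cis \<beta> f1' - f2' = f2' (Q - 1) along
  radii bounds the distance between points with the same parameter, and hence the Hausdorff
  distance.\<close>

coinductive real_smooth :: "(real \<Rightarrow> real) \<Rightarrow> bool" where
  real_smooth_step:
    "(\<And>t. (h has_real_derivative h' t) (at t)) \<Longrightarrow> real_smooth h' \<Longrightarrow> real_smooth h"

lemma real_smoothE:
  assumes "real_smooth h"
  obtains h' where "\<And>t. (h has_real_derivative h' t) (at t)" "real_smooth h'"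
  using assms by (cases rule: real_smooth.cases) (rule that)

lemma real_smooth_continuous: "real_smooth h \<Longrightarrow> continuous_on A h"
  by (erule real_smoothE) (blast intro: DERIV_isCont continuous_at_imp_continuous_on)

text \<open>Coinduction in usable form: a family closed under differentiation consists of smooth
  functions. The closure properties below come down to finding a large enough family.\<close>

lemma real_smooth_family:
  assumes "h \<in> F" "\<And>h. h \<in> F \<Longrightarrow> \<exists>h'\<in>F. \<forall>t. (h has_real_derivative h' t) (at t)"
  shows "real_smooth h"
  using assms(1)
proof (coinduction arbitrary: h)
  case real_smooth
  then obtain h' where "h' \<in> F" "\<forall>t. (h has_real_derivative h' t) (at t)"
    using assms(2) by (meson bexE)
  then show ?case by (intro exI[of _ h] exI[of _ h'] conjI disjI1 refl allI) auto
qed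

lemma real_smooth_const: "real_smooth (\<lambda>t. c)"
  by (rule real_smooth_family[of _ "range (\<lambda>c t. c)"]) (auto intro!: exI[of _ 0])

text \<open>The product rule turns a product into a sum of products, so the products alone are not
  closed under differentiation; the algebra generated by the smooth functions is.\<close>

inductive smooth_alg :: "(real \<Rightarrow> real) \<Rightarrow> bool" where
  base: "real_smooth h \<Longrightarrow> smooth_alg h"
| add: "smooth_alg g \<Longrightarrow> smooth_alg h \<Longrightarrow> smooth_alg (\<lambda>t. g t + h t)"
| mult: "smooth_alg g \<Longrightarrow> smooth_alg h \<Longrightarrow> smooth_alg (\<lambda>t. g t * h t)"

lemma smooth_alg_deriv:
  "smooth_alg h \<Longrightarrow> \<exists>h'. (\<forall>t. (h has_real_derivative h' t) (at t)) \<and> smooth_alg h'"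
proof (induction rule: smooth_alg.induct)
  case (base h)
  obtain h' where "\<And>t. (h has_real_derivative h' t) (at t)" "real_smooth h'"
    using base by (rule real_smoothE) blast
  then show ?case by (intro exI[of _ h'] conjI allI smooth_alg.base)
next
  case (add g h)
  obtain g' where "\<forall>t. (g has_real_derivative g' t) (at t)" "smooth_alg g'"
    using add.IH(1) by blast
  moreover obtain h' where "\<forall>t. (h has_real_derivative h' t) (at t)" "smooth_alg h'"
    using add.IH(2) by blast
  ultimately show ?case
    by (intro exI[of _ "\<lambda>t. g' t + h' t"] conjI allI smooth_alg.add DERIV_add) simp_all
next
  case (mult g h)
  obtain g' where "\<forall>t. (g has_real_derivative g' t) (at t)" "smooth_alg g'"
    using mult.IH(1) by blast
  moreover obtain h' where "\<forall>t. (h has_real_derivative h' t) (at t)" "smooth_alg h'"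
    using mult.IH(2) by blast
  ultimately show ?case using mult.hyps
    by (intro exI[of _ "\<lambda>t. g' t * h t + h' t * g t"] conjI allI smooth_alg.add
        smooth_alg.mult DERIV_mult) simp_all
qed

lemma smooth_alg_real_smooth: "smooth_alg h \<Longrightarrow> real_smooth h"
  by (rule real_smooth_family[of _ "{h. smooth_alg h}"]) (use smooth_alg_deriv in \<open>auto simp: Bex_def\<close>)

lemma real_smooth_add: "real_smooth g \<Longrightarrow> real_smooth h \<Longrightarrow> real_smooth (\<lambda>t. g t + h t)"
  and real_smooth_mult: "real_smooth g \<Longrightarrow> real_smooth h \<Longrightarrow> real_smooth (\<lambda>t. g t * h t)"
  by (rule smooth_alg_real_smooth, rule smooth_alg.intros, (erule smooth_alg.base)+)+

lemma real_smooth_ident: "real_smooth (\<lambda>t. t)"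
  by (rule real_smooth_step[where h' = "\<lambda>t. 1"]) (auto intro: real_smooth_const)

lemma real_smooth_diff: "real_smooth g \<Longrightarrow> real_smooth h \<Longrightarrow> real_smooth (\<lambda>t. g t - h t)"
  using real_smooth_add[of g "\<lambda>t. (-1) * h t"] real_smooth_mult[OF real_smooth_const, of h "-1"]
  by simp

lemma real_smooth_affine:
  assumes "real_smooth h"
  shows "real_smooth (\<lambda>t. h (a * t + b))"
proof (rule real_smooth_family)
  let ?F = "{k. \<exists>g c. real_smooth g \<and> k = (\<lambda>t. c * g (a * t + b))}"
  show "(\<lambda>t. h (a * t + b)) \<in> ?F"
    using assms by (auto intro!: exI[of _ h] exI[of _ 1])
  fix k assume "k \<in> ?F"
  then obtain g c where g: "real_smooth g" and k: "k = (\<lambda>t. c * g (a * t + b))" by blast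
  obtain g' where g': "\<And>t. (g has_real_derivative g' t) (at t)" "real_smooth g'"
    using g by (rule real_smoothE) blast
  have "(k has_real_derivative (c * a) * g' (a * t + b)) (at t)" for t
    unfolding k by (auto intro!: derivative_eq_intros DERIV_chain2[OF g'(1)])
  then show "\<exists>h'\<in>?F. \<forall>t. (k has_real_derivative h' t) (at t)"
    using g'(2) by (intro bexI[of _ "\<lambda>t. (c * a) * g' (a * t + b)"]) blast+
qed

text \<open>The zeros of \<open>P\<close> to the left of \<delta> keep the pole at 0 out of reach.
  The exponent is left general because the derivative of P / t^j is (t P' - j P) / t^(j+1), which
  has the same form with a numerator that vanishes on the same half-line.\<close>

lemma real_smooth_divide_power:
  assumes "real_smooth P" "\<delta> > 0" "\<And>t. t < \<delta> \<Longrightarrow> P t = 0"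
  shows "real_smooth (\<lambda>t. P t * (1 / t) ^ j)"
proof (rule real_smooth_family)
  let ?F = "{k. \<exists>P j. real_smooth P \<and> (\<forall>t<\<delta>. P t = 0) \<and> k = (\<lambda>t. P t * (1 / t) ^ j)}"
  show "(\<lambda>t. P t * (1 / t) ^ j) \<in> ?F" using assms by blast
  fix k assume "k \<in> ?F"
  then obtain P j where P: "real_smooth P" "\<forall>t<\<delta>. P t = 0" and k: "k = (\<lambda>t. P t * (1 / t) ^ j)"
      by blast
    obtain P' where P': "\<And>t. (P has_real_derivative P' t) (at t)" "real_smooth P'"
      using P(1) by (rule real_smoothE) blast
    have P'0: "P' t = 0" if "t < \<delta>" for t
    proof -
      have "((\<lambda>_. 0) has_real_derivative P' t) (at t)"
        by (rule has_field_derivative_transform_within_open[OF P'(1), of "{..<\<delta>}"])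
          (use P that in auto)
      then show ?thesis using DERIV_unique DERIV_const by blast
    qed
    define R where "R t = t * P' t - of_nat j * P t" for t
    have "real_smooth R" unfolding R_def
      by (intro real_smooth_diff real_smooth_mult real_smooth_ident real_smooth_const P P')
    moreover have "\<forall>t<\<delta>. R t = 0" using P P'0 by (auto simp: R_def)
    moreover have "(k has_real_derivative R t * (1 / t) ^ Suc j) (at t)" for t
    proof (cases "t < \<delta>")
      case True
      have "((\<lambda>_. 0) has_real_derivative 0) (at t)" by simp
      then have "(k has_real_derivative 0) (at t)"
        by (rule has_field_derivative_transform_within_open[of _ _ _ "{..<\<delta>}"])
          (use P True in \<open>auto simp: k\<close>)
      then show ?thesis using \<open>\<forall>t<\<delta>. R t = 0\<close> True by simp
    next
      case False
      then have t: "t > 0" using assms(2) by linarith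
      have "((\<lambda>t. (1/t) ^ j) has_real_derivative - (of_nat j * (1 / t) ^ Suc j)) (at t)"
      proof (cases j)
        case (Suc n)
        have "((\<lambda>t. (1/t) ^ Suc n) has_real_derivative (1 + of_nat n) * ((- (1 / t ^ 2)) * (1 / t) ^ n)) (at t)"
          using t by (intro DERIV_power_Suc) (auto intro!: derivative_eq_intros simp: power2_eq_square)
        then show ?thesis by (simp add: Suc power2_eq_square algebra_simps)
      qed simp
      from DERIV_mult[OF P'(1) this]
      have "(k has_real_derivative P' t * (1 / t) ^ j + - (of_nat j * (1 / t) ^ Suc j) * P t) (at t)"
        unfolding k .
      moreover have "P' t * (1 / t) ^ j + - (of_nat j * (1 / t) ^ Suc j) * P t = R t * (1 / t) ^ Suc j"
        using t by (simp add: R_def left_diff_distrib diff_divide_distrib)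
      ultimately show ?thesis by simp
    qed
    ultimately show "\<exists>h'\<in>?F. \<forall>t. (k has_real_derivative h' t) (at t)"
      by (intro bexI[of _ "\<lambda>t. R t * (1 / t) ^ Suc j"]) blast+
qed

section \<open>The flat exponential and a bump function\<close>

definition flat_exp :: "real poly \<Rightarrow> real \<Rightarrow> real" where
  "flat_exp p t = (if t \<le> 0 then 0 else poly p (1 / t) * exp (- (1 / t)))"

lemma poly_times_exp_minus_tendsto_0: "((\<lambda>x::real. poly p x * exp (- x)) \<longlongrightarrow> 0) at_top"
proof (induction p)
  case 0
  then show ?case by simp
next
  case (pCons a p)
  have monom: "((\<lambda>x::real. x ^ k * exp (- x)) \<longlongrightarrow> 0) at_top" for k
    using tendsto_power_div_exp_0[of k] by (simp add: exp_minus field_simps)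
  have "((\<lambda>x. \<Sum>i\<le>degree q. coeff q i * (x ^ i * exp (- x))) \<longlongrightarrow> (\<Sum>i\<le>degree q. coeff q i * 0)) at_top"
    for q :: "real poly" by (intro tendsto_sum tendsto_mult monom tendsto_const)
  from this[of "pCons a p"] show ?case
    by (simp only: poly_altdef sum_distrib_right mult.assoc mult_zero_right sum.neutral_const)
qed

text \<open>With x = 1/t one has d/dt = - x^2 d/dx, so p(x) exp(-x) becomes x^2 (p - p')(x) exp(-x);
  the polynomial x^2 is \<open>[:0, 0, 1:]\<close>. Hence the functions \<open>flat_exp p\<close>
  form a family closed under differentiation.\<close>

lemma flat_exp_deriv:
  "(flat_exp p has_real_derivative flat_exp ([:0, 0, 1:] * (p - pderiv p)) t) (at t)"
proof -
  consider "t < 0" | "t > 0" | "t = 0" by linarith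
  then show ?thesis
  proof cases
    case 1
    have "((\<lambda>_. 0) has_real_derivative 0) (at t)" by simp
    then have "(flat_exp p has_real_derivative 0) (at t)"
      by (rule has_field_derivative_transform_within_open[of _ _ _ "{..<0}"])
        (use 1 in \<open>auto simp: flat_exp_def\<close>)
    then show ?thesis using 1 by (simp add: flat_exp_def)
  next
    case 2
    have "((\<lambda>t. poly p (1 / t) * exp (- (1 / t))) has_real_derivative
        flat_exp ([:0, 0, 1:] * (p - pderiv p)) t) (at t)"
      using 2 by (auto intro!: derivative_eq_intros poly_DERIV simp: flat_exp_def)
        (simp add: power2_eq_square diff_divide_distrib algebra_simps)
    then show ?thesis
      by (rule has_field_derivative_transform_within_open[of _ _ _ "{0<..}"])
        (use 2 in \<open>auto simp: flat_exp_def\<close>)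
  next
    case 3
    have "((\<lambda>h. flat_exp p h / h) \<longlongrightarrow> 0) (at 0)"
    proof (rule filterlim_split_at)
      have "eventually (\<lambda>h::real. 0 = flat_exp p h / h) (at_left 0)"
        by (auto simp: eventually_at_filter flat_exp_def)
      then show "((\<lambda>h. flat_exp p h / h) \<longlongrightarrow> 0) (at_left 0)"
        by (rule Lim_transform_eventually[OF tendsto_const])
      \<comment> \<open>\<open>pCons 0 p\<close> multiplies by the variable and so takes up the
        factor 1/h of the difference quotient.\<close>
      have "((\<lambda>h. poly (pCons 0 p) (inverse h) * exp (- inverse h)) \<longlongrightarrow> 0) (at_right 0)"
        by (rule filterlim_compose[OF poly_times_exp_minus_tendsto_0 filterlim_inverse_at_top_right])
      then show "((\<lambda>h. flat_exp p h / h) \<longlongrightarrow> 0) (at_right 0)"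
        by (rule Lim_transform_eventually)
          (auto simp: eventually_at_filter flat_exp_def field_simps)
    qed
    then show ?thesis using 3 by (simp add: DERIV_def flat_exp_def)
  qed
qed

lemma real_smooth_flat_exp: "real_smooth (flat_exp p)"
  by (rule real_smooth_family[of _ "range flat_exp"]) (use flat_exp_deriv in auto)

text \<open>The support is [1, 2], away from 0: composed with |z|^2 / r it gives a function on an
  annulus, and its primitive vanishes near 0, which later permits division by t.\<close>

definition bump :: "real \<Rightarrow> real" where
  "bump t = flat_exp 1 (t - 1) * flat_exp 1 (2 - t)"

lemma real_smooth_bump: "real_smooth bump"
proof -
  have "real_smooth (\<lambda>t. flat_exp 1 (1 * t + (- 1)) * flat_exp 1 ((-1) * t + 2))"
    by (intro real_smooth_mult real_smooth_affine real_smooth_flat_exp)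
  then show ?thesis by (simp add: bump_def[abs_def] algebra_simps)
qed

lemma bump_nonneg: "bump t \<ge> 0"
  by (simp add: bump_def flat_exp_def)

lemma bump_pos: "1 < t \<Longrightarrow> t < 2 \<Longrightarrow> bump t > 0"
  by (simp add: bump_def flat_exp_def)

lemma bump_eq_0: "t \<le> 1 \<or> 2 \<le> t \<Longrightarrow> bump t = 0"
  by (auto simp: bump_def flat_exp_def)

lemma real_smooth_primitive:
  assumes "real_smooth h"
  obtains H where "real_smooth H" "\<And>t. (H has_real_derivative h t) (at t)" "H a = 0"
proof -
  define H0 where "H0 t = (LBINT y=ereal 0..t. h y)" for t :: real
  have H0: "(H0 has_real_derivative h t) (at t)" for t
  proof -
    have "((\<lambda>u. LBINT y=ereal 0..u. h y) has_vector_derivative h t) (at t within {min t 0 - 1..max t 0 + 1})"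
      by (rule interval_integral_FTC2)
        (auto intro!: real_smooth_continuous assms)
    then have "((\<lambda>u. LBINT y=ereal 0..u. h y) has_vector_derivative h t) (at t within {min t 0 - 1<..<max t 0 + 1})"
      by (rule has_vector_derivative_within_subset) auto
    then show ?thesis
      unfolding H0_def[abs_def] has_real_derivative_iff_has_vector_derivative
      by (subst (asm) has_vector_derivative_within_open) auto
  qed
  show ?thesis
  proof (rule that[of "\<lambda>t. H0 t - H0 a"])
    show D: "((\<lambda>t. H0 t - H0 a) has_real_derivative h t) (at t)" for t
      using DERIV_diff[OF H0[of t] DERIV_const[of "H0 a"]] by simp
    show "real_smooth (\<lambda>t. H0 t - H0 a)"
      by (rule real_smooth_step[OF D assms])
  qed simp
qed

section \<open>Smooth radial functions on the plane\<close>

lemma smooth_family: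
  assumes "\<phi> \<in> F"
    and "\<And>\<phi>. \<phi> \<in> F \<Longrightarrow> \<exists>D. (\<forall>z. (\<phi> has_derivative D z) (at z)) \<and> (\<forall>v. (\<lambda>z. D z v) \<in> F)"
  shows "smooth \<phi>"
  using assms(1)
proof (coinduction arbitrary: \<phi>)
  case (smooth \<phi>)
  then obtain D where D: "\<And>z. (\<phi> has_derivative D z) (at z)" "\<And>v. (\<lambda>z. D z v) \<in> F"
    using assms(2) by meson
  have "frechet_derivative \<phi> (at z) = D z" for z
    using frechet_derivative_at[OF D(1)] by simp
  moreover have "\<phi> differentiable (at z)" for z
    using D(1) by (auto simp: differentiable_def)
  ultimately show ?case
    using D(2) by simp
qed

text \<open>A directional derivative of h(|z - a|^2) carries the linear factor 2 (z - a) \<bullet>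
  v, whose own derivative is constant. Adding these two kinds of generators makes the algebra closed
  under directional derivatives.\<close>

inductive radial_alg :: "complex \<Rightarrow> (complex \<Rightarrow> real) \<Rightarrow> bool" for a where
  base: "real_smooth h \<Longrightarrow> radial_alg a (\<lambda>z. h ((norm (z - a))\<^sup>2))"
| lin: "radial_alg a (\<lambda>z. (z - a) \<bullet> v)"
| const: "radial_alg a (\<lambda>z. c)"
| add: "radial_alg a g \<Longrightarrow> radial_alg a h \<Longrightarrow> radial_alg a (\<lambda>z. g z + h z)"
| mult: "radial_alg a g \<Longrightarrow> radial_alg a h \<Longrightarrow> radial_alg a (\<lambda>z. g z * h z)"

lemma has_derivative_norm_squared:
  fixes a :: "'a::real_inner"
  shows "((\<lambda>z. (norm (z - a))\<^sup>2) has_derivative (\<lambda>v. 2 * ((z - a) \<bullet> v))) (at z)"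
  unfolding power2_norm_eq_inner
  by (auto intro!: derivative_eq_intros simp: inner_commute)

lemma has_derivative_radial:
  fixes a :: "'a::real_inner"
  assumes "(h has_real_derivative h') (at ((norm (z - a))\<^sup>2))"
  shows "((\<lambda>z. h ((norm (z - a))\<^sup>2)) has_derivative (\<lambda>v. h' * (2 * ((z - a) \<bullet> v)))) (at z)"
  using has_derivative_compose[OF has_derivative_norm_squared[of a z]
      assms[unfolded has_field_derivative_def]]
  by simp

lemma radial_alg_has_derivative:
  "radial_alg a \<phi> \<Longrightarrow> \<exists>D. (\<forall>z. (\<phi> has_derivative D z) (at z)) \<and> (\<forall>v. radial_alg a (\<lambda>z. D z v))"
proof (induction rule: radial_alg.induct)
  case (base h)
  obtain h' where h': "\<And>t. (h has_real_derivative h' t) (at t)" "real_smooth h'"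
    using base by (rule real_smoothE) blast
  show ?case
    by (intro exI[of _ "\<lambda>z v. h' ((norm (z - a))\<^sup>2) * (2 * ((z - a) \<bullet> v))"] conjI allI
        has_derivative_radial h' radial_alg.base radial_alg.lin radial_alg.const radial_alg.mult)
next
  case (lin v)
  show ?case
    by (rule exI[of _ "\<lambda>z w. w \<bullet> v"]) (auto intro!: derivative_eq_intros radial_alg.const)
next
  case (const c)
  show ?case by (rule exI[of _ "\<lambda>z w. 0"]) (auto intro: radial_alg.const)
next
  case (add g h)
  obtain D where "\<forall>z. (g has_derivative D z) (at z)" "\<forall>v. radial_alg a (\<lambda>z. D z v)"
    using add.IH(1) by blast
  moreover obtain E where "\<forall>z. (h has_derivative E z) (at z)" "\<forall>v. radial_alg a (\<lambda>z. E z v)"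
    using add.IH(2) by blast
  ultimately show ?case
    by (intro exI[of _ "\<lambda>z v. D z v + E z v"] conjI allI radial_alg.add has_derivative_add) simp_all
next
  case (mult g h)
  obtain D where "\<forall>z. (g has_derivative D z) (at z)" "\<forall>v. radial_alg a (\<lambda>z. D z v)"
    using mult.IH(1) by blast
  moreover obtain E where "\<forall>z. (h has_derivative E z) (at z)" "\<forall>v. radial_alg a (\<lambda>z. E z v)"
    using mult.IH(2) by blast
  ultimately show ?case using mult.hyps
    by (intro exI[of _ "\<lambda>z v. g z * E z v + D z v * h z"] conjI allI radial_alg.add
       radial_alg.mult has_derivative_mult) simp_all
qed

lemma smooth_radial: "real_smooth h \<Longrightarrow> smooth (\<lambda>z. h ((norm (z - a))\<^sup>2))"
  by (rule smooth_family[of _ "{\<phi>. radial_alg a \<phi>}"])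
    (use radial_alg_has_derivative[of a] in \<open>auto intro: radial_alg.base\<close>)

text \<open>In the variable q = |z - a|^2 the planar Laplacian of G(q) is 4 (q G')'. Prescribing a
  radial Laplacian therefore amounts to two integrations in one variable.\<close>

lemma laplacian_radial:
  assumes G: "\<And>t. (G has_real_derivative k t) (at t)" and k: "\<And>t. (k has_real_derivative k' t) (at t)"
  shows "laplacian (\<lambda>z. G ((norm (z - a))\<^sup>2)) z
    = 4 * (k ((norm (z - a))\<^sup>2) + (norm (z - a))\<^sup>2 * k' ((norm (z - a))\<^sup>2))"
proof -
  let ?q = "\<lambda>z. (norm (z - a))\<^sup>2"
  have 1: "frechet_derivative (\<lambda>z. G (?q z)) (at w) = (\<lambda>v. k (?q w) * (2 * ((w - a) \<bullet> v)))" for w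
    by (rule frechet_derivative_at[symmetric]) (rule has_derivative_radial[OF G])
  have 2: "frechet_derivative (\<lambda>z. k (?q z) * (2 * ((z - a) \<bullet> v))) (at w)
     = (\<lambda>u. k (?q w) * (2 * (u \<bullet> v)) + k' (?q w) * (2 * ((w - a) \<bullet> u)) * (2 * ((w - a) \<bullet> v)))" for v w
  proof -
    have "((\<lambda>z. 2 * ((z - a) \<bullet> v)) has_derivative (\<lambda>u. 2 * (u \<bullet> v))) (at w)"
      by (auto intro!: derivative_eq_intros)
    from has_derivative_mult[OF has_derivative_radial[OF k] this]
    show ?thesis by (rule frechet_derivative_at[symmetric])
  qed
  have "?q z = Re (z - a) ^ 2 + Im (z - a) ^ 2" by (rule cmod_power2)
  then show ?thesis unfolding laplacian_def 1 2
    by (simp add: inner_complex_def) (simp add: algebra_simps power2_eq_square)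
qed

text \<open>The factor 1/r is the normalization in dimension two that makes the total mass
  independent of r.\<close>

definition annular_kernel :: "real \<Rightarrow> complex \<Rightarrow> real" where
  "annular_kernel r z = bump ((norm z)\<^sup>2 / r) / r"

text \<open>Solves (t G')' = bump(t/\<delta>)/\<delta> - bump(t/r)/r. Both terms have the same mass,
  so the primitive \<open>P\<close> = t G' vanishes for large t as well as for small t; this is what
  makes \<open>G\<close> smooth at 0 and compactly supported.\<close>

lemma radial_test_function:
  assumes "0 < \<delta>" "0 < r" "cball a (sqrt (2 * max \<delta> r)) \<subseteq> \<Omega>"
  obtains \<phi> where "\<phi> \<in> test_functions \<Omega>"
    "\<And>z. laplacian \<phi> z = 4 * (annular_kernel \<delta> (z - a) - annular_kernel r (z - a))"
proof -
  obtain \<Theta> where \<Theta>: "real_smooth \<Theta>" "\<And>t. (\<Theta> has_real_derivative bump t) (at t)" "\<Theta> 1 = 0"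
    using real_smooth_primitive[OF real_smooth_bump, of 1] by blast
  have \<Theta>0: "\<Theta> t = 0" if "t \<le> 1" for t
  proof -
    have "\<exists>c. \<forall>x\<in>{..1}. \<Theta> x = c"
      by (rule has_field_derivative_zero_constant)
        (auto intro!: DERIV_subset[OF \<Theta>(2)[THEN DERIV_cong]] bump_eq_0)
    then show ?thesis using \<Theta>(3) that by force
  qed
  have \<Theta>2: "\<Theta> t = \<Theta> 2" if "t \<ge> 2" for t
  proof -
    have "\<exists>c. \<forall>x\<in>{2..}. \<Theta> x = c"
      by (rule has_field_derivative_zero_constant)
        (auto intro!: DERIV_subset[OF \<Theta>(2)[THEN DERIV_cong]] bump_eq_0)
    then show ?thesis using that by force
  qed
  define P where "P t = \<Theta> ((1 / \<delta>) * t + 0) - \<Theta> ((1 / r) * t + 0)" for t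
  have P: "real_smooth P" unfolding P_def by (intro real_smooth_diff real_smooth_affine \<Theta>)
  have dP: "(P has_real_derivative bump (t / \<delta>) / \<delta> - bump (t / r) / r) (at t)" for t
  proof -
    have "((\<lambda>t. \<Theta> ((1 / c) * t + 0)) has_real_derivative bump (t / c) / c) (at t)" for c
      using DERIV_chain2[OF \<Theta>(2) DERIV_cdivide[OF DERIV_ident], of c t UNIV] by simp
    then show ?thesis unfolding P_def by (intro DERIV_diff)
  qed
  have P0: "P t = 0" if "t < min \<delta> r" for t
    using that assms by (simp add: P_def \<Theta>0 field_simps)
  \<comment> \<open>Beyond 2 both terms have reached the same final value
    \<open>\<Theta> 2\<close>.\<close>
  have P2: "P t = 0" if "t \<ge> 2 * max \<delta> r" for t
    using that assms by (simp add: P_def \<Theta>2[of "t / \<delta>"] \<Theta>2[of "t / r"] field_simps)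
  define k where "k t = P t * (1 / t) ^ 1" for t
  have k: "real_smooth k" unfolding k_def
    by (rule real_smooth_divide_power[OF P, of "min \<delta> r"]) (use assms P0 in auto)
  obtain k' where k': "\<And>t. (k has_real_derivative k' t) (at t)" using k by (rule real_smoothE) blast
  \<comment> \<open>This includes t = 0, where \<open>P\<close> vanishes and the left side is 0 as
    well.\<close>
  have tk: "t * k t = P t" for t using P0[of 0] assms by (simp add: k_def)
  have kk': "k t + t * k' t = bump (t / \<delta>) / \<delta> - bump (t / r) / r" for t
  proof -
    have "((\<lambda>t. t * k t) has_real_derivative 1 * k t + k' t * t) (at t)"
      by (intro DERIV_mult DERIV_ident k')
    then have "(P has_real_derivative 1 * k t + k' t * t) (at t)" by (simp only: tk)
    from DERIV_unique[OF this dP[of t]] show ?thesis by (simp add: mult.commute)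
  qed
  obtain G where G: "real_smooth G" "\<And>t. (G has_real_derivative k t) (at t)" "G (2 * max \<delta> r) = 0"
    using real_smooth_primitive[OF k] by blast
  have G0: "G t = 0" if "t \<ge> 2 * max \<delta> r" for t
  proof -
    have "\<exists>c. \<forall>x\<in>{2 * max \<delta> r..}. G x = c"
      by (rule has_field_derivative_zero_constant)
        (auto intro!: DERIV_subset[OF G(2)[THEN DERIV_cong]] simp: k_def P2)
    then show ?thesis using that G(3) by force
  qed
  define \<phi> where "\<phi> = (\<lambda>z. G ((norm (z - a))\<^sup>2))"
  have sub: "{z. \<phi> z \<noteq> 0} \<subseteq> cball a (sqrt (2 * max \<delta> r))"
  proof
    fix z assume "z \<in> {z. \<phi> z \<noteq> 0}"
    then have "\<not> 2 * max \<delta> r \<le> (norm (z - a))\<^sup>2" using G0[of "(norm (z - a))\<^sup>2"] by (auto simp: \<phi>_def)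
    then have "(norm (z - a))\<^sup>2 \<le> 2 * max \<delta> r" by linarith
    then have "norm (z - a) \<le> sqrt (2 * max \<delta> r)" by (rule real_le_rsqrt)
    then show "z \<in> cball a (sqrt (2 * max \<delta> r))" by (simp add: dist_norm norm_minus_commute)
  qed
  have cl: "closure {z. \<phi> z \<noteq> 0} \<subseteq> cball a (sqrt (2 * max \<delta> r))"
    using closure_minimal[OF sub closed_cball] .
  have "compact (closure {z. \<phi> z \<noteq> 0})"
    unfolding compact_eq_bounded_closed using bounded_subset[OF bounded_cball cl] by simp
  with cl assms(3) have "\<phi> \<in> test_functions \<Omega>"
    unfolding test_functions_def using smooth_radial[OF G(1), of a] by (auto simp: \<phi>_def)
  moreover have "laplacian \<phi> z = 4 * (annular_kernel \<delta> (z - a) - annular_kernel r (z - a))" for z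
    unfolding \<phi>_def laplacian_radial[OF G(2) k'] kk' annular_kernel_def ..
  ultimately show ?thesis by (rule that)
qed

section \<open>Integration by parts and the logarithmic potential\<close>

lemma bounded_compact_support:
  fixes f :: "'a::topological_space \<Rightarrow> real"
  assumes "compact K" "continuous_on K f" "\<And>z. z \<notin> K \<Longrightarrow> f z = 0"
  obtains B where "\<And>z. \<bar>f z\<bar> \<le> B" "0 \<le> B"
proof -
  have "bounded (f ` K)" by (intro compact_imp_bounded compact_continuous_image assms)
  then obtain B where B: "\<forall>x\<in>f ` K. norm x \<le> B" unfolding bounded_iff by blast
  have "\<bar>f z\<bar> \<le> max B 0" for z
    using B assms(3)[of z] by (cases "z \<in> K") (auto simp: le_max_iff_disj)
  then show ?thesis by (rule that) simp
qed

lemma holder_on_imp_continuous_on: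
  assumes "holder_on \<alpha> S f" "0 < \<alpha>"
  shows "continuous_on S f"
  unfolding continuous_on_def
proof
  obtain C where C: "\<And>x y. x \<in> S \<Longrightarrow> y \<in> S \<Longrightarrow> norm (f x - f y) \<le> C * norm (x - y) powr \<alpha>"
    using assms(1) unfolding holder_on_def by blast
  fix x assume x: "x \<in> S"
  have "((\<lambda>y. C * norm (y - x) powr \<alpha>) \<longlongrightarrow> C * norm (x - x) powr \<alpha>) (at x within S)"
    using assms(2) by (intro tendsto_intros tendsto_powr') auto
  then have "((\<lambda>y. C * norm (y - x) powr \<alpha>) \<longlongrightarrow> 0) (at x within S)" by simp
  then have "((\<lambda>y. f y - f x) \<longlongrightarrow> 0) (at x within S)"
    by (rule Lim_null_comparison[rotated]) (use C x in \<open>auto simp: eventually_at_filter\<close>)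
  then show "(f \<longlongrightarrow> f x) (at x within S)" by (rule LIM_zero_cancel)
qed

lemma integrable_compact_support:
  fixes f :: "'a::euclidean_space \<Rightarrow> real"
  assumes "compact K" "continuous_on K f" "\<And>z. z \<notin> K \<Longrightarrow> f z = 0"
  shows "integrable lborel f"
proof -
  have "integrable lborel (\<lambda>x. indicator K x *\<^sub>R f x)"
    by (rule borel_integrable_compact[OF assms(1,2)])
  also have "(\<lambda>x. indicator K x *\<^sub>R f x) = f"
    using assms(3) by (force simp: indicator_def)
  finally show ?thesis .
qed

lemma lborel_integral_translate:
  fixes f :: "'a::euclidean_space \<Rightarrow> real"
  assumes "integrable lborel f"
  shows "integrable lborel (\<lambda>z. f (c + z))" "integral\<^sup>L lborel (\<lambda>z. f (c + z)) = integral\<^sup>L lborel f"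
proof -
  have f: "f \<in> borel_measurable borel" using borel_measurable_integrable[OF assms] by simp
  have *: "distr lborel borel ((+) c) = (lborel :: 'a measure)" by (rule lborel_distr_plus)
  have m: "(+) c \<in> measurable lborel (borel :: 'a measure)" by simp
  show "integrable lborel (\<lambda>z. f (c + z))"
    using integrable_distr_eq[OF m f] assms unfolding * by simp
  show "integral\<^sup>L lborel (\<lambda>z. f (c + z)) = integral\<^sup>L lborel f"
    using integral_distr[OF m f] unfolding * by simp
qed

text \<open>By translation invariance of Lebesgue measure every difference quotient of \<open>V\<close> has integral
  \<open>0\<close>.\<close>

lemma integral_directional_derivative_eq_0:
  fixes V V' :: "'a::euclidean_space \<Rightarrow> real"
  assumes D: "\<And>z. ((\<lambda>t. V (z + t *\<^sub>R v)) has_real_derivative V' z) (at 0)"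
    and V: "continuous_on UNIV V" and V': "continuous_on UNIV V'"
    and K: "compact K" "\<And>z. z \<notin> K \<Longrightarrow> V z = 0"
  shows "integral\<^sup>L lborel V' = 0"
proof -
  have intV: "integrable lborel V"
    using integrable_compact_support[OF K(1) continuous_on_subset[OF V] K(2)] by auto
  have V'0: "V' z = 0" if "z \<notin> K" for z
  proof -
    have "open ((\<lambda>t::real. z + t *\<^sub>R v) -` (- K))"
      by (rule open_vimage) (auto intro!: continuous_intros simp: compact_imp_closed[OF K(1)] open_Compl)
    moreover have "((\<lambda>_. 0) has_real_derivative 0) (at (0::real))" by simp
    ultimately have "((\<lambda>t. V (z + t *\<^sub>R v)) has_real_derivative 0) (at 0)"
      using K(2) that
      by (elim has_field_derivative_transform_within_open[rotated]) auto
    then show ?thesis using D DERIV_unique by blast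
  qed
  obtain B where B: "\<And>z. \<bar>V' z\<bar> \<le> B"
    using bounded_compact_support[OF K(1) continuous_on_subset[OF V' subset_UNIV] V'0] by blast
  obtain R where R: "\<And>z. z \<in> K \<Longrightarrow> norm z \<le> R"
    using compact_imp_bounded[OF K(1)] unfolding bounded_iff by blast
  define q where "q n z = (V (inverse (real (Suc n)) *\<^sub>R v + z) - V z) * real (Suc n)" for n z
  have int_q: "integrable lborel (q n)" "integral\<^sup>L lborel (q n) = 0" for n
    using lborel_integral_translate[OF intV] intV by (auto simp: q_def[abs_def])
  have q_lim: "(\<lambda>n. q n z) \<longlonglongrightarrow> V' z" for z
  proof -
    have "((\<lambda>h. (V (z + h *\<^sub>R v) - V z) / h) \<longlongrightarrow> V' z) (at 0)"
      using D[of z] by (simp add: DERIV_def)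
    moreover have "filterlim (\<lambda>n. inverse (real (Suc n))) (at 0) sequentially"
      by (intro filterlim_atI LIMSEQ_inverse_real_of_nat) simp
    ultimately have "(\<lambda>n. (V (z + inverse (real (Suc n)) *\<^sub>R v) - V z) / inverse (real (Suc n))) \<longlonglongrightarrow> V' z"
      by (rule filterlim_compose)
    then show ?thesis by (simp add: q_def add.commute divide_inverse)
  qed
  \<comment> \<open>The dominating function: inside the ball the mean value theorem turns the
    quotient into a value of \<open>V'\<close>; outside it neither of the two evaluation points lies
    in \<open>K\<close>, because the step is at most |v|.\<close>
  have q_bound: "\<bar>q n z\<bar> \<le> indicator (cball 0 (R + norm v)) z * B" for n z
  proof -
    define h where "h = inverse (real (Suc n))"
    have h: "0 < h" "h \<le> 1" by (auto simp: h_def field_simps)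
    have hv: "norm (h *\<^sub>R v) \<le> norm v" using h by (simp add: mult_left_le_one_le)
    show ?thesis
    proof (cases "norm z \<le> R + norm v")
      case True
      have "\<exists>x>0. x < h \<and> V (z + h *\<^sub>R v) - V (z + 0 *\<^sub>R v) = (h - 0) * V' (z + x *\<^sub>R v)"
      proof (rule MVT2[OF h(1)])
        fix x
        have "((\<lambda>t. t - x) has_real_derivative 1) (at x)"
          by (auto intro!: derivative_eq_intros)
        moreover have "((\<lambda>s. V ((z + x *\<^sub>R v) + s *\<^sub>R v)) has_real_derivative V' (z + x *\<^sub>R v)) (at (x - x))"
          using D[of "z + x *\<^sub>R v"] by simp
        ultimately have "((\<lambda>t. V ((z + x *\<^sub>R v) + (t - x) *\<^sub>R v)) has_real_derivative V' (z + x *\<^sub>R v) * 1) (at x)"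
          by (rule DERIV_chain2[rotated])
        then show "((\<lambda>t. V (z + t *\<^sub>R v)) has_real_derivative V' (z + x *\<^sub>R v)) (at x)"
          by (simp add: algebra_simps)
      qed
      then obtain x where x: "V (z + h *\<^sub>R v) - V z = h * V' (z + x *\<^sub>R v)" by auto
      have "q n z = V' (z + x *\<^sub>R v)"
        using x h unfolding q_def h_def by (simp add: add.commute)
      with True B show ?thesis by simp
    next
      case False
      then have "z \<notin> K" using R[of z] norm_ge_zero[of v] by linarith
      moreover have "h *\<^sub>R v + z \<notin> K"
        using R[of "h *\<^sub>R v + z"] hv False norm_diff_ineq[of z "h *\<^sub>R v"] by (auto simp: add.commute)
      ultimately show ?thesis unfolding q_def h_def[symmetric] using False K(2) by simp
    qed
  qed
  have "(\<lambda>n. integral\<^sup>L lborel (q n)) \<longlonglongrightarrow> integral\<^sup>L lborel V'"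
  proof (rule integral_dominated_convergence[where w = "\<lambda>z. indicator (cball 0 (R + norm v)) z * B"])
    show "V' \<in> borel_measurable lborel"
      using borel_measurable_continuous_onI[OF V'] by simp
    show "integrable lborel (\<lambda>z::'a. indicator (cball 0 (R + norm v)) z * B)"
      by (intro integrable_mult_left integrable_real_indicator) (use emeasure_lborel_cball_finite[of "0 :: 'a"] in \<open>auto simp: less_top\<close>)
    show "AE z in lborel. (\<lambda>n. q n z) \<longlonglongrightarrow> V' z" using q_lim by simp
    show "AE z in lborel. norm (q n z) \<le> indicator (cball 0 (R + norm v)) z * B" for n
      using q_bound by simp
  qed (use int_q in auto)
  then show ?thesis by (simp add: int_q LIMSEQ_const_iff)
qed

section \<open>Integration by parts against compactly supported smooth functions\<close>

lemma smoothD: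
  assumes "smooth \<phi>"
  shows "(\<phi> has_derivative frechet_derivative \<phi> (at z)) (at z)" "smooth (\<lambda>z. frechet_derivative \<phi> (at z) v)"
  using assms by (cases rule: smooth.cases; simp add: frechet_derivative_works[symmetric])+

lemma smooth_continuous: "smooth \<phi> \<Longrightarrow> continuous_on A \<phi>"
  by (intro continuous_at_imp_continuous_on ballI has_derivative_continuous[OF smoothD(1)])

lemma smooth_directional:
  assumes "smooth \<phi>"
  shows "((\<lambda>t. \<phi> (z + t *\<^sub>R v)) has_real_derivative frechet_derivative \<phi> (at z) v) (at 0)"
proof -
  have "((\<lambda>t. z + t *\<^sub>R v) has_derivative (\<lambda>t. t *\<^sub>R v)) (at 0)"
    by (auto intro!: derivative_eq_intros)
  moreover have "(\<phi> has_derivative frechet_derivative \<phi> (at z)) (at (z + 0 *\<^sub>R v))"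
    using smoothD(1)[OF assms] by simp
  ultimately have "((\<lambda>t. \<phi> (z + t *\<^sub>R v)) has_derivative (\<lambda>t. frechet_derivative \<phi> (at z) (t *\<^sub>R v))) (at 0)"
    by (rule has_derivative_compose)
  moreover have "frechet_derivative \<phi> (at z) (t *\<^sub>R v) = frechet_derivative \<phi> (at z) v * t" for t
    using linear_scale[OF has_derivative_linear[OF smoothD(1)[OF assms]]] by simp
  ultimately show ?thesis by (simp add: has_field_derivative_def)
qed

lemma smooth_vanishing:
  assumes "smooth \<phi>" "open U" "\<And>z. z \<in> U \<Longrightarrow> \<phi> z = 0" "z \<in> U"
  shows "frechet_derivative \<phi> (at z) v = 0"
proof -
  have "((\<lambda>_. 0) has_derivative (\<lambda>_. 0)) (at z)" by simp
  then have "(\<phi> has_derivative (\<lambda>_. 0)) (at z)"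
    by (rule has_derivative_transform_within_open[OF _ assms(2,4)]) (use assms(3) in auto)
  from frechet_derivative_at[OF this] show ?thesis by metis
qed

text \<open>The derivative of h \<phi>1 - \<phi> h1 along v is h \<phi>2 - \<phi> h2, since the
  mixed terms cancel; its integral is therefore 0. Working with one direction at a time yields the
  Laplacian by summing over v = 1 and v = i.\<close>

lemma integral_by_parts_twice:
  fixes h h1 h2 \<phi> :: "complex \<Rightarrow> real" and v :: complex
  defines "\<phi>1 \<equiv> \<lambda>z. frechet_derivative \<phi> (at z) v"
  defines "\<phi>2 \<equiv> \<lambda>z. frechet_derivative \<phi>1 (at z) v"
  assumes \<phi>: "smooth \<phi>" and K: "compact K" "K \<subseteq> U" "\<And>z. z \<notin> K \<Longrightarrow> \<phi> z = 0" and U: "open U"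
    and h: "\<And>z. z \<in> U \<Longrightarrow> ((\<lambda>t. h (z + t *\<^sub>R v)) has_real_derivative h1 z) (at 0)"
    and h1: "\<And>z. z \<in> U \<Longrightarrow> ((\<lambda>t. h1 (z + t *\<^sub>R v)) has_real_derivative h2 z) (at 0)"
    and cont: "continuous_on U h" "continuous_on U h1" "continuous_on U h2"
  shows "integrable lborel (\<lambda>z. h z * \<phi>2 z)" "integrable lborel (\<lambda>z. \<phi> z * h2 z)"
    "(\<integral>z. h z * \<phi>2 z \<partial>lborel) = (\<integral>z. \<phi> z * h2 z \<partial>lborel)"
proof -
  have \<phi>1: "smooth \<phi>1" and \<phi>2: "smooth \<phi>2"
    unfolding \<phi>1_def \<phi>2_def by (intro smoothD \<phi>)+
  have oK: "open (- K)" using K(1) by (simp add: compact_imp_closed open_Compl)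
  have z1: "\<phi>1 z = 0" if "z \<notin> K" for z
    unfolding \<phi>1_def by (rule smooth_vanishing[OF \<phi> oK]) (use that K in auto)
  have z2: "\<phi>2 z = 0" if "z \<notin> K" for z
    unfolding \<phi>2_def by (rule smooth_vanishing[OF \<phi>1 oK]) (use that z1 in auto)
  define V where "V z = h z * \<phi>1 z - \<phi> z * h1 z" for z
  define V' where "V' z = h z * \<phi>2 z - \<phi> z * h2 z" for z
  have V0: "V z = 0" "V' z = 0" if "z \<notin> K" for z using K(3) z1 z2 that by (auto simp: V_def V'_def)
  \<comment> \<open>\<open>U\<close> and the complement of \<open>K\<close> are open and cover the
    plane, so it does not matter what values h takes outside \<open>U\<close>.\<close>
  have glue: "continuous_on UNIV W" if "continuous_on U W" "\<And>z. z \<notin> K \<Longrightarrow> W z = 0" for W :: "complex \<Rightarrow> real"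
  proof -
    have "continuous_on (U \<union> - K) W"
      by (intro continuous_on_open_Un U oK that(1)) (auto intro!: continuous_on_eq[OF continuous_on_const[of _ 0]] simp: that(2))
    moreover have "U \<union> - K = UNIV" using K(2) by auto
    ultimately show ?thesis by simp
  qed
  have "integral\<^sup>L lborel V' = 0"
  proof (rule integral_directional_derivative_eq_0[of V v V', OF _ _ _ K(1)])
    show "continuous_on UNIV V" unfolding V_def
      by (intro glue[unfolded V_def] continuous_intros smooth_continuous \<phi> \<phi>1 cont)
        (auto simp: K(3) z1)
    show "continuous_on UNIV V'" unfolding V'_def
      by (intro glue continuous_intros smooth_continuous \<phi> \<phi>2 cont) (auto simp: K(3) z2)
    show "((\<lambda>t. V (z + t *\<^sub>R v)) has_real_derivative V' z) (at 0)" for z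
    proof (cases "z \<in> K")
      case True
      then have z: "z \<in> U" using K by auto
      have "((\<lambda>t. \<phi> (z + t *\<^sub>R v)) has_real_derivative \<phi>1 z) (at 0)"
        "((\<lambda>t. \<phi>1 (z + t *\<^sub>R v)) has_real_derivative \<phi>2 z) (at 0)"
        unfolding \<phi>1_def \<phi>2_def by (intro smooth_directional \<phi> \<phi>1[unfolded \<phi>1_def])+
      from DERIV_diff[OF DERIV_mult[OF h[OF z] this(2)] DERIV_mult[OF this(1) h1[OF z]]]
      show ?thesis by (simp add: V_def V'_def algebra_simps)
    next
      case False
      have "open ((\<lambda>t::real. z + t *\<^sub>R v) -` (- K))"
        by (rule open_vimage[OF oK]) (auto intro!: continuous_intros)
      moreover have "((\<lambda>_. 0) has_real_derivative 0) (at (0::real))" by simp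
      ultimately have "((\<lambda>t. V (z + t *\<^sub>R v)) has_real_derivative 0) (at 0)"
        using V0 False by (elim has_field_derivative_transform_within_open[rotated]) auto
      then show ?thesis using V0 False by simp
    qed
  qed (use V0 in auto)
  moreover show i: "integrable lborel (\<lambda>z. h z * \<phi>2 z)" "integrable lborel (\<lambda>z. \<phi> z * h2 z)"
    by (rule integrable_compact_support[OF K(1)];
      (intro continuous_on_mult smooth_continuous \<phi> \<phi>2 continuous_on_subset[OF cont(1) K(2)]
        continuous_on_subset[OF cont(3) K(2)])?; simp add: K(3) z2)+
  ultimately show "(\<integral>z. h z * \<phi>2 z \<partial>lborel) = (\<integral>z. \<phi> z * h2 z \<partial>lborel)"
    unfolding V'_def by (simp add: Bochner_Integration.integral_diff)
qed

section \<open>Radial integrals in the plane\<close>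

lemma distr_norm_squared:
  "distr lborel borel (\<lambda>z::complex. (norm z)\<^sup>2) = density lborel (\<lambda>q. ennreal pi * indicator {0..} q)"
    (is "?M = ?N")
proof (rule measure_eqI_generator_eq[where E = "range atMost" and \<Omega> = UNIV and A = "\<lambda>n. {..real n}"])
  \<comment> \<open>Polar coordinates without angles: the disc |z|^2 \<le> a has area \<pi> a, and
    the half-lines up to a determine the image measure.\<close>
  have m: "(\<lambda>z::complex. (norm z)\<^sup>2) \<in> borel_measurable lborel" by simp
  have M: "emeasure ?M {..a} = ennreal (pi * max a 0)" for a
  proof -
    have "emeasure ?M {..a} = emeasure lborel ((\<lambda>z::complex. (norm z)\<^sup>2) -` {..a})"
      by (subst emeasure_distr[OF m]) auto
    also have "\<dots> = ennreal (pi * max a 0)"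
    proof (cases "0 \<le> a")
      case True
      then have "(\<lambda>z::complex. (norm z)\<^sup>2) -` {..a} = cball 0 (sqrt a)"
        by (auto simp: real_le_rsqrt sqrt_ge_absD intro: real_le_rsqrt)
      then show ?thesis using True by (simp add: emeasure_cball unit_ball_vol_2)
    next
      case False
      then have "(\<lambda>z::complex. (norm z)\<^sup>2) -` {..a} = {}"
        by (auto simp: not_le) (meson False order_trans zero_le_power2)
      with False show ?thesis by (simp only: emeasure_empty) simp
    qed
    finally show ?thesis .
  qed
  have N: "emeasure ?N {..a} = ennreal (pi * max a 0)" for a
  proof -
    have "emeasure ?N {..a} = (\<integral>\<^sup>+q. ennreal pi * indicator {0..} q * indicator {..a} q \<partial>lborel)"
      by (subst emeasure_density) auto
    also have "\<dots> = (\<integral>\<^sup>+q. ennreal pi * indicator {0..a} q \<partial>lborel)"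
      by (intro nn_integral_cong) (auto simp: indicator_def)
    also have "\<dots> = ennreal pi * emeasure lborel {0..a}"
      by (rule nn_integral_cmult_indicator) simp
    also have "\<dots> = ennreal (pi * max a 0)" by (cases "0 \<le> a") (auto simp: ennreal_mult)
    finally show ?thesis .
  qed
  show "emeasure ?M X = emeasure ?N X" if "X \<in> range atMost" for X using that M N by auto
  show "emeasure ?M {..real n} \<noteq> \<infinity>" for n unfolding M by simp
  show "Int_stable (range atMost :: real set set)" by (auto simp: Int_stable_def)
  show "(\<Union>n. {..real n}) = UNIV" using real_arch_simple by auto
qed (auto simp: borel_eq_atMost)

lemma nn_integral_norm_squared:
  assumes [measurable]: "h \<in> borel_measurable borel"
  shows "(\<integral>\<^sup>+z. h ((norm (z::complex))\<^sup>2) \<partial>lborel) = ennreal pi * (\<integral>\<^sup>+q. h q * indicator {0..} q \<partial>lborel)"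
proof -
  have "(\<integral>\<^sup>+z. h ((norm (z::complex))\<^sup>2) \<partial>lborel) = (\<integral>\<^sup>+q. h q \<partial>distr lborel borel (\<lambda>z::complex. (norm z)\<^sup>2))"
    by (rule nn_integral_distr[symmetric]) auto
  also have "\<dots> = (\<integral>\<^sup>+q. (ennreal pi * indicator {0..} q) * h q \<partial>lborel)"
    unfolding distr_norm_squared by (rule nn_integral_density) auto
  also have "\<dots> = (\<integral>\<^sup>+q. ennreal pi * (h q * indicator {0..} q) \<partial>lborel)"
    by (simp add: mult_ac)
  also have "\<dots> = ennreal pi * (\<integral>\<^sup>+q. h q * indicator {0..} q \<partial>lborel)"
    by (rule nn_integral_cmult) simp
  finally show ?thesis .
qed

text \<open>The integrand is the Laplacian of ln(|z|^2 + 1) / 2. Its mass, \<pi> times the integral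
  of 2 / (q + 1)^2 over q \<ge> 0, is the origin of the constant 2 \<pi> in the fundamental
  solution.\<close>

lemma has_bochner_integral_poisson_kernel:
  "has_bochner_integral lborel (\<lambda>z::complex. 2 / ((norm z)\<^sup>2 + 1)\<^sup>2) (2 * pi)"
proof (rule has_bochner_integral_nn_integral)
  let ?f = "\<lambda>q::real. 2 / (q + 1)\<^sup>2"
  have "(\<integral>\<^sup>+z. ennreal (?f ((norm (z::complex))\<^sup>2)) \<partial>lborel)
      = ennreal pi * (\<integral>\<^sup>+q. ennreal (?f q) * indicator {0..} q \<partial>lborel)"
    by (rule nn_integral_norm_squared) simp
  also have "(\<integral>\<^sup>+q. ennreal (?f q) * indicator {0..} q \<partial>lborel) = ennreal (0 - (- 2 / (0 + 1)))"
  proof (rule nn_integral_FTC_atLeast)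
    show "((\<lambda>q. - 2 / (q + 1)) has_real_derivative ?f x) (at x)" if "0 \<le> x" for x
      using that by (auto intro!: derivative_eq_intros simp: power2_eq_square)
    show "((\<lambda>q::real. - 2 / (q + 1)) \<longlongrightarrow> 0) at_top" by real_asymp
  qed auto
  finally show "(\<integral>\<^sup>+z. ennreal (?f ((norm (z::complex))\<^sup>2)) \<partial>lborel) = ennreal (2 * pi)"
    by (simp add: ennreal_mult mult.commute)
qed auto

text \<open>In the variable q = |z|^2 the integrand is q^(-1/2), integrable at 0. It serves as
  majorant for the logarithm and for its regularizations.\<close>

lemma integrable_inverse_norm:
  "integrable lborel (\<lambda>z::complex. indicator (cball 0 R) z * (1 / norm z))"
proof -
  define f :: "real \<Rightarrow> real" where "f q = indicator {0..R\<^sup>2} q * q powr (- 1 / 2)" for q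
  have fm: "f \<in> borel_measurable borel" unfolding f_def by measurable
  have "((\<lambda>q. q powr (- 1 / 2)) has_integral ((R\<^sup>2) powr (- 1 / 2 + 1) / (- 1 / 2 + 1))) {0..R\<^sup>2}"
    by (rule has_integral_powr_from_0) auto
  then have "((\<lambda>q. if q \<in> {0..R\<^sup>2} then q powr (- 1 / 2) else 0) has_integral
      ((R\<^sup>2) powr (- 1 / 2 + 1) / (- 1 / 2 + 1))) UNIV"
    by (simp only: has_integral_restrict_UNIV)
  also have "(\<lambda>q. if q \<in> {0..R\<^sup>2} then q powr (- 1 / 2) else 0) = f"
    by (auto simp: f_def indicator_def)
  finally have "integral\<^sup>N lborel f = ennreal ((R\<^sup>2) powr (- 1 / 2 + 1) / (- 1 / 2 + 1))"
    by (intro nn_integral_has_integral_lborel fm) (auto simp: f_def)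
  moreover have "(\<integral>\<^sup>+q. ennreal (f q) * indicator {0..} q \<partial>lborel) = integral\<^sup>N lborel f"
    by (intro nn_integral_cong) (auto simp: f_def indicator_def)
  ultimately have fin: "(\<integral>\<^sup>+z. ennreal (f ((norm (z::complex))\<^sup>2)) \<partial>lborel) < \<infinity>"
    by (subst nn_integral_norm_squared[of "\<lambda>q. ennreal (f q)"]) (use fm in \<open>auto simp: ennreal_mult_less_top\<close>)
  have "integrable lborel (\<lambda>z::complex. f ((norm z)\<^sup>2))"
    by (rule integrableI_nonneg) (use fm fin in \<open>auto simp: f_def\<close>)
  then show ?thesis
  proof (rule Bochner_Integration.integrable_bound)
    show "AE z::complex in lborel. norm (indicator (cball 0 R) z * (1 / norm z)) \<le> norm (f ((norm z)\<^sup>2))"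
    proof (rule AE_I2)
      fix z :: complex
      have "(norm z)\<^sup>2 powr (- 1 / 2) = 1 / norm z" if "z \<noteq> 0"
      proof -
        have "(norm z)\<^sup>2 powr (- 1 / 2) = (norm z powr 2) powr (- 1 / 2)"
          by (simp only: powr_numeral norm_ge_zero)
        also have "\<dots> = norm z powr (2 * (- 1 / 2))" by (rule powr_powr)
        also have "2 * (- 1 / 2) = (- 1 :: real)" by simp
        also have "norm z powr - 1 = 1 / norm z" using that by (simp only: powr_minus_divide powr_one_gt_zero_iff zero_less_norm_iff powr_one norm_ge_zero)
        finally show ?thesis .
      qed
      moreover have "(norm z)\<^sup>2 \<le> R\<^sup>2" if "norm z \<le> R" using that by (simp add: power_mono)
      ultimately show "norm (indicator (cball 0 R) z * (1 / norm z)) \<le> norm (f ((norm z)\<^sup>2))"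
        by (cases "z = 0") (auto simp: f_def indicator_def)
    qed
  qed (auto intro!: borel_measurable_divide borel_measurable_indicator)
qed

lemma abs_ln_bound: "0 < x \<Longrightarrow> \<bar>ln x\<bar> \<le> 1 / x + x" for x :: real
proof -
  assume x: "0 < x"
  then have "ln x \<le> x - 1" "- ln x \<le> 1 / x - 1" "0 < 1 / x"
    using ln_le_minus_one[of x] ln_le_minus_one[of "1 / x"] by (auto simp: ln_div)
  with x show ?thesis by linarith
qed

lemma integrable_ln_norm:
  "integrable lborel (\<lambda>z. indicator (cball a R) z * ln (norm (z - a :: complex)))"
proof -
  have "integrable lborel (\<lambda>z::complex. indicator (cball 0 R) z * (1 / norm z) + indicator (cball 0 R) z * R)"
    by (intro Bochner_Integration.integrable_add integrable_inverse_norm integrable_mult_left integrable_real_indicator)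
      (use emeasure_lborel_cball_finite[of "0 :: complex"] in auto)
  then have "integrable lborel (\<lambda>z::complex. indicator (cball 0 R) z * ln (norm z))"
  proof (rule Bochner_Integration.integrable_bound)
    show "AE z::complex in lborel. norm (indicator (cball 0 R) z * ln (norm z))
      \<le> norm (indicator (cball 0 R) z * (1 / norm z) + indicator (cball 0 R) z * R)"
    proof (rule AE_I2)
      fix z :: complex
      have "\<bar>ln (norm z)\<bar> \<le> 1 / norm z + norm z"
        by (cases "z = 0") (use abs_ln_bound[of "norm z"] in auto)
      then show "norm (indicator (cball 0 R) z * ln (norm z))
         \<le> norm (indicator (cball 0 R) z * (1 / norm z) + indicator (cball 0 R) z * R)"
        by (auto simp: indicator_def)
    qed
  qed (auto intro!: borel_measurable_times borel_measurable_indicator borel_measurable_ln)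
  from lborel_integral_translate(1)[OF this, of "- a"]
  show ?thesis by (simp add: indicator_def dist_norm norm_minus_commute cong: if_cong)
qed

section \<open>The logarithm as fundamental solution of the Laplacian\<close>

lemma lborel_integral_scale:
  fixes f :: "complex \<Rightarrow> real"
  assumes f: "f \<in> borel_measurable borel" and c: "c > 0"
  shows "integral\<^sup>L lborel f = c\<^sup>2 * (\<integral>w. f (a + c *\<^sub>R w) \<partial>lborel)"
proof -
  have "integral\<^sup>L lborel f = integral\<^sup>L (density (distr lborel borel (\<lambda>x. a + c *\<^sub>R x)) (\<lambda>_. \<bar>c\<bar>^DIM(complex))) f"
    using lborel_affine[of c a] c by simp
  also have "\<dots> = (\<integral>x. c\<^sup>2 *\<^sub>R f x \<partial>distr lborel borel (\<lambda>x. a + c *\<^sub>R x))"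
    using c f by (subst integral_density) auto
  also have "\<dots> = (\<integral>w. c\<^sup>2 *\<^sub>R f (a + c *\<^sub>R w) \<partial>lborel)"
    using f by (subst integral_distr) auto
  finally show ?thesis by simp
qed

lemma directional_derivative_norm_squared:
  fixes z a v :: "'a::real_inner"
  shows "((\<lambda>t. (norm (z + t *\<^sub>R v - a))\<^sup>2) has_real_derivative 2 * ((z - a) \<bullet> v)) (at 0)"
proof -
  have "(norm (z + t *\<^sub>R v - a))\<^sup>2 = (norm (z - a))\<^sup>2 + 2 * ((z - a) \<bullet> v) * t + t\<^sup>2 * (norm v)\<^sup>2" for t
    unfolding power2_norm_eq_inner by (simp add: algebra_simps inner_commute power2_eq_square)
  then show ?thesis by (auto intro!: derivative_eq_intros)
qed

lemma laplacian_zero_outside: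
  assumes \<phi>: "smooth \<phi>" and "closed K" "\<And>z. z \<notin> K \<Longrightarrow> \<phi> z = 0" "z \<notin> K"
  shows "laplacian \<phi> z = 0"
proof -
  have o: "open (- K)" using assms by (simp add: open_Compl)
  have 1: "frechet_derivative \<phi> (at z) v = 0" if "z \<in> - K" for z v
    by (rule smooth_vanishing[OF \<phi> o _ that]) (use assms in auto)
  have "frechet_derivative (\<lambda>z. frechet_derivative \<phi> (at z) v) (at z) v = 0" for v
    by (rule smooth_vanishing[OF smoothD(2)[OF \<phi>] o]) (use assms 1 in auto)
  then show ?thesis by (simp add: laplacian_def)
qed

lemma laplacian_continuous:
  assumes "smooth \<phi>"
  shows "continuous_on A (laplacian \<phi>)"
  unfolding laplacian_def by (intro continuous_intros smooth_continuous smoothD assms)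

lemma laplacian_bounded:
  assumes \<phi>: "smooth \<phi>" and K: "compact K" "\<And>z. z \<notin> K \<Longrightarrow> \<phi> z = 0"
  obtains B where "\<And>z. \<bar>laplacian \<phi> z\<bar> \<le> B"
  using bounded_compact_support[OF K(1) laplacian_continuous[OF \<phi>]
      laplacian_zero_outside[OF \<phi> compact_imp_closed[OF K(1)] K(2)]] that by blast

text \<open>The two halves of the left side are the second derivatives of ln(n) / 2 along 1 and i.
  Without e they would cancel; the regularization leaves the kernel on the right.\<close>

lemma laplacian_log_identity:
  fixes n x y e :: real
  assumes "n \<noteq> 0" "n = x\<^sup>2 + y\<^sup>2 + e"
  shows "1 / n - 2 * x\<^sup>2 / n\<^sup>2 + (1 / n - 2 * y\<^sup>2 / n\<^sup>2) = 2 * e / n\<^sup>2"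
proof -
  have "1 / n = n / n\<^sup>2" using assms(1) by (simp add: power2_eq_square)
  then have "1 / n - 2 * x\<^sup>2 / n\<^sup>2 + (1 / n - 2 * y\<^sup>2 / n\<^sup>2) = (n - 2 * x\<^sup>2 + (n - 2 * y\<^sup>2)) / n\<^sup>2"
    by (simp only: diff_divide_distrib add_divide_distrib)
  also have "n - 2 * x\<^sup>2 + (n - 2 * y\<^sup>2) = 2 * e" using assms(2) by simp
  finally show ?thesis .
qed

lemma integral_regularized_log_laplacian:
  assumes \<phi>: "smooth \<phi>" and K: "compact K" "\<And>z. z \<notin> K \<Longrightarrow> \<phi> z = 0" and e: "e > 0"
  shows "integrable lborel (\<lambda>z. ln ((norm (z - a))\<^sup>2 + e) / 2 * laplacian \<phi> z)"
    "(\<integral>z. ln ((norm (z - a))\<^sup>2 + e) / 2 * laplacian \<phi> z \<partial>lborel)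
      = (\<integral>z. \<phi> z * (2 * e / ((norm (z - a))\<^sup>2 + e)\<^sup>2) \<partial>lborel)"
proof -
  define N where "N z = (norm (z - a))\<^sup>2 + e" for z
  have N: "N z > 0" "N z \<noteq> 0" for z
    using e unfolding N_def by (simp_all add: add_nonneg_pos add_nonneg_pos[THEN less_imp_neq[THEN not_sym]])
  have dN: "((\<lambda>t. N (z + t *\<^sub>R v)) has_real_derivative 2 * ((z - a) \<bullet> v)) (at 0)" for z v
    unfolding N_def using DERIV_add[OF directional_derivative_norm_squared DERIV_const, of z v a e] by simp
  define h where "h z = ln (N z) / 2" for z
  define h1 where "h1 v z = ((z - a) \<bullet> v) / N z" for v z
  define h2 where "h2 v z = (v \<bullet> v) / N z - 2 * ((z - a) \<bullet> v)\<^sup>2 / (N z)\<^sup>2" for v z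
  have d1: "((\<lambda>t. h (z + t *\<^sub>R v)) has_real_derivative h1 v z) (at 0)" for z v
    unfolding h_def h1_def using N by (auto intro!: derivative_eq_intros dN)
  have dI: "((\<lambda>t. (z + t *\<^sub>R v - a) \<bullet> v) has_real_derivative v \<bullet> v) (at 0)" for z v
  proof -
    have "(z + t *\<^sub>R v - a) \<bullet> v = (z - a) \<bullet> v + t * (v \<bullet> v)" for t by (simp add: inner_simps)
    then show ?thesis by (auto intro!: derivative_eq_intros)
  qed
  have d2: "((\<lambda>t. h1 v (z + t *\<^sub>R v)) has_real_derivative h2 v z) (at 0)" for z v
    unfolding h1_def h2_def using N
    by (auto intro!: derivative_eq_intros dN dI simp: power2_eq_square field_simps)
  have cont: "continuous_on UNIV h" "continuous_on UNIV (h1 v)" "continuous_on UNIV (h2 v)" for v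
    unfolding h_def h1_def h2_def using N unfolding N_def by (auto intro!: continuous_intros)
  let ?d = "\<lambda>v z. frechet_derivative (\<lambda>z. frechet_derivative \<phi> (at z) v) (at z) v"
  note parts = integral_by_parts_twice[OF \<phi> K(1) subset_UNIV K(2) open_UNIV d1 d2 cont]
  have lap: "h z * laplacian \<phi> z = h z * ?d 1 z + h z * ?d \<i> z" for z
    by (simp add: laplacian_def distrib_left)
  have sum: "\<phi> z * (2 * e / (N z)\<^sup>2) = \<phi> z * h2 1 z + \<phi> z * h2 \<i> z" for z
  proof -
    have "N z = (Re (z - a))\<^sup>2 + (Im (z - a))\<^sup>2 + e" unfolding N_def cmod_power2 ..
    from laplacian_log_identity[OF N(2) this]
    have "h2 1 z + h2 \<i> z = 2 * e / (N z)\<^sup>2"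
      by (simp add: h2_def inner_complex_def)
    then show ?thesis by (simp add: distrib_left[symmetric])
  qed
  show "integrable lborel (\<lambda>z. ln ((norm (z - a))\<^sup>2 + e) / 2 * laplacian \<phi> z)"
  proof -
    have "integrable lborel (\<lambda>z. h z * laplacian \<phi> z)"
      unfolding lap by (intro Bochner_Integration.integrable_add parts(1))
    then show ?thesis unfolding h_def N_def .
  qed
  have "(\<integral>z. h z * laplacian \<phi> z \<partial>lborel) = (\<integral>z. \<phi> z * (2 * e / (N z)\<^sup>2) \<partial>lborel)"
    unfolding lap sum using parts[of 1] parts[of \<i>]
    by (simp add: Bochner_Integration.integral_add)
  then show "(\<integral>z. ln ((norm (z - a))\<^sup>2 + e) / 2 * laplacian \<phi> z \<partial>lborel)
      = (\<integral>z. \<phi> z * (2 * e / ((norm (z - a))\<^sup>2 + e)\<^sup>2) \<partial>lborel)"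
    unfolding h_def N_def .
qed

text \<open>Regularize with e = c^2 and let c tend to 0. The substitution z = a + c w turns the
  regularized Laplacian into a fixed kernel of mass 2 \<pi>, so one side tends to 2 \<pi> \<phi>(a);
  on the other side the logarithms converge under an integrable majorant.\<close>

lemma integral_log_laplacian:
  assumes \<phi>: "smooth \<phi>" and K: "compact K" "\<And>z. z \<notin> K \<Longrightarrow> \<phi> z = 0"
  shows "integrable lborel (\<lambda>z. ln (norm (z - a)) * laplacian \<phi> z)"
    "(\<integral>z. ln (norm (z - a)) * laplacian \<phi> z \<partial>lborel) = 2 * pi * \<phi> a"
proof -
  have cK: "closed K" by (rule compact_imp_closed[OF K(1)])
  have \<phi>m [measurable]: "\<phi> \<in> borel_measurable borel"
    by (intro borel_measurable_continuous_onI smooth_continuous \<phi>)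
  obtain B where B: "\<And>z. \<bar>laplacian \<phi> z\<bar> \<le> B"
    using laplacian_bounded[OF \<phi> K] by blast
  obtain C where C: "\<And>z. \<bar>\<phi> z\<bar> \<le> C" "0 \<le> C"
    using bounded_compact_support[OF K(1) smooth_continuous[OF \<phi>] K(2)] by blast
  obtain R where R: "K \<subseteq> cball a R"
    using bounded_subset_ballD[OF compact_imp_bounded[OF K(1)], of a] ball_subset_cball by blast
  define c where "c n = inverse (real (Suc n))" for n
  have c: "0 < c n" "c n \<le> 1" for n by (auto simp: c_def field_simps)
  have c_lim: "c \<longlonglongrightarrow> 0" unfolding c_def[abs_def] by (rule LIMSEQ_inverse_real_of_nat)
  define L where "L n z = ln ((norm (z - a))\<^sup>2 + (c n)\<^sup>2) / 2 * laplacian \<phi> z" for n z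
  define P where "P n w = \<phi> (a + c n *\<^sub>R w) * (2 / ((norm w)\<^sup>2 + 1)\<^sup>2)" for n w
  have L: "integrable lborel (L n)" and LP: "integral\<^sup>L lborel (L n) = integral\<^sup>L lborel (P n)" for n
  proof -
    let ?I = "\<lambda>w. \<phi> (a + c n *\<^sub>R w) * (2 * (c n)\<^sup>2 / ((norm (a + c n *\<^sub>R w - a))\<^sup>2 + (c n)\<^sup>2)\<^sup>2)"
    have e: "(c n)\<^sup>2 > 0" using c(1)[of n] by simp
    show "integrable lborel (L n)"
      unfolding L_def[abs_def] by (rule integral_regularized_log_laplacian[OF \<phi> K e])
    have "integral\<^sup>L lborel (L n) = (\<integral>z. \<phi> z * (2 * (c n)\<^sup>2 / ((norm (z - a))\<^sup>2 + (c n)\<^sup>2)\<^sup>2) \<partial>lborel)"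
      unfolding L_def[abs_def] by (rule integral_regularized_log_laplacian[OF \<phi> K e])
    also have "\<dots> = (c n)\<^sup>2 * (\<integral>w. ?I w \<partial>lborel)"
      by (rule lborel_integral_scale[OF _ c(1)]) (use \<phi>m in measurable)
    also have "\<dots> = (\<integral>w. (c n)\<^sup>2 * ?I w \<partial>lborel)"
      by (rule integral_mult_right_zero[symmetric])
    also have "\<dots> = integral\<^sup>L lborel (P n)"
    proof (rule Bochner_Integration.integral_cong[OF refl])
      fix w
      have "(norm (a + c n *\<^sub>R w - a))\<^sup>2 + (c n)\<^sup>2 = (c n)\<^sup>2 * ((norm w)\<^sup>2 + 1)"
        using c[of n] by (simp add: power_mult_distrib algebra_simps)
      then have "(c n)\<^sup>2 * ?I w
         = (c n)\<^sup>2 * (\<phi> (a + c n *\<^sub>R w) * (2 * (c n)\<^sup>2 / ((c n)\<^sup>2 * ((norm w)\<^sup>2 + 1))\<^sup>2))" by simp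
      also have "\<dots> = P n w"
        using c[of n] e unfolding P_def by (simp add: power_mult_distrib power2_eq_square)
      finally show "(c n)\<^sup>2 * ?I w = P n w" .
    qed
    finally show "integral\<^sup>L lborel (L n) = integral\<^sup>L lborel (P n)" .
  qed
  have kernel: "integrable lborel (\<lambda>w::complex. 2 / ((norm w)\<^sup>2 + 1)\<^sup>2)"
    "(\<integral>w. 2 / ((norm (w::complex))\<^sup>2 + 1)\<^sup>2 \<partial>lborel) = 2 * pi"
    using has_bochner_integral_poisson_kernel by (auto simp: has_bochner_integral_iff)
  have P_lim: "(\<lambda>n. integral\<^sup>L lborel (P n)) \<longlonglongrightarrow> (\<integral>w. \<phi> a * (2 / ((norm (w::complex))\<^sup>2 + 1)\<^sup>2) \<partial>lborel)"
  proof (rule integral_dominated_convergence[where w = "\<lambda>w. C * (2 / ((norm w)\<^sup>2 + 1)\<^sup>2)"])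
    show "integrable lborel (\<lambda>w::complex. C * (2 / ((norm w)\<^sup>2 + 1)\<^sup>2))"
      using kernel(1) by (rule integrable_mult_right)
    show "AE w in lborel. (\<lambda>n. P n w) \<longlonglongrightarrow> \<phi> a * (2 / ((norm w)\<^sup>2 + 1)\<^sup>2)"
    proof (rule AE_I2)
      fix w
      have "(\<lambda>n. a + c n *\<^sub>R w) \<longlonglongrightarrow> a + 0 *\<^sub>R w" by (intro tendsto_intros c_lim)
      moreover have "isCont \<phi> a" using smoothD(1)[OF \<phi>] has_derivative_continuous by blast
      ultimately have "(\<lambda>n. \<phi> (a + c n *\<^sub>R w)) \<longlonglongrightarrow> \<phi> a" by (auto intro: isCont_tendsto_compose)
      then show "(\<lambda>n. P n w) \<longlonglongrightarrow> \<phi> a * (2 / ((norm w)\<^sup>2 + 1)\<^sup>2)"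
        unfolding P_def by (intro tendsto_mult tendsto_const)
    qed
    show "AE w in lborel. norm (P n w) \<le> C * (2 / ((norm w)\<^sup>2 + 1)\<^sup>2)" for n
      unfolding P_def norm_mult using C by (intro AE_I2 mult_mono) auto
    show "P n \<in> borel_measurable lborel" for n
      unfolding P_def[abs_def]
      by (auto intro!: borel_measurable_times borel_measurable_continuous_onI continuous_intros
         continuous_on_compose2[OF smooth_continuous[OF \<phi>], of UNIV])
  qed simp
  \<comment> \<open>A majorant uniform in n: from below the regularized logarithm exceeds ln |z - a|
    \<ge> - 1 / |z - a|, from above it is at most R^2 + 1 on the support.\<close>
  define W where "W z = (indicator (cball a R) z * (1 / norm (z - a)) + indicator (cball a R) z * (R\<^sup>2 + 1)) * B" for z
  have L_bound: "norm (L n z) \<le> W z" if z: "z \<noteq> a" for n z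
  proof (cases "z \<in> K")
    case True
    with R have zR: "norm (z - a) \<le> R" by (auto simp: dist_norm norm_minus_commute)
    let ?q = "(norm (z - a))\<^sup>2"
    have q: "0 < ?q" "?q \<le> R\<^sup>2" using z zR by (auto intro!: power_mono)
    have c2: "0 < (c n)\<^sup>2" "(c n)\<^sup>2 \<le> 1" using c[of n] by (auto simp: power_le_one less_imp_le)
    have "ln (?q + (c n)\<^sup>2) \<le> ?q + (c n)\<^sup>2 - 1" using q c2 by (intro ln_le_minus_one add_pos_pos)
    then have up: "ln (?q + (c n)\<^sup>2) / 2 \<le> R\<^sup>2 + 1" using q c2 by linarith
    have "ln ?q \<le> ln (?q + (c n)\<^sup>2)" using q c2 by (intro ln_mono) auto
    moreover have "ln ?q = 2 * ln (norm (z - a))" using z by (simp add: ln_realpow)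
    moreover have "- ln (norm (z - a)) \<le> 1 / norm (z - a)"
      using ln_le_minus_one[of "1 / norm (z - a)"] z by (simp add: ln_div)
    ultimately have low: "- (ln (?q + (c n)\<^sup>2) / 2) \<le> 1 / norm (z - a)" by simp
    have "\<bar>ln (?q + (c n)\<^sup>2) / 2\<bar> \<le> 1 / norm (z - a) + (R\<^sup>2 + 1)"
    proof -
      have "0 \<le> 1 / norm (z - a)" "0 \<le> R\<^sup>2" by simp_all
      with up low show ?thesis by linarith
    qed
    then have "norm (L n z) \<le> (1 / norm (z - a) + (R\<^sup>2 + 1)) * B"
      unfolding L_def real_norm_def abs_mult using B[of z] by (intro mult_mono) auto
    then show ?thesis using True R by (auto simp: W_def)
  next
    case False
    have "B \<ge> 0" using B[of z] by linarith
    then show ?thesis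
      using laplacian_zero_outside[OF \<phi> cK K(2) False] by (simp add: L_def W_def)
  qed
  have W: "integrable lborel W"
  proof -
    have "integrable lborel (\<lambda>z. indicator (cball 0 R) (- a + z) * (1 / norm (- a + z)))"
      by (rule lborel_integral_translate(1)[OF integrable_inverse_norm])
    also have "(\<lambda>z. indicator (cball 0 R) (- a + z) * (1 / norm (- a + z)))
       = (\<lambda>z. indicator (cball a R) z * (1 / norm (z - a)))"
      by (auto simp: fun_eq_iff indicator_def dist_norm norm_minus_commute)
    finally have i: "integrable lborel (\<lambda>z. indicator (cball a R) z * (1 / norm (z - a)))" .
    have "integrable lborel (indicator (cball a R) :: complex \<Rightarrow> real)"
      by (rule integrable_real_indicator[OF _ emeasure_lborel_cball_finite]) simp
    with i show ?thesis unfolding W_def[abs_def]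
      by (intro integrable_mult_left Bochner_Integration.integrable_add)
  qed
  have Lm: "L n \<in> borel_measurable lborel" for n using L by (rule borel_measurable_integrable)
  have lim_m: "(\<lambda>z. ln (norm (z - a)) * laplacian \<phi> z) \<in> borel_measurable lborel"
  proof -
    have [measurable]: "laplacian \<phi> \<in> borel_measurable borel"
      by (intro borel_measurable_continuous_onI laplacian_continuous \<phi>)
    show ?thesis by measurable
  qed
  have AEa: "AE z in lborel. z \<noteq> a" by (rule AE_lborel_singleton)
  have AE_lim: "AE z in lborel. (\<lambda>n. L n z) \<longlonglongrightarrow> ln (norm (z - a)) * laplacian \<phi> z"
    using AEa
  proof eventually_elim
    case (elim z)
    have "(\<lambda>n. ln ((norm (z - a))\<^sup>2 + (c n)\<^sup>2) / 2) \<longlonglongrightarrow> ln ((norm (z - a))\<^sup>2 + 0\<^sup>2) / 2"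
      using elim by (intro tendsto_intros c_lim) auto
    moreover have "ln ((norm (z - a))\<^sup>2 + 0\<^sup>2) / 2 = ln (norm (z - a))"
      using elim by (simp add: ln_realpow)
    ultimately show ?case unfolding L_def by (metis tendsto_mult_right)
  qed
  have AE_bound: "AE z in lborel. norm (L n z) \<le> W z" for n
    using AEa by eventually_elim (rule L_bound)
  show "integrable lborel (\<lambda>z. ln (norm (z - a)) * laplacian \<phi> z)"
    by (rule integrable_dominated_convergence[OF lim_m Lm W AE_lim AE_bound])
  have "(\<lambda>n. integral\<^sup>L lborel (L n)) \<longlonglongrightarrow> (\<integral>z. ln (norm (z - a)) * laplacian \<phi> z \<partial>lborel)"
    by (rule integral_dominated_convergence[OF lim_m Lm W AE_lim AE_bound])
  from LIMSEQ_unique[OF this[unfolded LP] P_lim]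
  show "(\<integral>z. ln (norm (z - a)) * laplacian \<phi> z \<partial>lborel) = 2 * pi * \<phi> a"
    by (simp only: integral_mult_right_zero kernel(2) mult.commute)
qed

text \<open>The second derivative of Re H along v is Re (H'' v^2), so the contributions of v = 1 and
  v = i are opposite.\<close>

lemma integral_harmonic_laplacian:
  assumes \<phi>: "smooth \<phi>" and K: "compact K" "K \<subseteq> U" "\<And>z. z \<notin> K \<Longrightarrow> \<phi> z = 0"
    and U: "open U" and H: "H holomorphic_on U"
  shows "integrable lborel (\<lambda>z. Re (H z) * laplacian \<phi> z)"
    "(\<integral>z. Re (H z) * laplacian \<phi> z \<partial>lborel) = 0"
proof -
  define h1 where "h1 v z = Re (deriv H z * v)" for v z
  define h2 where "h2 v z = Re (deriv (deriv H) z * v * v)" for v z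
  have H': "deriv H holomorphic_on U" and H'': "deriv (deriv H) holomorphic_on U"
    using H U by (auto intro!: holomorphic_deriv)
  have dir: "((\<lambda>t. Re (F (z + t *\<^sub>R v) * w)) has_real_derivative Re (deriv F z * v * w)) (at 0)"
    if F: "F holomorphic_on U" and z: "z \<in> U" for F z v w
  proof -
    have 1: "(F has_field_derivative deriv F z) (at (z + of_real 0 * v))"
      using holomorphic_derivI[OF F U z] by simp
    have 2: "((\<lambda>t. z + of_real t * v) has_vector_derivative v) (at 0)"
      unfolding has_vector_derivative_def by (auto intro!: derivative_eq_intros simp: scaleR_conv_of_real)
    have "((\<lambda>t. F (z + of_real t * v)) has_vector_derivative v * deriv F z) (at 0)"
      using field_vector_diff_chain_at[OF 2 1] unfolding o_def .
    then have "((\<lambda>t. F (z + of_real t * v)) has_vector_derivative deriv F z * v) (at 0)"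
      by (simp only: mult.commute)
    then have "((\<lambda>t. F (z + of_real t * v) * w) has_vector_derivative deriv F z * v * w) (at 0)"
      by (rule has_vector_derivative_mult_left)
    from bounded_linear.has_vector_derivative[OF bounded_linear_Re this]
    show ?thesis by (simp add: has_real_derivative_iff_has_vector_derivative scaleR_conv_of_real)
  qed
  have d1: "((\<lambda>t. Re (H (z + t *\<^sub>R v))) has_real_derivative h1 v z) (at 0)" if "z \<in> U" for z v
    using dir[OF H that, of v 1] by (simp add: h1_def)
  have d2: "((\<lambda>t. h1 v (z + t *\<^sub>R v)) has_real_derivative h2 v z) (at 0)" if "z \<in> U" for z v
    using dir[OF H' that, of v v] by (simp add: h1_def h2_def)
  have cont: "continuous_on U (\<lambda>z. Re (H z))" "continuous_on U (h1 v)" "continuous_on U (h2 v)" for v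
    unfolding h1_def h2_def
    by (intro continuous_intros holomorphic_on_imp_continuous_on H H' H'')+
  note parts = integral_by_parts_twice[OF \<phi> K U d1 d2 cont]
  let ?d = "\<lambda>v z. frechet_derivative (\<lambda>z. frechet_derivative \<phi> (at z) v) (at z) v"
  have lap: "Re (H z) * laplacian \<phi> z = Re (H z) * ?d 1 z + Re (H z) * ?d \<i> z" for z
    by (simp add: laplacian_def distrib_left)
  show "integrable lborel (\<lambda>z. Re (H z) * laplacian \<phi> z)"
    unfolding lap by (intro Bochner_Integration.integrable_add parts(1))
  have "(\<integral>z. Re (H z) * laplacian \<phi> z \<partial>lborel) = (\<integral>z. \<phi> z * h2 1 z + \<phi> z * h2 \<i> z \<partial>lborel)"
    unfolding lap using parts[of 1] parts[of \<i>] by (simp add: Bochner_Integration.integral_add)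
  also have "\<dots> = 0" by (simp add: h2_def)
  finally show "(\<integral>z. Re (H z) * laplacian \<phi> z \<partial>lborel) = 0" .
qed

section \<open>Uniqueness for the Dirichlet problem with a point source\<close>

lemma integral_pos_if_pos_on_open:
  fixes f :: "'a::euclidean_space \<Rightarrow> real"
  assumes f: "integrable lborel f" "\<And>z. 0 \<le> f z" and U: "open U" "z0 \<in> U" "\<And>z. z \<in> U \<Longrightarrow> 0 < f z"
  shows "0 < integral\<^sup>L lborel f"
proof (rule ccontr)
  assume "\<not> 0 < integral\<^sup>L lborel f"
  moreover have "0 \<le> integral\<^sup>L lborel f" using f(2) by (intro integral_nonneg_AE) auto
  ultimately have "integral\<^sup>L lborel f = 0" by linarith
  then have "AE z in lborel. f z = 0"
    using integral_nonneg_eq_0_iff_AE[OF f(1)] f(2) by auto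
  then have "AE z in lborel. z \<notin> U" by eventually_elim (use U(3) in force)
  moreover have "U \<in> sets lborel" using U(1) by simp
  ultimately have "emeasure lborel U = 0"
    by (subst (asm) AE_iff_measurable[of U]) auto
  moreover obtain e where e: "e > 0" "ball z0 e \<subseteq> U" using U open_contains_ball by blast
  ultimately have "emeasure lborel (ball z0 e) = 0"
    using emeasure_mono[OF e(2), of lborel] U(1) by simp
  with e show False
    using emeasure_ball[of e z0] unit_ball_vol_pos[of "real DIM('a)"] by simp
qed

section \<open>Properties of the annular kernels\<close>

lemma annular_kernel_nonneg: "0 < r \<Longrightarrow> 0 \<le> annular_kernel r z"
  by (simp add: annular_kernel_def bump_nonneg)

lemma annular_kernel_pos: "0 < r \<Longrightarrow> r < (norm z)\<^sup>2 \<Longrightarrow> (norm z)\<^sup>2 < 2 * r \<Longrightarrow> 0 < annular_kernel r z"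
  by (simp add: annular_kernel_def bump_pos field_simps)

lemma annular_kernel_eq_0: "0 < r \<Longrightarrow> sqrt (2 * r) \<le> norm z \<Longrightarrow> annular_kernel r z = 0"
  by (auto simp: annular_kernel_def field_simps intro!: bump_eq_0)
    (use real_le_lsqrt sqrt_le_D in fastforce)

lemma annular_kernel_continuous:
  assumes "0 < r" shows "continuous_on UNIV (annular_kernel r)"
proof -
  have "continuous_on UNIV (\<lambda>z. bump ((norm z)\<^sup>2 / r) / r)"
    using assms by (intro continuous_intros continuous_on_compose2[OF real_smooth_continuous[OF real_smooth_bump, of UNIV]]) auto
  then show ?thesis by (simp add: annular_kernel_def[abs_def])
qed

lemma annular_kernel_bounded:
  assumes "0 < r" obtains B where "\<And>z. \<bar>annular_kernel r z\<bar> \<le> B"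
proof (rule bounded_compact_support[of "cball 0 (sqrt (2 * r))" "annular_kernel r"])
  show "continuous_on (cball 0 (sqrt (2 * r))) (annular_kernel r)"
    by (rule continuous_on_subset[OF annular_kernel_continuous[OF assms]]) simp
qed (use that in \<open>auto intro!: annular_kernel_eq_0 assms\<close>)

lemma annular_kernel_integrable:
  assumes "0 < r" shows "integrable lborel (\<lambda>z. annular_kernel r (z - x))"
proof (rule integrable_compact_support[of "cball x (sqrt (2 * r))"])
  show "continuous_on (cball x (sqrt (2 * r))) (\<lambda>z. annular_kernel r (z - x))"
    by (intro continuous_on_compose2[OF annular_kernel_continuous[OF assms]] continuous_intros) auto
qed (auto intro!: annular_kernel_eq_0 assms simp: dist_norm norm_minus_commute)

lemma integral_annular_kernel:
  assumes "0 < r"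
  shows "(\<integral>z. annular_kernel r (z - x) \<partial>lborel) = integral\<^sup>L lborel (annular_kernel 1)"
proof -
  have "(\<integral>z. annular_kernel r (z - x) \<partial>lborel) = (sqrt r)\<^sup>2 * (\<integral>w. annular_kernel r (x + sqrt r *\<^sub>R w - x) \<partial>lborel)"
    using assms by (intro lborel_integral_scale borel_measurable_integrable[OF annular_kernel_integrable, simplified]) auto
  also have "\<dots> = (\<integral>w. (sqrt r)\<^sup>2 * annular_kernel r (x + sqrt r *\<^sub>R w - x) \<partial>lborel)"
    by (rule integral_mult_right_zero[symmetric])
  also have "\<dots> = integral\<^sup>L lborel (annular_kernel 1)"
    using assms by (intro Bochner_Integration.integral_cong) (auto simp: annular_kernel_def power_mult_distrib)
  finally show ?thesis .
qed

lemma integral_annular_kernel_pos: "0 < integral\<^sup>L lborel (annular_kernel 1)"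
proof (rule integral_pos_if_pos_on_open)
  let ?U = "{z::complex. 1 < (norm z)\<^sup>2} \<inter> {z. (norm z)\<^sup>2 < 2}"
  show "integrable lborel (annular_kernel 1)" using annular_kernel_integrable[of 1 0] by simp
  show "open ?U" by (intro open_Int open_Collect_less continuous_intros)
  \<comment> \<open>A point of the open annulus: (6/5)^2 = 36/25 lies between 1 and 2.\<close>
  show "complex_of_real (6 / 5) \<in> ?U" by (simp add: power2_eq_square)
qed (auto intro: annular_kernel_pos annular_kernel_nonneg)

section \<open>Weakly harmonic functions: mean values, removable points, maximum principle\<close>

definition weakly_harmonic :: "complex set \<Rightarrow> (complex \<Rightarrow> real) \<Rightarrow> bool" where
  "weakly_harmonic \<Omega> w \<longleftrightarrow> set_integrable lborel \<Omega> w \<and>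
     (\<forall>\<phi>\<in>test_functions \<Omega>. (LINT z:\<Omega>|lborel. w z * laplacian \<phi> z) = 0)"

text \<open>Not divided by the mass of the kernel: the weighted mean is this value over the integral
  of \<open>annular_kernel 1\<close>.\<close>

definition annular_mean :: "complex set \<Rightarrow> (complex \<Rightarrow> real) \<Rightarrow> real \<Rightarrow> complex \<Rightarrow> real" where
  "annular_mean \<Omega> w r x = (\<integral>z. indicator \<Omega> z * w z * annular_kernel r (z - x) \<partial>lborel)"

lemma annular_mean_integrable:
  assumes w: "set_integrable lborel \<Omega> w" and r: "0 < r"
  shows "integrable lborel (\<lambda>z. indicator \<Omega> z * w z * annular_kernel r (z - x))"
proof -
  obtain B where B: "\<And>z. \<bar>annular_kernel r z\<bar> \<le> B" using annular_kernel_bounded[OF r] by blast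
  have i: "integrable lborel (\<lambda>z. indicator \<Omega> z * w z)"
    using w by (simp add: set_integrable_def)
  have "integrable lborel (\<lambda>z. (indicator \<Omega> z * w z) * B)"
    by (rule integrable_mult_left[OF i])
  then show ?thesis
  proof (rule Bochner_Integration.integrable_bound)
    show "(\<lambda>z. indicator \<Omega> z * w z * annular_kernel r (z - x)) \<in> borel_measurable lborel"
      by (intro borel_measurable_times borel_measurable_integrable[OF i] borel_measurable_integrable[OF annular_kernel_integrable[OF r]])
    show "AE z in lborel. norm (indicator \<Omega> z * w z * annular_kernel r (z - x)) \<le> norm (indicator \<Omega> z * w z * B)"
      using B unfolding norm_mult by (intro AE_I2 mult_left_mono) (auto intro: order_trans[OF _ abs_ge_self])
  qed
qed

lemma annular_mean_radius:
  assumes w: "weakly_harmonic \<Omega> w" and r: "0 < \<delta>" "0 < r" "cball x (sqrt (2 * max \<delta> r)) \<subseteq> \<Omega>"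
  shows "annular_mean \<Omega> w \<delta> x = annular_mean \<Omega> w r x"
proof -
  obtain \<phi> where \<phi>: "\<phi> \<in> test_functions \<Omega>"
    "\<And>z. laplacian \<phi> z = 4 * (annular_kernel \<delta> (z - x) - annular_kernel r (z - x))"
    using radial_test_function[OF r] by blast
  have i: "set_integrable lborel \<Omega> w" and "(LINT z:\<Omega>|lborel. w z * laplacian \<phi> z) = 0"
    using w \<phi>(1) by (auto simp: weakly_harmonic_def)
  then have "(\<integral>z. 4 * (indicator \<Omega> z * w z * annular_kernel \<delta> (z - x) - indicator \<Omega> z * w z * annular_kernel r (z - x)) \<partial>lborel) = 0"
    unfolding set_lebesgue_integral_def \<phi>(2) by (simp add: algebra_simps)
  then show ?thesis unfolding annular_mean_def
    by (simp add: Bochner_Integration.integral_diff annular_mean_integrable[OF i] r)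
qed

text \<open>The mean does not change when the radius shrinks, and on a small annulus continuity
  makes w nearly equal to w x. The mass of the kernel is the same at every radius, so the error is
  at most any e > 0.\<close>

lemma annular_mean_value:
  assumes w: "weakly_harmonic \<Omega> w" and r: "0 < r" "cball x (sqrt (2 * r)) \<subseteq> \<Omega>" and cont: "isCont w x"
  shows "annular_mean \<Omega> w r x = integral\<^sup>L lborel (annular_kernel 1) * w x"
proof -
  let ?C = "integral\<^sup>L lborel (annular_kernel 1)"
  have C: "0 < ?C" by (rule integral_annular_kernel_pos)
  have i: "set_integrable lborel \<Omega> w" using w by (simp add: weakly_harmonic_def)
  have "\<bar>annular_mean \<Omega> w r x - ?C * w x\<bar> \<le> e" if e: "e > 0" for e
  proof -
    obtain d where d: "d > 0" "\<And>z. dist z x < d \<Longrightarrow> dist (w z) (w x) < e / ?C"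
      using cont e C unfolding continuous_at_eps_delta by (metis divide_pos_pos)
    \<comment> \<open>Gives 2 \<delta> \<le> d^2 / 2 < d^2, so the kernel lives where w is within e
      / ?C of w x.\<close>
    define \<delta> where "\<delta> = min r (d\<^sup>2 / 4)"
    have \<delta>: "0 < \<delta>" "\<delta> \<le> r" using r d by (auto simp: \<delta>_def)
    have "sqrt (2 * \<delta>) < d"
    proof (rule real_less_lsqrt)
      have "2 * \<delta> \<le> d\<^sup>2 / 2" by (auto simp: \<delta>_def)
      also have "\<dots> < d\<^sup>2" using d by simp
      finally show "2 * \<delta> < d\<^sup>2" .
    qed (use d in auto)
    note sd = this
    let ?I = "\<lambda>z. indicator \<Omega> z * w z * annular_kernel \<delta> (z - x) - w x * annular_kernel \<delta> (z - x)"
    have sub: "cball x (sqrt (2 * \<delta>)) \<subseteq> \<Omega>"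
      using subset_cball[of "sqrt (2 * \<delta>)" "sqrt (2 * r)" x] r(2) \<delta> by simp
    have "annular_mean \<Omega> w r x = annular_mean \<Omega> w \<delta> x"
      using r \<delta> by (intro annular_mean_radius[OF w]) (auto simp: max_def)
    then have "annular_mean \<Omega> w r x - ?C * w x
       = annular_mean \<Omega> w \<delta> x - (\<integral>z. w x * annular_kernel \<delta> (z - x) \<partial>lborel)"
      by (simp add: integral_annular_kernel[OF \<delta>(1)])
    also have "\<dots> = (\<integral>z. ?I z \<partial>lborel)"
      unfolding annular_mean_def
      by (intro Bochner_Integration.integral_diff[symmetric] annular_mean_integrable i \<delta>
          integrable_mult_right annular_kernel_integrable)
    finally have eq: "annular_mean \<Omega> w r x - ?C * w x
       = (\<integral>z. ?I z \<partial>lborel)" .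
    have "norm (\<integral>z. ?I z \<partial>lborel)
       \<le> (\<integral>z. (e / ?C) * annular_kernel \<delta> (z - x) \<partial>lborel)"
    proof (rule Bochner_Integration.integral_norm_bound_integral)
      fix z
      have nn: "0 \<le> annular_kernel \<delta> (z - x)" by (rule annular_kernel_nonneg[OF \<delta>(1)])
      show "norm (?I z)
         \<le> (e / ?C) * annular_kernel \<delta> (z - x)"
      proof (cases "norm (z - x) < sqrt (2 * \<delta>)")
        case True
        then have "z \<in> \<Omega>" "dist z x < d" using sub sd by (auto simp: dist_norm norm_minus_commute subset_eq)
        then have "\<bar>w z - w x\<bar> \<le> e / ?C" using d(2)[of z] by (simp add: dist_real_def)
        then have "\<bar>w z - w x\<bar> * annular_kernel \<delta> (z - x) \<le> (e / ?C) * annular_kernel \<delta> (z - x)"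
          using nn by (rule mult_right_mono)
        then show ?thesis using \<open>z \<in> \<Omega>\<close> nn by (simp add: left_diff_distrib[symmetric] abs_mult)
      next
        case False
        then show ?thesis using annular_kernel_eq_0[OF \<delta>(1), of "z - x"] by simp
      qed
    qed (intro Bochner_Integration.integrable_diff annular_mean_integrable i \<delta>
          integrable_mult_right annular_kernel_integrable)+
    also have "\<dots> = e" using C by (simp add: integral_annular_kernel[OF \<delta>(1)])
    finally show ?thesis using eq by simp
  qed
  then have "\<bar>annular_mean \<Omega> w r x - ?C * w x\<bar> \<le> 0" by (rule field_le_epsilon) simp
  then show ?thesis by simp
qed

lemma annular_mean_continuous:
  assumes w: "set_integrable lborel \<Omega> w" and r: "0 < r"
  shows "isCont (annular_mean \<Omega> w r) x"
proof (rule continuous_at_sequentiallyI)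
  fix s assume s: "s \<longlonglongrightarrow> x"
  obtain B where B: "\<And>z. \<bar>annular_kernel r z\<bar> \<le> B" using annular_kernel_bounded[OF r] by blast
  have i: "integrable lborel (\<lambda>z. indicator \<Omega> z * w z)"
    using w by (simp add: set_integrable_def)
  show "(\<lambda>n. annular_mean \<Omega> w r (s n)) \<longlonglongrightarrow> annular_mean \<Omega> w r x"
    unfolding annular_mean_def
  proof (rule integral_dominated_convergence[where w = "\<lambda>z. \<bar>indicator \<Omega> z * w z\<bar> * B"])
    show "integrable lborel (\<lambda>z. \<bar>indicator \<Omega> z * w z\<bar> * B)"
      by (intro integrable_mult_left integrable_abs i)
    have "isCont (annular_kernel r) z" for z
      using annular_kernel_continuous[OF r] continuous_on_eq_continuous_at by blast
    then show "AE z in lborel. (\<lambda>n. indicator \<Omega> z * w z * annular_kernel r (z - s n))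
        \<longlonglongrightarrow> indicator \<Omega> z * w z * annular_kernel r (z - x)"
      by (intro AE_I2 tendsto_mult tendsto_const isCont_tendsto_compose[of _ "annular_kernel r"] tendsto_diff s)
    show "AE z in lborel. norm (indicator \<Omega> z * w z * annular_kernel r (z - s n)) \<le> \<bar>indicator \<Omega> z * w z\<bar> * B" for n
      using B unfolding norm_mult real_norm_def abs_mult by (intro AE_I2 mult_left_mono) auto
  qed (intro borel_measurable_integrable annular_mean_integrable[OF w r])+
qed

text \<open>The equation holds across p in the sense of distributions. With one fixed radius, the
  annular mean recovers w at every nearby point other than p and is continuous at p too; its value
  there is the missing value of w. Changing w at one point does not affect integrals.\<close>

lemma weakly_harmonic_removable:
  assumes \<Omega>: "open \<Omega>" "p \<in> \<Omega>" and w: "weakly_harmonic \<Omega> w" and cont: "continuous_on (\<Omega> - {p}) w"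
  obtains c where "continuous_on \<Omega> (w(p := c))" "weakly_harmonic \<Omega> (w(p := c))"
proof -
  let ?C = "integral\<^sup>L lborel (annular_kernel 1)"
  have C: "0 < ?C" by (rule integral_annular_kernel_pos)
  have i: "set_integrable lborel \<Omega> w" using w by (simp add: weakly_harmonic_def)
  have isC: "isCont w x" if "x \<in> \<Omega>" "x \<noteq> p" for x
    using cont that \<Omega> by (simp add: continuous_on_eq_continuous_at open_delete)
  obtain \<rho> where \<rho>: "0 < \<rho>" "cball p \<rho> \<subseteq> \<Omega>" using \<Omega> open_contains_cball by blast
  \<comment> \<open>The kernel then reaches to distance \<rho> / 2, so around each centre within
    \<rho> / 2 of p it stays in \<open>cball p \<rho>\<close>.\<close>
  define r where "r = \<rho>\<^sup>2 / 8"
  have r: "0 < r" "sqrt (2 * r) = \<rho> / 2" using \<rho> by (auto simp: r_def real_sqrt_divide)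
  define c where "c = annular_mean \<Omega> w r p / ?C"
  let ?W = "w(p := c)"
  have W: "?W x = annular_mean \<Omega> w r x / ?C" if "x \<in> ball p (\<rho> / 2)" for x
  proof (cases "x = p")
    case False
    have "cball x (\<rho> / 2) \<subseteq> cball p \<rho>"
    proof
      fix y assume "y \<in> cball x (\<rho> / 2)"
      then show "y \<in> cball p \<rho>" using that dist_triangle[of p y x] by simp
    qed
    then have sub: "cball x (sqrt (2 * r)) \<subseteq> \<Omega>" using \<rho> r by auto
    moreover have "x \<in> cball x (sqrt (2 * r))" using r by simp
    ultimately have "x \<in> \<Omega>" by (rule subsetD)
    note sub this
    then show ?thesis
      using annular_mean_value[OF w r(1) sub] isC False C by simp
  qed (simp add: c_def)
  have "isCont ?W x" if "x \<in> \<Omega>" for x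
  proof (cases "x = p")
    case True
    have "isCont (\<lambda>x. annular_mean \<Omega> w r x / ?C) p"
      using C by (intro continuous_divide annular_mean_continuous i r) auto
    moreover have "eventually (\<lambda>x. annular_mean \<Omega> w r x / ?C = ?W x) (nhds p)"
      using \<rho> W by (intro eventually_nhds_in_open[THEN eventually_mono, of "ball p (\<rho> / 2)"]) auto
    ultimately show ?thesis using isCont_cong True by metis
  next
    case False
    have "eventually (\<lambda>z. ?W z = w z) (nhds x)"
      using False by (intro eventually_nhds_in_open[THEN eventually_mono, of "- {p}"]) auto
    from isCont_cong[OF this] show ?thesis using isC[OF that False] by blast
  qed
  then have "continuous_on \<Omega> ?W" by (intro continuous_at_imp_continuous_on ballI)
  moreover have "weakly_harmonic \<Omega> ?W"
  proof -
    have eq: "(\<lambda>z. indicator \<Omega> z *\<^sub>R ?W z) = (\<lambda>z. indicator \<Omega> z * w z + indicator {p} z * (c - w p))"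
      using \<Omega>(2) by (auto simp: fun_eq_iff indicator_def)
    have i0: "integrable lborel (\<lambda>z. indicator \<Omega> z * w z)" using i by (simp add: set_integrable_def)
    have "integrable lborel (\<lambda>z. indicator \<Omega> z * w z + indicator {p} z * (c - w p))"
      by (intro Bochner_Integration.integrable_add i0 integrable_mult_left integrable_real_indicator) auto
    then have "set_integrable lborel \<Omega> ?W" unfolding set_integrable_def eq .
    moreover have "(LINT z:\<Omega>|lborel. ?W z * laplacian \<phi> z) = 0" if \<phi>: "\<phi> \<in> test_functions \<Omega>" for \<phi>
    proof -
      have "smooth \<phi>" using \<phi> by (simp add: test_functions_def)
      then have lm: "laplacian \<phi> \<in> borel_measurable lborel"
        by (auto intro!: borel_measurable_continuous_onI laplacian_continuous)
      have m: "(\<lambda>z. indicator \<Omega> z *\<^sub>R (v z * laplacian \<phi> z)) \<in> borel_measurable lborel"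
        if v: "set_integrable lborel \<Omega> v" for v
      proof -
        have "(\<lambda>z. (indicator \<Omega> z *\<^sub>R v z) * laplacian \<phi> z) \<in> borel_measurable lborel"
          using v lm by (intro borel_measurable_times) (auto simp: set_integrable_def)
        then show ?thesis by (simp add: mult.assoc)
      qed
      have "(LINT z:\<Omega>|lborel. ?W z * laplacian \<phi> z) = (LINT z:\<Omega>|lborel. w z * laplacian \<phi> z)"
        unfolding set_lebesgue_integral_def
      proof (rule integral_cong_AE)
        show "AE z in lborel. indicator \<Omega> z *\<^sub>R (?W z * laplacian \<phi> z) = indicator \<Omega> z *\<^sub>R (w z * laplacian \<phi> z)"
          using AE_lborel_singleton[of p] by eventually_elim simp
      qed (intro m \<open>set_integrable lborel \<Omega> ?W\<close> i)+
      then show ?thesis using w \<phi> by (simp add: weakly_harmonic_def)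
    qed
    ultimately show ?thesis by (simp add: weakly_harmonic_def)
  qed
  ultimately show ?thesis by (rule that)
qed

text \<open>Among the maximum points choose one with largest real part. Around it the annulus
  contains points further to the right, where w is strictly smaller, and this contradicts the mean
  value property. The choice replaces a connectedness argument.\<close>

lemma weakly_harmonic_max_principle:
  assumes \<Omega>: "open \<Omega>" "bounded \<Omega>" and w: "weakly_harmonic \<Omega> w" and cont: "continuous_on (closure \<Omega>) w"
    and bd: "\<And>z. z \<in> frontier \<Omega> \<Longrightarrow> w z \<le> 0" and z: "z \<in> \<Omega>"
  shows "w z \<le> 0"
proof (rule ccontr)
  assume pos: "\<not> w z \<le> 0"
  have i: "set_integrable lborel \<Omega> w" using w by (simp add: weakly_harmonic_def)
  have cc: "compact (closure \<Omega>)" using \<Omega>(2) by (simp add: compact_closure)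
  have zc: "z \<in> closure \<Omega>" using z closure_subset by blast
  obtain y where y: "y \<in> closure \<Omega>" "\<And>x. x \<in> closure \<Omega> \<Longrightarrow> w x \<le> w y"
  proof -
    have "closure \<Omega> \<noteq> {}" using z by auto
    from continuous_attains_sup[OF cc this cont] show ?thesis using that by blast
  qed
  define K where "K = {x \<in> closure \<Omega>. w x = w y}"
  have "closed K" unfolding K_def
    by (intro continuous_closed_preimage_constant cont closed_closure)
  moreover have "K \<subseteq> closure \<Omega>" by (auto simp: K_def)
  ultimately have "compact K" using compact_Int_closed[OF cc, of K] by (simp add: Int_absorb1)
  then obtain x where x: "x \<in> K" "\<And>x'. x' \<in> K \<Longrightarrow> Re x' \<le> Re x"
  proof -
    have "K \<noteq> {}" using y(1) by (auto simp: K_def)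
    moreover have "continuous_on K Re" by (intro continuous_intros)
    ultimately show ?thesis using continuous_attains_sup[of K Re] \<open>compact K\<close> that by blast
  qed
  have wx: "w x = w y" "x \<in> closure \<Omega>" using x(1) by (auto simp: K_def)
  have "w y > 0" using y(2)[OF zc] pos by linarith
  then have "x \<notin> frontier \<Omega>" using bd[of x] wx by auto
  then have x\<Omega>: "x \<in> \<Omega>" using wx(2) \<Omega>(1) by (simp add: frontier_def interior_open)
  obtain \<rho> where \<rho>: "0 < \<rho>" "cball x \<rho> \<subseteq> \<Omega>" using \<Omega> x\<Omega> open_contains_cball by blast
  define r where "r = \<rho>\<^sup>2 / 2"
  have r: "0 < r" "sqrt (2 * r) = \<rho>" using \<rho> by (auto simp: r_def)
  have cont\<Omega>: "continuous_on \<Omega> w" by (rule continuous_on_subset[OF cont closure_subset])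
  then have "isCont w x" using \<Omega> x\<Omega> by (simp add: continuous_on_eq_continuous_at)
  then have mean: "annular_mean \<Omega> w r x = integral\<^sup>L lborel (annular_kernel 1) * w x"
    using \<rho> r by (intro annular_mean_value[OF w]) auto
  define n where "n z = w x * annular_kernel r (z - x) - indicator \<Omega> z * w z * annular_kernel r (z - x)" for z
  have "integral\<^sup>L lborel n = w x * (\<integral>z. annular_kernel r (z - x) \<partial>lborel) - annular_mean \<Omega> w r x"
    unfolding n_def[abs_def] annular_mean_def
    by (subst Bochner_Integration.integral_diff)
      (auto intro!: annular_mean_integrable annular_kernel_integrable i r)
  then have n0: "integral\<^sup>L lborel n = 0" by (simp add: mean integral_annular_kernel[OF r(1)])
  let ?U = "(\<Omega> \<inter> w -` {..<w x}) \<inter> ({z. r < (norm (z - x))\<^sup>2} \<inter> {z. (norm (z - x))\<^sup>2 < 2 * r})"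
  \<comment> \<open>To the right of x, with squared distance 3r/2 strictly between r and 2r, hence
    inside the open annulus where the kernel is positive.\<close>
  define z0 where "z0 = x + of_real (sqrt (3 / 2 * r))"
  have nz0: "(norm (z0 - x))\<^sup>2 = 3 / 2 * r" using r by (simp add: z0_def)
  have "norm (z0 - x) \<le> sqrt (2 * r)" using r by (auto simp: z0_def)
  then have z0\<Omega>: "z0 \<in> \<Omega>" using \<rho> r by (auto simp: dist_norm norm_minus_commute)
  have "Re z0 > Re x" using r by (simp add: z0_def)
  then have "z0 \<notin> K" using x(2)[of z0] by auto
  then have "w z0 < w x" using y(2)[of z0] z0\<Omega> closure_subset wx unfolding K_def by force
  then have z0U: "z0 \<in> ?U" using z0\<Omega> nz0 r by auto
  have n_eq: "n z = (w x - w z) * annular_kernel r (z - x)" if "z \<in> \<Omega>" for z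
    using that by (simp add: n_def left_diff_distrib)
  have "0 < integral\<^sup>L lborel n"
  proof (rule integral_pos_if_pos_on_open[OF _ _ _ z0U])
    show "integrable lborel n" unfolding n_def[abs_def]
      by (intro Bochner_Integration.integrable_diff integrable_mult_right annular_mean_integrable annular_kernel_integrable i r)
    have "open (\<Omega> \<inter> w -` {..<w x})"
      by (rule continuous_open_preimage[OF cont\<Omega> \<Omega>(1) open_lessThan])
    moreover have "open {z. r < (norm (z - x))\<^sup>2}" "open {z. (norm (z - x))\<^sup>2 < 2 * r}"
      by (intro open_Collect_less continuous_intros)+
    ultimately show "open ?U" by (rule open_Int[OF _ open_Int])
    show "0 \<le> n z" for z
    proof (cases "norm (z - x) < sqrt (2 * r)")
      case True
      then have "z \<in> \<Omega>" using \<rho> r by (auto simp: dist_norm norm_minus_commute subset_eq)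
      then show ?thesis using n_eq y(2)[of z] wx closure_subset annular_kernel_nonneg[OF r(1)]
        by (metis diff_ge_0_iff_ge mult_nonneg_nonneg subset_iff)
    qed (simp add: n_def annular_kernel_eq_0[OF r(1)])
    show "0 < n z" if "z \<in> ?U" for z
      using that n_eq[of z] annular_kernel_pos[OF r(1), of "z - x"] by simp
  qed
  with n0 show False by simp
qed

section \<open>Comparison of two solutions with the same source\<close>

lemma zero_outside_support: "z \<notin> closure {z. \<phi> z \<noteq> 0} \<Longrightarrow> \<phi> z = 0"
  using closure_subset[of "{z. \<phi> z \<noteq> 0}"] by auto

lemma test_function_integrable:
  assumes u: "set_integrable lborel \<Omega> u" and \<phi>: "\<phi> \<in> test_functions \<Omega>"
  shows "set_integrable lborel \<Omega> (\<lambda>z. u z * laplacian \<phi> z)"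
proof -
  have sm: "smooth \<phi>" and cK: "compact (closure {z. \<phi> z \<noteq> 0})" using \<phi> by (auto simp: test_functions_def)
  obtain B where B: "\<And>z. \<bar>laplacian \<phi> z\<bar> \<le> B"
    using laplacian_bounded[OF sm cK zero_outside_support[of _ \<phi>]] by blast
  have u': "integrable lborel (\<lambda>z. indicator \<Omega> z * u z)" using u by (simp add: set_integrable_def)
  have "integrable lborel (\<lambda>z. (indicator \<Omega> z * u z) * laplacian \<phi> z)"
  proof (rule Bochner_Integration.integrable_bound[OF integrable_mult_left[OF u', of B]])
    show "(\<lambda>z. indicator \<Omega> z * u z * laplacian \<phi> z) \<in> borel_measurable lborel"
      using borel_measurable_continuous_onI[OF laplacian_continuous[OF sm]]
      by (intro borel_measurable_times borel_measurable_integrable[OF u']) simp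
    show "AE z in lborel. norm (indicator \<Omega> z * u z * laplacian \<phi> z) \<le> norm (indicator \<Omega> z * u z * B)"
      using B unfolding norm_mult by (intro AE_I2 mult_left_mono) (auto intro: order_trans[OF _ abs_ge_self])
  qed
  then show ?thesis by (simp add: set_integrable_def mult.assoc)
qed

text \<open>In u - v the point masses cancel, so the difference is weakly harmonic on all of
  \<Omega> and continuous away from p. Once the value at p is repaired, the maximum principle
  applies, the boundary values being 0.\<close>

lemma point_source_solution_le:
  assumes \<Omega>: "open \<Omega>" "bounded \<Omega>" "p \<in> \<Omega>"
    and u: "point_source_solution \<Omega> p u" and v: "point_source_solution \<Omega> p v"
    and z: "z \<in> closure \<Omega> - {p}"
  shows "u z \<le> v z"
proof (cases "z \<in> \<Omega>")
  case False
  then have "z \<in> frontier \<Omega>" using z \<Omega>(1) by (simp add: frontier_def interior_open)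
  then show ?thesis using u v by (simp add: point_source_solution_def)
next
  case True
  define w where "w z = u z - v z" for z
  have iu: "set_integrable lborel \<Omega> u" and iv: "set_integrable lborel \<Omega> v"
    using u v by (auto simp: point_source_solution_def)
  have "weakly_harmonic \<Omega> w" unfolding weakly_harmonic_def
  proof (intro conjI ballI)
    show "set_integrable lborel \<Omega> w" unfolding w_def using iu iv by (rule set_integral_diff)
    fix \<phi> assume \<phi>: "\<phi> \<in> test_functions \<Omega>"
    have "(LINT z:\<Omega>|lborel. w z * laplacian \<phi> z) =
       (LINT z:\<Omega>|lborel. u z * laplacian \<phi> z) - (LINT z:\<Omega>|lborel. v z * laplacian \<phi> z)"
      unfolding w_def left_diff_distrib
      by (intro set_integral_diff test_function_integrable iu iv \<phi>)
    moreover have "- (LINT z:\<Omega>|lborel. u z * laplacian \<phi> z) = \<phi> p"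
      "- (LINT z:\<Omega>|lborel. v z * laplacian \<phi> z) = \<phi> p"
      using u v \<phi> by (simp_all add: point_source_solution_def)
    ultimately show "(LINT z:\<Omega>|lborel. w z * laplacian \<phi> z) = 0" by linarith
  qed
  moreover have cw: "continuous_on (closure \<Omega> - {p}) w"
    unfolding w_def using u v by (intro continuous_on_diff) (auto simp: point_source_solution_def)
  then have "continuous_on (\<Omega> - {p}) w"
    by (rule continuous_on_subset) (use closure_subset in auto)
  ultimately obtain c where c: "continuous_on \<Omega> (w(p := c))" "weakly_harmonic \<Omega> (w(p := c))"
    using weakly_harmonic_removable[OF \<Omega>(1,3)] by metis
  have "(w(p := c)) z \<le> 0"
  proof (rule weakly_harmonic_max_principle[OF \<Omega>(1,2) c(2) _ _ True])
    show "continuous_on (closure \<Omega>) (w(p := c))"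
      unfolding continuous_on_eq_continuous_within
    proof
      fix x assume x: "x \<in> closure \<Omega>"
      show "continuous (at x within closure \<Omega>) (w(p := c))"
      proof (cases "x = p")
        case True
        then have "isCont (w(p := c)) x"
          using c(1) \<Omega> continuous_on_eq_continuous_at[of \<Omega> "w(p := c)"] by blast
        then show ?thesis by (rule continuous_at_imp_continuous_at_within)
      next
        case False
        have "continuous (at x within closure \<Omega> - {p}) w"
          using cw x False by (simp add: continuous_on_eq_continuous_within)
        moreover have "at x within closure \<Omega> - {p} = at x within closure \<Omega>"
          using False by (intro at_within_nhd[of x "- {p}"]) auto
        ultimately have "continuous (at x within closure \<Omega>) w" by simp
        moreover have "eventually (\<lambda>z. w z = (w(p := c)) z) (at x within closure \<Omega>)"
          using False by (intro eventually_at_topological[THEN iffD2] exI[of _ "- {p}"]) auto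
        ultimately show ?thesis
          using False unfolding continuous_within by (auto elim: Lim_transform_eventually)
      qed
    qed
    show "(w(p := c)) z \<le> 0" if "z \<in> frontier \<Omega>" for z
    proof -
      have "z \<noteq> p" using that \<Omega> by (auto simp: frontier_def interior_open)
      then show ?thesis using that u v by (simp add: w_def point_source_solution_def)
    qed
  qed
  then show ?thesis using z by (simp add: w_def)
qed

lemma point_source_solution_unique:
  assumes "open \<Omega>" "bounded \<Omega>" "p \<in> \<Omega>"
    and "point_source_solution \<Omega> p u" "point_source_solution \<Omega> p v" "z \<in> closure \<Omega> - {p}"
  shows "u z = v z"
  using point_source_solution_le[of \<Omega> p u v z] point_source_solution_le[of \<Omega> p v u z] assms
  by (simp add: antisym)

section \<open>Green's function and its normal derivative\<close>

text \<open>\<open>F\<close> is the complex derivative up to the boundary, one-sided on the circle.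
  Nothing here prevents it from vanishing there: injectivity excludes zeros only in the open
  disc.\<close>

locale conformal_disc =
  fixes f F :: "complex \<Rightarrow> complex"
  assumes inj: "inj_on f (cball 0 1)"
    and deriv: "\<And>x. x \<in> cball 0 1 \<Longrightarrow> (f has_field_derivative F x) (at x within cball 0 1)"
    and contF: "continuous_on (cball 0 1) F"
begin

lemma contf: "continuous_on (cball 0 1) f"
  using deriv by (rule DERIV_continuous_on)

lemma deriv_at: "x \<in> ball 0 1 \<Longrightarrow> (f has_field_derivative F x) (at x)"
  using deriv[of x] at_within_interior[of x "cball 0 1"] by (simp add: less_imp_le)

lemma holf: "f holomorphic_on ball 0 1"
  unfolding holomorphic_on_open[OF open_ball] using deriv_at by blast

lemma holF: "F holomorphic_on ball 0 1"
proof -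
  have "deriv f holomorphic_on ball 0 1" by (intro holomorphic_deriv holf open_ball)
  then show ?thesis
    by (rule holomorphic_transform) (simp add: DERIV_imp_deriv deriv_at)
qed

lemma inj_ball: "inj_on f (ball 0 1)"
  using inj by (rule inj_on_subset) auto

lemma F_nonzero: "x \<in> ball 0 1 \<Longrightarrow> F x \<noteq> 0"
  using holomorphic_injective_imp_regular[OF holf open_ball inj_ball] by (metis DERIV_imp_deriv deriv_at)

abbreviation \<Omega> :: "complex set" where "\<Omega> \<equiv> f ` ball 0 1"

lemma open_\<Omega>: "open \<Omega>"
  using open_mapping_thm3[OF holf open_ball inj_ball] .

lemma closure_\<Omega>: "closure \<Omega> = f ` cball 0 1"
proof
  have "closed (f ` cball 0 1)"
    by (intro compact_imp_closed compact_continuous_image contf compact_cball)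
  then show "closure \<Omega> \<subseteq> f ` cball 0 1" by (intro closure_minimal image_mono) auto
  have "f ` closure (ball 0 1) \<subseteq> closure \<Omega>"
    by (rule image_closure_subset) (auto simp: contf closure_subset)
  then show "f ` cball 0 1 \<subseteq> closure \<Omega>" by simp
qed

lemma frontier_\<Omega>: "frontier \<Omega> = f ` sphere 0 1"
proof -
  have "frontier \<Omega> = f ` cball 0 1 - f ` ball 0 1"
    by (simp add: frontier_def closure_\<Omega> interior_open open_\<Omega>)
  also have "\<dots> = f ` (cball 0 1 - ball 0 1)"
    by (rule inj_on_image_set_diff[OF inj, symmetric]) auto
  also have "cball 0 1 - ball 0 1 = (sphere 0 1 :: complex set)" by auto
  finally show ?thesis .
qed

lemma bounded_\<Omega>: "bounded \<Omega>"
proof -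
  have "bounded (f ` cball 0 1)"
    by (intro compact_imp_bounded compact_continuous_image contf compact_cball)
  then show ?thesis by (rule bounded_subset) auto
qed

lemma f0_in_\<Omega>: "f 0 \<in> \<Omega>"
  by simp

definition g :: "complex \<Rightarrow> complex" where "g = inv_into (cball 0 1) f"

lemma g_f: "z \<in> cball 0 1 \<Longrightarrow> g (f z) = z"
  using inv_into_f_f[OF inj] by (simp add: g_def)

lemma contg: "continuous_on (f ` cball 0 1) g"
  by (rule continuous_on_inv[OF contf compact_cball]) (use g_f in auto)

lemma holg: "g holomorphic_on \<Omega>"
proof -
  obtain h where h: "h holomorphic_on \<Omega>" "\<And>z. z \<in> ball 0 1 \<Longrightarrow> h (f z) = z"
    using holomorphic_has_inverse[OF holf open_ball inj_ball] by metis
  show ?thesis by (rule holomorphic_transform[OF h(1)]) (use h(2) g_f in auto)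
qed

text \<open>This divides out the zero of f - f 0; being free of zeros on the closed disc, it has a
  logarithm in the open disc, which supplies the harmonic part of Green's function.\<close>

definition diff_quot :: "complex \<Rightarrow> complex" where
  "diff_quot z = (if z = 0 then F 0 else (f z - f 0) / z)"

lemma diff_quot_holomorphic: "diff_quot holomorphic_on ball 0 1"
proof -
  have "deriv f 0 = F 0" by (intro DERIV_imp_deriv deriv_at) simp
  then have "diff_quot = (\<lambda>z. if z = 0 then deriv f 0 else (f z - f 0) / (z - 0))"
    by (auto simp: fun_eq_iff diff_quot_def)
  then show ?thesis using pole_lemma_open[OF holf open_ball, of 0] by simp
qed

lemma diff_quot_nonzero: "z \<in> cball 0 1 \<Longrightarrow> diff_quot z \<noteq> 0"
  using F_nonzero[of 0] inj_onD[OF inj, of z 0] by (auto simp: diff_quot_def)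

definition green_function :: "complex \<Rightarrow> real" where
  "green_function z = - ln (norm (g z)) / (2 * pi)"

text \<open>From |z - f 0| = |g z| exp (Re (H z)), with H the pull-back of a logarithm of
  \<open>diff_quot\<close>, one gets - ln |g z| = Re (H z) - ln |z - f 0|. The harmonic term
  contributes nothing when paired with a Laplacian, and the logarithm contributes the point
  mass.\<close>

lemma point_source_solution_green_function: "point_source_solution \<Omega> (f 0) green_function"
proof -
  obtain E where E: "E holomorphic_on ball 0 1"
    "\<And>z. z \<in> ball 0 1 \<Longrightarrow> diff_quot z = exp (E z)"
    using contractible_imp_holomorphic_log[OF diff_quot_holomorphic]
      diff_quot_nonzero convex_imp_contractible[OF convex_ball]
    by (metis ball_subset_cball subsetD)
  define H where "H z = E (g z)" for z
  have gball: "g ` \<Omega> \<subseteq> ball 0 1" using g_f by auto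
  have H: "H holomorphic_on \<Omega>"
    unfolding H_def using holomorphic_on_compose_gen[OF holg E(1)] gball by (simp add: o_def image_subset_iff_funcset)
  define u where "u z = (Re (H z) - ln (norm (z - f 0))) / (2 * pi)" for z
  have green_eq: "green_function z = u z" if z: "z \<in> \<Omega>" "z \<noteq> f 0" for z
  proof -
    obtain x where x: "x \<in> ball 0 1" "z = f x" using z by auto
    then have "x \<noteq> 0" "g z = x" using z g_f by auto
    then have "norm (z - f 0) = norm x * norm (diff_quot x)"
      using x by (simp add: diff_quot_def norm_divide)
    also have "norm (diff_quot x) = exp (Re (H z))"
      using E(2)[OF x(1)] \<open>g z = x\<close> by (simp add: H_def)
    finally have "ln (norm (z - f 0)) = ln (norm x) + Re (H z)"
      using \<open>x \<noteq> 0\<close> by (simp add: ln_mult)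
    then show ?thesis by (simp add: green_function_def u_def \<open>g z = x\<close>)
  qed
  \<comment> \<open>A default value, coming from \<open>ln 0 = 0\<close>.\<close>
  have green_0: "green_function (f 0) = 0" using g_f[of 0] by (simp add: green_function_def)
  have contH: "continuous_on \<Omega> H" using H by (rule holomorphic_on_imp_continuous_on)
  obtain R where R: "\<Omega> \<subseteq> cball (f 0) R"
    using bounded_subset_ballD[OF bounded_\<Omega>, of "f 0"] ball_subset_cball by blast
  have fin: "emeasure lborel \<Omega> < \<infinity>"
    using emeasure_mono[OF R, of lborel] emeasure_lborel_cball_finite[of "f 0" R] open_\<Omega>
    by (simp add: order.strict_trans1)
  have i_ln: "integrable lborel (\<lambda>z. indicator \<Omega> z * ln (norm (z - f 0)))"
  proof -
    have "set_integrable lborel (cball (f 0) R) (\<lambda>z. ln (norm (z - f 0)))"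
      using integrable_ln_norm[of "f 0" R] by (simp add: set_integrable_def)
    then have "set_integrable lborel \<Omega> (\<lambda>z. ln (norm (z - f 0)))"
      by (rule set_integrable_subset) (use open_\<Omega> R in auto)
    then show ?thesis by (simp add: set_integrable_def)
  qed
  \<comment> \<open>Re (H z) equals ln |diff_quot (g z)|, and \<open>diff_quot\<close> is continuous
    without zeros on the closed disc; so the harmonic part is bounded on a set of finite
    measure.\<close>
  have i_H: "integrable lborel (\<lambda>z. indicator \<Omega> z * Re (H z))"
  proof -
    have "continuous_on (cball 0 1) (\<lambda>z. ln (norm (diff_quot z)))"
    proof (intro continuous_intros)
      show "continuous_on (cball 0 1) diff_quot"
        unfolding continuous_on_eq_continuous_within
      proof
        fix x :: complex assume x: "x \<in> cball 0 1"
        show "continuous (at x within cball 0 1) diff_quot"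
        proof (cases "x = 0")
          case True
          have "isCont diff_quot 0"
            using holomorphic_on_imp_continuous_on[OF diff_quot_holomorphic]
            by (simp add: continuous_on_eq_continuous_at)
          then show ?thesis using True continuous_at_imp_continuous_at_within by blast
        next
          case False
          have "continuous (at x within cball 0 1) (\<lambda>z. (f z - f 0) / z)"
            using contf x False by (intro continuous_intros) (auto simp: continuous_on_eq_continuous_within)
          moreover have "eventually (\<lambda>z. (f z - f 0) / z = diff_quot z) (at x within cball 0 1)"
            using False unfolding eventually_at_topological
            by (intro exI[of _ "- {0}"]) (auto simp: diff_quot_def)
          ultimately show ?thesis
            using False unfolding continuous_within
            by (auto simp: diff_quot_def elim: Lim_transform_eventually)
        qed
      qed
    qed (use diff_quot_nonzero in auto)
    then have "bounded ((\<lambda>z. ln (norm (diff_quot z))) ` cball 0 1)"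
      by (intro compact_imp_bounded compact_continuous_image compact_cball)
    then obtain B where B0: "\<forall>x\<in>(\<lambda>z. ln (norm (diff_quot z))) ` cball 0 1. norm x \<le> B"
      unfolding bounded_iff by blast
    have B: "\<bar>ln (norm (diff_quot z))\<bar> \<le> B" if "z \<in> cball 0 1" for z
      using B0 that by simp
    have "integrable lborel (\<lambda>z. indicator \<Omega> z * B)"
      by (intro integrable_mult_left integrable_real_indicator fin) (simp add: open_\<Omega>)
    then show ?thesis
    proof (rule Bochner_Integration.integrable_bound)
      have "(\<lambda>z. indicator \<Omega> z *\<^sub>R Re (H z)) \<in> borel_measurable borel"
        by (intro borel_measurable_continuous_on_indicator continuous_on_Re contH) (simp add: open_\<Omega>)
      then show "(\<lambda>z. indicator \<Omega> z * Re (H z)) \<in> borel_measurable lborel" by simp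
      show "AE z in lborel. norm (indicator \<Omega> z * Re (H z)) \<le> norm (indicator \<Omega> z * B)"
      proof (rule AE_I2)
        fix z
        show "norm (indicator \<Omega> z * Re (H z)) \<le> norm (indicator \<Omega> z * B)"
        proof (cases "z \<in> \<Omega>")
          case True
          then have "g z \<in> ball 0 1" using gball by blast
          then have "\<bar>Re (H z)\<bar> \<le> B" using B[of "g z"] E(2)[of "g z"] by (simp add: H_def)
          then show ?thesis using True by simp
        qed simp
      qed
    qed
  qed
  have i_green: "set_integrable lborel \<Omega> green_function"
  proof -
    \<comment> \<open>The last term corrects the single point f 0, where
      \<open>green_function\<close> takes the value 0 and not that of \<open>u\<close>.\<close>
    have eq: "(\<lambda>z. indicator \<Omega> z *\<^sub>R green_function z) =
       (\<lambda>z. (indicator \<Omega> z * Re (H z) - indicator \<Omega> z * ln (norm (z - f 0))) * (1 / (2 * pi))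
          - indicator {f 0} z * u (f 0))"
    proof
      fix z show "indicator \<Omega> z *\<^sub>R green_function z = 
       (indicator \<Omega> z * Re (H z) - indicator \<Omega> z * ln (norm (z - f 0))) * (1 / (2 * pi))
          - indicator {f 0} z * u (f 0)"
        using green_eq[of z] green_0 f0_in_\<Omega> by (auto simp: indicator_def u_def)
    qed
    show ?thesis unfolding set_integrable_def eq
      by (intro Bochner_Integration.integrable_diff integrable_mult_left i_H i_ln integrable_real_indicator) auto
  qed
  have weak: "- (LINT z:\<Omega>|lborel. green_function z * laplacian \<phi> z) = \<phi> (f 0)" if \<phi>: "\<phi> \<in> test_functions \<Omega>" for \<phi>
  proof -
    let ?K = "closure {z. \<phi> z \<noteq> 0}"
    have sm: "smooth \<phi>" and K: "compact ?K" "?K \<subseteq> \<Omega>" using \<phi> by (auto simp: test_functions_def)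
    note K0 = zero_outside_support[of _ \<phi>]
    note ln = integral_log_laplacian[OF sm K(1) K0, of "f 0"]
    note harm = integral_harmonic_laplacian[OF sm K(1,2) K0 open_\<Omega> H]
    have lap0: "laplacian \<phi> z = 0" if "z \<notin> \<Omega>" for z
      using laplacian_zero_outside[OF sm closed_closure K0] K that by blast
    have "(LINT z:\<Omega>|lborel. green_function z * laplacian \<phi> z)
       = (\<integral>z. (Re (H z) * laplacian \<phi> z - ln (norm (z - f 0)) * laplacian \<phi> z) / (2 * pi) \<partial>lborel)"
      unfolding set_lebesgue_integral_def
    proof (rule integral_cong_AE)
      show "(\<lambda>z. indicator \<Omega> z *\<^sub>R (green_function z * laplacian \<phi> z)) \<in> borel_measurable lborel"
        using test_function_integrable[OF i_green \<phi>] unfolding set_integrable_def by (rule borel_measurable_integrable)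
      show "(\<lambda>z. (Re (H z) * laplacian \<phi> z - ln (norm (z - f 0)) * laplacian \<phi> z) / (2 * pi)) \<in> borel_measurable lborel"
        using harm(1) ln(1) by (intro borel_measurable_divide borel_measurable_diff borel_measurable_integrable) auto
      show "AE z in lborel. indicator \<Omega> z *\<^sub>R (green_function z * laplacian \<phi> z) =
          (Re (H z) * laplacian \<phi> z - ln (norm (z - f 0)) * laplacian \<phi> z) / (2 * pi)"
        using AE_lborel_singleton[of "f 0"]
      proof eventually_elim
        case (elim z)
        then show ?case using green_eq[of z] lap0[of z]
          by (cases "z \<in> \<Omega>") (auto simp: u_def left_diff_distrib)
      qed
    qed
    also have "\<dots> = (0 - 2 * pi * \<phi> (f 0)) / (2 * pi)"
      using harm ln by (simp add: Bochner_Integration.integral_diff)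
    finally show ?thesis by simp
  qed
  have "continuous_on (closure \<Omega> - {f 0}) green_function"
    unfolding green_function_def closure_\<Omega>
    by (intro continuous_intros continuous_on_subset[OF contg]) (use g_f in auto)
  moreover have "green_function z = 0" if z: "z \<in> frontier \<Omega>" for z
  proof -
    obtain x where "x \<in> sphere 0 1" "z = f x" using z frontier_\<Omega> by auto
    then show ?thesis using g_f[of x] by (simp add: green_function_def)
  qed
  ultimately show ?thesis
    unfolding point_source_solution_def using i_green weak by blast
qed

text \<open>Existence makes the chosen function a solution, and uniqueness away from the pole makes
  the choice immaterial.\<close>

lemma green_solution_eq:
  assumes "z \<in> f ` cball 0 1" "z \<noteq> f 0"
  shows "green_solution \<Omega> (f 0) z = green_function z"
proof -
  have "point_source_solution \<Omega> (f 0) (green_solution \<Omega> (f 0))"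
    unfolding green_solution_def by (rule someI[of "point_source_solution \<Omega> (f 0)", OF point_source_solution_green_function])
  then show ?thesis
    by (rule point_source_solution_unique[OF open_\<Omega> bounded_\<Omega> f0_in_\<Omega> _ point_source_solution_green_function])
      (use assms closure_\<Omega> in auto)
qed

end

text \<open>The class provides a real-linear derivative within the closed disc. Its failure to be
  complex multiplication depends continuously on the point and is 0 in the open disc, hence also on
  the circle.\<close>

lemma class_F_conformal_disc:
  assumes f: "f \<in> class_F \<alpha> \<zeta>o \<zeta>b" and \<alpha>: "0 < \<alpha>"
  obtains F where "conformal_disc f F"
proof -
  have inj: "inj_on f (cball 0 1)" and hol: "f holomorphic_on ball 0 1" using f by (auto simp: class_F_def)
  obtain f' :: "complex \<Rightarrow> complex \<Rightarrow>\<^sub>L complex" where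
    f': "\<And>x. x \<in> cball 0 1 \<Longrightarrow> (f has_derivative blinfun_apply (f' x)) (at x within cball 0 1)"
    and hold: "holder_on \<alpha> (cball 0 1) f'"
    using f unfolding class_F_def C1_holder_on_def by blast
  have cont: "continuous_on (cball 0 1) f'" by (rule holder_on_imp_continuous_on[OF hold \<alpha>])
  have lin: "blinfun_apply (f' x) h = blinfun_apply (f' x) 1 * h" if x: "x \<in> cball 0 1" for x h
  proof -
    have "blinfun_apply (f' x) h - blinfun_apply (f' x) 1 * h = 0"
    proof (rule continuous_constant_on_closure[where S = "ball 0 1" and f = "\<lambda>x. blinfun_apply (f' x) h - blinfun_apply (f' x) 1 * h"])
      show "continuous_on (closure (ball 0 1)) (\<lambda>x. blinfun_apply (f' x) h - blinfun_apply (f' x) 1 * h)"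
        using cont by (auto intro!: continuous_intros)
      show "x \<in> closure (ball 0 1)" using x by simp
      fix y :: complex assume y: "y \<in> ball 0 1"
      then have "at y within cball 0 1 = at y" by (intro at_within_interior) simp
      then have "(f has_derivative blinfun_apply (f' y)) (at y)" using f'[of y] y by (simp add: less_imp_le)
      moreover have "(f has_derivative (*) (deriv f y)) (at y)"
        using holomorphic_derivI[OF hol open_ball y] by (simp add: has_field_derivative_def)
      ultimately have "blinfun_apply (f' y) = (*) (deriv f y)" by (rule has_derivative_unique)
      then show "blinfun_apply (f' y) h - blinfun_apply (f' y) 1 * h = 0" by simp
    qed
    then show ?thesis by simp
  qed
  show ?thesis
  proof (rule that[of "\<lambda>x. blinfun_apply (f' x) 1"], rule conformal_disc.intro)
    show "(f has_field_derivative blinfun_apply (f' x) 1) (at x within cball 0 1)" if x: "x \<in> cball 0 1" for x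
    proof -
      have "blinfun_apply (f' x) = (*) (blinfun_apply (f' x) 1)"
        by (rule ext) (rule lin[OF x])
      with f'[OF x] show ?thesis by (simp add: has_field_derivative_def)
    qed
    show "continuous_on (cball 0 1) (\<lambda>x. blinfun_apply (f' x) 1)"
      using cont by (auto intro!: continuous_intros)
  qed (rule inj)
qed

section \<open>Arclength on the boundary and the normal derivative\<close>

lemma cis_eq_imp_eq:
  assumes "cis a = cis b" "\<bar>a - b\<bar> < 2 * pi"
  shows "a = b"
proof -
  have "sin a = sin b \<and> cos a = cos b" using assms(1) by (simp add: complex_eq_iff)
  then obtain n :: int where n: "a = b + 2 * pi * n" using sin_cos_eq_iff by blast
  then have "2 * pi * \<bar>real_of_int n\<bar> < 2 * pi * 1" using assms(2) by (simp add: abs_mult)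
  then have "\<bar>real_of_int n\<bar> < 1" by (subst (asm) mult_less_cancel_left_pos) auto
  then have "n = 0" by linarith
  then show ?thesis using n by simp
qed

context conformal_disc
begin

lemma curve_derivative: "(boundary_curve f has_vector_derivative \<i> * cis t * F (cis t)) (at t)"
proof -
  have "(f has_field_derivative F (cis t)) (at (cis t) within range cis)"
    by (rule has_field_derivative_subset[OF deriv]) auto
  moreover have "(cis has_vector_derivative \<i> * cis t) (at t within UNIV)"
    unfolding has_vector_derivative_def by (auto intro!: derivative_eq_intros simp: scaleR_conv_of_real)
  ultimately have "((f \<circ> cis) has_vector_derivative (\<i> * cis t) * F (cis t)) (at t)"
    by (intro field_vector_diff_chain_within) auto
  then show ?thesis by (simp add: boundary_curve_def[abs_def] o_def)
qed

lemma vector_derivative_curve: "vector_derivative (boundary_curve f) (at t) = \<i> * cis t * F (cis t)"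
  using curve_derivative by (rule vector_derivative_at)

lemma speed_continuous: "continuous_on A (\<lambda>t. norm (F (cis t)))"
  by (intro continuous_intros continuous_on_compose2[OF contF]) auto

lemma boundary_arclength_eq: "boundary_arclength f \<theta> = integral {0..\<theta>} (\<lambda>t. norm (F (cis t)))"
  by (simp add: boundary_arclength_def vector_derivative_curve norm_mult)

lemma boundary_arclength_deriv:
  assumes "\<theta> \<in> {0..2 * pi}"
  shows "(boundary_arclength f has_real_derivative norm (F (cis \<theta>))) (at \<theta> within {0..2 * pi})"
  using integral_has_real_derivative[OF speed_continuous assms]
  by (simp add: boundary_arclength_eq[abs_def])

text \<open>The speed may vanish at points, but not on a whole arc: there f would be constant,
  contrary to injectivity on the closed disc.\<close>

lemma boundary_arclength_strict_mono:
  assumes "0 \<le> a" "a < b" "b \<le> 2 * pi"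
  shows "boundary_arclength f a < boundary_arclength f b"
proof (rule ccontr)
  let ?v = "\<lambda>t. norm (F (cis t))"
  have int: "?v integrable_on {x..y}" for x y
    by (rule integrable_continuous_interval[OF speed_continuous])
  have split: "boundary_arclength f b = boundary_arclength f a + integral {a..b} ?v"
    using Henstock_Kurzweil_Integration.integral_combine[OF _ _ int, of 0 a b] assms by (simp add: boundary_arclength_eq)
  assume "\<not> boundary_arclength f a < boundary_arclength f b"
  moreover have "0 \<le> integral {a..b} ?v" by (intro integral_nonneg int) auto
  ultimately have "integral {a..b} ?v = 0" using split by linarith
  then have zero: "\<forall>t\<in>{a..b}. F (cis t) = 0"
    by (subst (asm) integral_eq_0_iff[OF speed_continuous assms(2)]) auto
  \<comment> \<open>The midpoint is compared with a because for a = 0 and b = 2 \<pi> the two ends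
    give the same point of the circle.\<close>
  define c where "c = (a + b) / 2"
  have c: "a < c" "c < b" using assms by (auto simp: c_def)
  obtain k where "\<And>t. t \<in> {a..b} \<Longrightarrow> boundary_curve f t = k"
  proof (rule has_vector_derivative_zero_constant)
    show "(boundary_curve f has_vector_derivative 0) (at t within {a..b})" if "t \<in> {a..b}" for t
      using curve_derivative[of t] zero that by (simp add: has_vector_derivative_at_within)
  qed (auto simp: convex_real_interval)
  then have "boundary_curve f a = boundary_curve f c" using c by simp
  then have "f (cis a) = f (cis c)" by (simp add: boundary_curve_def)
  then have "cis a = cis c" by (rule inj_onD[OF inj]) auto
  then show False using cis_eq_imp_eq[of a c] c assms by linarith
qed

lemma perimeter_pos: "0 < perimeter f"
  using boundary_arclength_strict_mono[of 0 "2 * pi"] by (simp add: perimeter_def boundary_arclength_eq)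

lemma boundary_angle_arclength:
  assumes "0 \<le> \<theta>" "\<theta> < 2 * pi"
  shows "boundary_angle f (boundary_arclength f \<theta>) = \<theta>"
proof -
  let ?s = "boundary_arclength f"
  have "?s \<theta> < perimeter f" "0 \<le> ?s \<theta>"
    using boundary_arclength_strict_mono[of \<theta> "2 * pi"] boundary_arclength_strict_mono[of 0 \<theta>] assms
    by (cases "\<theta> = 0"; simp add: perimeter_def boundary_arclength_eq)+
  then have "\<lfloor>?s \<theta> / perimeter f\<rfloor> = 0" using perimeter_pos by (simp add: floor_eq_iff)
  then have "boundary_angle f (?s \<theta>) = (THE \<theta>'. 0 \<le> \<theta>' \<and> \<theta>' < 2 * pi \<and> ?s \<theta>' = ?s \<theta>)"
    by (simp add: boundary_angle_def)
  also have "\<dots> = \<theta>"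
  proof (rule the_equality)
    fix \<theta>' assume "0 \<le> \<theta>' \<and> \<theta>' < 2 * pi \<and> ?s \<theta>' = ?s \<theta>"
    then show "\<theta>' = \<theta>"
      using boundary_arclength_strict_mono[of \<theta> \<theta>'] boundary_arclength_strict_mono[of \<theta>' \<theta>] assms
      by (cases \<theta> \<theta>' rule: linorder_cases) auto
  qed (use assms in auto)
  finally show ?thesis .
qed

lemma at_0_within_nonneg: "at (0 :: real) within {0..} \<noteq> bot"
  by (simp add: at_within_Ici_at_right)

lemma op_T_eq_0:
  assumes "0 \<le> \<theta>" "\<theta> < 2 * pi" "F (cis \<theta>) = 0"
  shows "op_T f (boundary_arclength f \<theta>) = 0"
proof -
  have "interior_normal f \<theta> = 0" using assms(3) by (simp add: interior_normal_def vector_derivative_curve)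
  then show ?thesis
    unfolding op_T_def Let_def boundary_angle_arclength[OF assms(1,2)]
    by (simp add: vector_derivative_within[OF at_0_within_nonneg has_vector_derivative_const])
qed

text \<open>The inner normal at \<open>f \<zeta>\<close> is \<open>- \<zeta> sgn (F \<zeta>)\<close>. Brouwer's fixed point theorem, applied to a Newton step in a ball of
  radius \<open>o(t)\<close> around \<open>(1 - t c) \<zeta>\<close>, shows without any regularity of the image that the normal enters the domain.\<close>

lemma inner_normal_preimage:
  assumes \<zeta>: "norm \<zeta> = 1" and F: "F \<zeta> \<noteq> 0" and \<eta>: "0 < \<eta>" "\<eta> < 1"
  defines "c \<equiv> 1 / norm (F \<zeta>)"
  obtains \<delta> where "\<delta> > 0"
    "\<And>t. 0 < t \<Longrightarrow> t < \<delta> \<Longrightarrow>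
       \<exists>z\<in>ball 0 1. z \<noteq> 0 \<and> f z = f \<zeta> - of_real t * (\<zeta> * sgn (F \<zeta>)) \<and> \<bar>norm z - 1 + t * c\<bar> \<le> \<eta> * (t * c)"
proof -
  have c: "c > 0" using F by (simp add: c_def)
  have \<zeta>in: "\<zeta> \<in> cball 0 1" using \<zeta> by simp
  \<comment> \<open>Chosen so that an error e * 2tc, divided by |F \<zeta>|, is exactly the radius
    \<eta> tc of the ball.\<close>
  define e where "e = \<eta> * norm (F \<zeta>) / 2"
  have e: "e > 0" using \<eta> F by (simp add: e_def)
  obtain r where r: "r > 0" and
    err: "\<And>z. z \<in> cball 0 1 \<Longrightarrow> norm (z - \<zeta>) < r \<Longrightarrow> norm (f z - f \<zeta> - F \<zeta> * (z - \<zeta>)) \<le> e * norm (z - \<zeta>)"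
    using deriv[OF \<zeta>in] e unfolding has_field_derivative_def has_derivative_within_alt by meson
  define \<delta> where "\<delta> = min (r / (2 * c)) (1 / (2 * c))"
  show ?thesis
  proof (rule that[of \<delta>])
    show "\<delta> > 0" using r c by (simp add: \<delta>_def)
    fix t assume t: "0 < t" "t < \<delta>"
    have "t < r / (2 * c)" "t < 1 / (2 * c)" using t by (auto simp: \<delta>_def)
    then have tc: "2 * (t * c) < r" "2 * (t * c) < 1" "0 < t * c" using c t by (auto simp: field_simps)
    define w where "w = (1 - of_real (t * c)) * \<zeta>"
    define \<rho> where "\<rho> = \<eta> * (t * c)"
    have \<rho>: "0 < \<rho>" "\<rho> < t * c" using \<eta> mult_strict_right_mono[OF \<eta>(2) tc(3)] tc by (auto simp: \<rho>_def)
    have "norm (1 - of_real (t * c) :: complex) = 1 - t * c"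
      using tc by (metis abs_of_nonneg add_increasing2 diff_ge_0_iff_ge linorder_not_less mult_2 norm_of_real of_real_1 of_real_diff order_less_imp_le)
    then have nw: "norm w = 1 - t * c" using \<zeta> by (simp add: w_def norm_mult)
    have w\<zeta>: "norm (w - \<zeta>) = t * c"
    proof -
      have "w - \<zeta> = - (of_real (t * c) * \<zeta>)" by (simp add: w_def algebra_simps)
      then show ?thesis using \<zeta> t c by (simp add: norm_mult)
    qed
    have near: "norm z < 1" "norm (z - \<zeta>) \<le> 2 * (t * c)" "\<bar>norm z - 1 + t * c\<bar> \<le> \<rho>" if "z \<in> cball w \<rho>" for z
    proof -
      have zw: "norm (z - w) \<le> \<rho>" using that by (simp add: dist_norm norm_minus_commute)
      show *: "\<bar>norm z - 1 + t * c\<bar> \<le> \<rho>"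
        using norm_triangle_ineq3[of z w] zw nw by linarith
      then show "norm z < 1" using \<rho> by linarith
      show "norm (z - \<zeta>) \<le> 2 * (t * c)"
        using norm_triangle_ineq[of "z - w" "w - \<zeta>"] zw w\<zeta> \<rho> by simp
    qed
    \<comment> \<open>Newton step with the derivative frozen at \<zeta>; its fixed points are the
      preimages of the point at distance t along the inner normal.\<close>
    define \<Phi> where "\<Phi> z = z - (f z - f \<zeta> + of_real t * (\<zeta> * sgn (F \<zeta>))) / F \<zeta>" for z
    have "continuous_on (cball w \<rho>) \<Phi>"
      unfolding \<Phi>_def using F near
      by (intro continuous_intros continuous_on_subset[OF contf]) (auto simp: less_imp_le)
    moreover have "\<Phi> \<in> cball w \<rho> \<rightarrow> cball w \<rho>"
    proof
      fix z assume z: "z \<in> cball w \<rho>"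
      have "\<Phi> z - w = - ((f z - f \<zeta> - F \<zeta> * (z - \<zeta>)) / F \<zeta>)"
      proof -
        have "sgn (F \<zeta>) / F \<zeta> = of_real c" using F by (simp add: c_def sgn_div_norm scaleR_conv_of_real field_simps)
        then have "of_real t * (\<zeta> * sgn (F \<zeta>)) / F \<zeta> = of_real (t * c) * \<zeta>"
          by (metis (no_types, lifting) mult.assoc mult.commute of_real_mult times_divide_eq_right)
        then show ?thesis using F by (simp add: \<Phi>_def w_def add_divide_distrib diff_divide_distrib algebra_simps)
      qed
      then have "norm (\<Phi> z - w) = norm (f z - f \<zeta> - F \<zeta> * (z - \<zeta>)) * c"
        by (simp add: norm_divide c_def)
      also have "\<dots> \<le> (e * norm (z - \<zeta>)) * c"
        using err[of z] near[OF z] tc c by (intro mult_right_mono) auto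
      also have "\<dots> \<le> (e * (2 * (t * c))) * c"
        using near(2)[OF z] e c by (intro mult_right_mono mult_left_mono) auto
      also have "\<dots> = \<rho>" using F by (simp add: e_def \<rho>_def c_def)
      finally show "\<Phi> z \<in> cball w \<rho>" by (simp add: dist_norm norm_minus_commute)
    qed
    ultimately obtain z where z: "z \<in> cball w \<rho>" "\<Phi> z = z" using brouwer_ball[OF \<rho>(1)] by blast
    have "f z - f \<zeta> + of_real t * (\<zeta> * sgn (F \<zeta>)) = 0"
      using z(2) F by (simp add: \<Phi>_def)
    moreover have "f z = (f z - f \<zeta> + of_real t * (\<zeta> * sgn (F \<zeta>))) + (f \<zeta> - of_real t * (\<zeta> * sgn (F \<zeta>)))"
      by simp
    ultimately have "f z = f \<zeta> - of_real t * (\<zeta> * sgn (F \<zeta>))" by simp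
    moreover have "z \<noteq> 0" using near(3)[OF z(1)] \<rho> tc by auto
    ultimately show "\<exists>z\<in>ball 0 1. z \<noteq> 0 \<and> f z = f \<zeta> - of_real t * (\<zeta> * sgn (F \<zeta>))
        \<and> \<bar>norm z - 1 + t * c\<bar> \<le> \<eta> * (t * c)"
      using near[OF z(1)] by (intro bexI[of _ z]) (auto simp: \<rho>_def)
  qed
qed

text \<open>Along the normal the preimage has modulus 1 - tc + o(t) with c = 1 / |F \<zeta>|,
  because \<eta> can be taken arbitrarily small. Composition with - ln / (2 \<pi>), whose derivative
  at 1 is - 1 / (2 \<pi>), gives the value.\<close>

lemma green_solution_normal_derivative:
  assumes \<zeta>: "norm \<zeta> = 1" and F: "F \<zeta> \<noteq> 0"
  shows "((\<lambda>t. green_solution \<Omega> (f 0) (f \<zeta> - of_real t * (\<zeta> * sgn (F \<zeta>))))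
     has_real_derivative 1 / (2 * pi * norm (F \<zeta>))) (at 0 within {0..})"
proof -
  define c where "c = 1 / norm (F \<zeta>)"
  have c: "c > 0" using F by (simp add: c_def)
  define p where "p t = f \<zeta> - of_real t * (\<zeta> * sgn (F \<zeta>))" for t :: real
  define \<rho> where "\<rho> t = norm (g (p t))" for t
  have \<zeta>in: "\<zeta> \<in> cball 0 1" using \<zeta> by simp
  have p0: "p 0 = f \<zeta>" by (simp add: p_def)
  have \<rho>0: "\<rho> 0 = 1" using \<zeta> g_f[OF \<zeta>in] by (simp add: \<rho>_def p0)
  have pre: "\<exists>\<delta>>0. \<forall>t. 0 < t \<longrightarrow> t < \<delta> \<longrightarrow> p t \<in> f ` cball 0 1 \<and> p t \<noteq> f 0 \<and> \<bar>\<rho> t - 1 + t * c\<bar> \<le> \<eta> * (t * c)"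
    if \<eta>: "0 < \<eta>" "\<eta> < 1" for \<eta>
  proof -
    obtain \<delta> where \<delta>: "\<delta> > 0"
      "\<And>t. 0 < t \<Longrightarrow> t < \<delta> \<Longrightarrow>
       \<exists>z\<in>ball 0 1. z \<noteq> 0 \<and> f z = p t \<and> \<bar>norm z - 1 + t * c\<bar> \<le> \<eta> * (t * c)"
      using inner_normal_preimage[OF \<zeta> F \<eta>] unfolding p_def c_def by metis
    have "p t \<in> f ` cball 0 1 \<and> p t \<noteq> f 0 \<and> \<bar>\<rho> t - 1 + t * c\<bar> \<le> \<eta> * (t * c)" if t: "0 < t" "t < \<delta>" for t
    proof -
      obtain z where z: "z \<in> ball 0 1" "z \<noteq> 0" "f z = p t" "\<bar>norm z - 1 + t * c\<bar> \<le> \<eta> * (t * c)"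
        using \<delta>(2)[OF t] by blast
      have zc: "z \<in> cball 0 1" using z by simp
      have "\<rho> t = norm z" using g_f[OF zc] z by (simp add: \<rho>_def)
      moreover have "p t \<noteq> f 0" using inj_onD[OF inj, of z 0] z zc by auto
      moreover have "p t \<in> f ` cball 0 1" using zc z(3) by (metis image_eqI)
      ultimately show ?thesis using z by simp
    qed
    with \<delta>(1) show ?thesis by blast
  qed
  have "(\<rho> has_real_derivative - c) (at 0 within {0..})"
    unfolding has_field_derivative_def has_derivative_within_alt
  proof (intro conjI allI impI)
    fix e :: real assume e: "e > 0"
    define \<eta> where "\<eta> = min (1 / 2) (e / c)"
    have \<eta>: "0 < \<eta>" "\<eta> < 1" "\<eta> * c \<le> e" using e c by (auto simp: \<eta>_def min_def field_simps)
    obtain \<delta> where \<delta>: "\<delta> > 0" "\<And>t. 0 < t \<Longrightarrow> t < \<delta> \<Longrightarrow> \<bar>\<rho> t - 1 + t * c\<bar> \<le> \<eta> * (t * c)"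
      using pre[OF \<eta>(1,2)] by blast
    have "norm (\<rho> y - \<rho> 0 - - c * (y - 0)) \<le> e * norm (y - 0)" if y: "y \<in> {0..}" "norm (y - 0) < \<delta>" for y
    proof (cases "y = 0")
      case False
      then have "\<bar>\<rho> y - 1 + y * c\<bar> \<le> (\<eta> * c) * y" using \<delta>(2)[of y] y by (simp add: mult_ac)
      also have "\<dots> \<le> e * y" using \<eta> y by (intro mult_right_mono) auto
      finally show ?thesis using y by (simp add: \<rho>0 mult.commute)
    qed simp
    with \<delta>(1) show "\<exists>d>0. \<forall>y\<in>{0..}. norm (y - 0) < d \<longrightarrow> norm (\<rho> y - \<rho> 0 - - c * (y - 0)) \<le> e * norm (y - 0)"
      by blast
  qed (rule bounded_linear_mult_right)
  moreover have "((\<lambda>x. - ln x / (2 * pi)) has_real_derivative - (1 / (2 * pi))) (at (\<rho> 0))"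
    unfolding \<rho>0 by (auto intro!: derivative_eq_intros)
  ultimately have D: "((\<lambda>t. - ln (\<rho> t) / (2 * pi)) has_real_derivative - (1 / (2 * pi)) * - c) (at 0 within {0..})"
    using DERIV_chain2 by blast
  obtain \<delta> where \<delta>: "\<delta> > 0" "\<And>t. 0 < t \<Longrightarrow> t < \<delta> \<Longrightarrow> p t \<in> f ` cball 0 1 \<and> p t \<noteq> f 0"
    using pre[of "1 / 2"] by auto
  have eq: "green_solution \<Omega> (f 0) (p t) = - ln (\<rho> t) / (2 * pi)" if "t \<in> {0..}" "dist t 0 < \<delta>" for t
  proof -
    have "p 0 \<in> f ` cball 0 1" "p 0 \<noteq> f 0"
      using \<zeta>in inj_onD[OF inj, of \<zeta> 0] \<zeta> by (auto simp: p0)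
    then have "p t \<in> f ` cball 0 1" "p t \<noteq> f 0" using \<delta>(2)[of t] that by (cases "t = 0"; simp)+
    then show ?thesis by (simp add: green_solution_eq green_function_def \<rho>_def)
  qed
  have "((\<lambda>t. green_solution \<Omega> (f 0) (p t)) has_real_derivative - (1 / (2 * pi)) * - c) (at 0 within {0..})"
    by (rule has_field_derivative_transform_within[OF D \<delta>(1)]) (use eq in auto)
  then show ?thesis by (simp add: p_def c_def)
qed

lemma op_T_arclength:
  assumes "0 \<le> \<theta>" "\<theta> < 2 * pi" "F (cis \<theta>) \<noteq> 0"
  shows "op_T f (boundary_arclength f \<theta>) = 1 / (2 * pi * norm (F (cis \<theta>)))"
proof -
  have sgn: "sgn (\<i> * cis \<theta> * F (cis \<theta>)) = \<i> * cis \<theta> * sgn (F (cis \<theta>))"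
    by (simp add: sgn_div_norm norm_mult)
  have "interior_normal f \<theta> = \<i> * (\<i> * cis \<theta> * sgn (F (cis \<theta>)))"
    unfolding interior_normal_def vector_derivative_curve sgn ..
  also have "\<dots> = - (cis \<theta> * sgn (F (cis \<theta>)))" by (simp add: mult.assoc[symmetric])
  finally have "boundary_curve f \<theta> + of_real t * interior_normal f \<theta> = f (cis \<theta>) - of_real t * (cis \<theta> * sgn (F (cis \<theta>)))" for t
    by (simp add: boundary_curve_def)
  then have "op_T f (boundary_arclength f \<theta>) = vector_derivative (\<lambda>t. green_solution \<Omega> (f 0)
      (f (cis \<theta>) - of_real t * (cis \<theta> * sgn (F (cis \<theta>))))) (at 0 within {0..})"
    by (simp add: op_T_def Let_def boundary_angle_arclength[OF assms(1,2)])
  also have "\<dots> = 1 / (2 * pi * norm (F (cis \<theta>)))"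
    using green_solution_normal_derivative[of "cis \<theta>"] assms(3)
    by (intro vector_derivative_within at_0_within_nonneg)
      (simp add: has_real_derivative_iff_has_vector_derivative)
  finally show ?thesis .
qed

text \<open>A zero of \<open>F\<close> on the circle would give the value 0 of \<open>op_T\<close>.
  The end \<theta> = 2 \<pi> lies outside the half-open range of \<open>boundary_angle\<close> and
  is reduced to \<theta> = 0 by periodicity.\<close>

lemma boundary_speed:
  assumes pos: "\<And>s. 0 < op_T f s" and per: "\<And>s. op_T f (s + perimeter f) = op_T f s"
  shows "F (cis \<theta>) \<noteq> 0"
    and "0 \<le> \<theta> \<Longrightarrow> \<theta> \<le> 2 * pi \<Longrightarrow> norm (F (cis \<theta>)) = 1 / (2 * pi * op_T f (boundary_arclength f \<theta>))"
proof -
  have nz: "F (cis \<theta>) \<noteq> 0" if "0 \<le> \<theta>" "\<theta> < 2 * pi" for \<theta>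
    using op_T_eq_0[OF that] pos by (metis less_irrefl)
  show "F (cis \<theta>) \<noteq> 0"
  proof -
    have "\<exists>\<theta>'\<in>{0..<2 * pi}. cis \<theta> = cis \<theta>'"
      using Arg2pi[of "cis \<theta>"] by (intro bexI[of _ "Arg2pi (cis \<theta>)"]) (auto simp: cis_conv_exp is_Arg_def)
    then show ?thesis using nz by auto
  qed
  have eq: "norm (F (cis \<theta>)) = 1 / (2 * pi * op_T f (boundary_arclength f \<theta>))" if "0 \<le> \<theta>" "\<theta> < 2 * pi" for \<theta>
    using op_T_arclength[OF that nz[OF that]] nz[OF that] by simp
  assume \<theta>: "0 \<le> \<theta>" "\<theta> \<le> 2 * pi"
  show "norm (F (cis \<theta>)) = 1 / (2 * pi * op_T f (boundary_arclength f \<theta>))"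
  proof (cases "\<theta> = 2 * pi")
    case True
    have "boundary_arclength f 0 = 0" by (simp add: boundary_arclength_eq)
    then have "op_T f (boundary_arclength f \<theta>) = op_T f (boundary_arclength f 0)"
      using per[of 0] True by (simp add: perimeter_def)
    then show ?thesis using eq[of 0] True by simp
  qed (use eq \<theta> in auto)
qed

end

section \<open>Boundary Hoelder estimates for holomorphic logarithms\<close>

text \<open>Barrier: \<open>Re (1 - z / \<zeta>)\<^sup>\<gamma>\<close> is harmonic in the disc and comparable to \<open>\<bar>\<zeta> - z\<bar>\<^sup>\<gamma>\<close>, because \<open>1 - z / \<zeta>\<close>
  stays in the right half-plane.\<close>

lemma Re_powr_bounds:
  assumes "0 \<le> Re w" "0 < \<gamma>" "\<gamma> \<le> 1"
  shows "cos (pi * \<gamma> / 2) * norm w powr \<gamma> \<le> Re (w powr of_real \<gamma>)"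
    and "Re (w powr of_real \<gamma>) \<le> norm w powr \<gamma>"
proof -
  show "Re (w powr of_real \<gamma>) \<le> norm w powr \<gamma>"
    using complex_Re_le_cmod[of "w powr of_real \<gamma>"] by (simp add: norm_powr_real_powr')
  show "cos (pi * \<gamma> / 2) * norm w powr \<gamma> \<le> Re (w powr of_real \<gamma>)"
  proof (cases "w = 0")
    case False
    have "\<bar>Im (Ln w)\<bar> \<le> pi / 2" using Re_Ln_pos_le[OF False] assms by simp
    then have "\<gamma> * \<bar>Im (Ln w)\<bar> \<le> \<gamma> * (pi / 2)" using assms by (intro mult_left_mono) auto
    then have "\<bar>\<gamma> * Im (Ln w)\<bar> \<le> pi * \<gamma> / 2" using assms by (simp add: abs_mult mult.commute)
    moreover have "pi * \<gamma> / 2 \<le> pi" using assms by (simp add: mult_le_cancel_left1) 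
    ultimately have "cos (pi * \<gamma> / 2) \<le> cos \<bar>\<gamma> * Im (Ln w)\<bar>"
      by (intro cos_monotone_0_pi_le) auto
    then have "cos (pi * \<gamma> / 2) \<le> cos (\<gamma> * Im (Ln w))" by simp
    moreover have "Re (w powr of_real \<gamma>) = norm w powr \<gamma> * cos (\<gamma> * Im (Ln w))"
      using False by (simp add: powr_def Re_exp)
    ultimately show ?thesis by (simp add: mult.commute mult_left_mono)
  qed simp
qed

lemma cos_half_pi_mult_pos: "0 < \<gamma> \<Longrightarrow> \<gamma> < 1 \<Longrightarrow> 0 < cos (pi * \<gamma> / 2)"
  by (rule cos_gt_zero) auto

text \<open>The logarithm of |\<Psi>| is ln |Q z| - ln |Q \<zeta>| minus A/c times the barrier, and
  it is at most 0 on the circle by the lower bound on the barrier. So the maximum modulus principle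
  for \<Psi> does the work of one for harmonic functions, and the upper bound on the barrier
  finishes.\<close>

lemma log_modulus_barrier:
  assumes Q: "Q holomorphic_on ball 0 1" "continuous_on (cball 0 1) Q" "\<And>z. z \<in> cball 0 1 \<Longrightarrow> Q z \<noteq> 0"
    and \<gamma>: "0 < \<gamma>" "\<gamma> < 1" and A: "0 \<le> A" and \<zeta>: "norm \<zeta> = 1"
    and bd: "\<And>z. norm z = 1 \<Longrightarrow> ln (norm (Q z)) - ln (norm (Q \<zeta>)) \<le> A * norm (z - \<zeta>) powr \<gamma>"
    and z: "z \<in> ball 0 1"
  shows "ln (norm (Q z)) - ln (norm (Q \<zeta>)) \<le> A / cos (pi * \<gamma> / 2) * norm (z - \<zeta>) powr \<gamma>"
proof -
  define c where "c = cos (pi * \<gamma> / 2)"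
  have c: "0 < c" unfolding c_def using \<gamma> by (rule cos_half_pi_mult_pos)
  define W where "W z = 1 - z * cnj \<zeta>" for z
  have \<zeta>\<zeta>: "\<zeta> * cnj \<zeta> = 1" using \<zeta> complex_norm_square[of \<zeta>] by simp
  have nW: "norm (W z) = norm (z - \<zeta>)" for z
  proof -
    have "W z = (\<zeta> - z) * cnj \<zeta>" by (simp add: W_def algebra_simps \<zeta>\<zeta>)
    then show ?thesis using \<zeta> by (simp add: norm_mult norm_minus_commute)
  qed
  have ReW: "0 \<le> Re (W z)" if "norm z \<le> 1" for z
    using complex_Re_le_cmod[of "z * cnj \<zeta>"] that \<zeta> by (simp add: W_def norm_mult)
  have ReW': "0 < Re (W z)" if "norm z < 1" for z
    using complex_Re_le_cmod[of "z * cnj \<zeta>"] that \<zeta> by (simp add: W_def norm_mult)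
  define \<Psi> where "\<Psi> z = Q z / of_real (norm (Q \<zeta>)) * exp (- of_real (A / c) * (W z powr of_real \<gamma>))" for z
  have \<zeta>in: "\<zeta> \<in> cball 0 1" using \<zeta> by simp
  have n\<Psi>: "norm (\<Psi> z) = exp (ln (norm (Q z)) - ln (norm (Q \<zeta>)) - A / c * Re (W z powr of_real \<gamma>))"
    if "z \<in> cball 0 1" for z
  proof -
    have "norm (Q z) / norm (Q \<zeta>) = exp (ln (norm (Q z)) - ln (norm (Q \<zeta>)))"
      using Q(3)[OF that] Q(3)[OF \<zeta>in] by (simp add: exp_diff)
    moreover have "norm (\<Psi> z) = norm (Q z) / norm (Q \<zeta>) * exp (- (A / c * Re (W z powr of_real \<gamma>)))"
      by (simp add: \<Psi>_def norm_mult norm_divide)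
    ultimately show ?thesis by (simp only: exp_add[symmetric]) simp
  qed
  have "norm (\<Psi> z) \<le> 1"
  proof (rule maximum_modulus_frontier[of \<Psi> "cball 0 1"])
    have "(\<lambda>z. W z powr of_real \<gamma>) holomorphic_on ball 0 1"
      unfolding W_def
      by (intro holomorphic_intros) (use ReW' in \<open>force simp: W_def complex_nonpos_Reals_iff\<close>)
    then show "\<Psi> holomorphic_on interior (cball 0 1)"
      unfolding \<Psi>_def using Q by (auto intro!: holomorphic_intros)
    have "continuous_on (cball 0 1) (\<lambda>z. W z powr of_real \<gamma>)"
    proof (rule continuous_on_powr_complex)
      show "cball 0 1 \<subseteq> {z. 0 \<le> Re (W z) \<or> Im (W z) \<noteq> 0}" using ReW by auto
    qed (use \<gamma> in \<open>auto simp: W_def intro!: continuous_intros\<close>)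
    then show "continuous_on (closure (cball 0 1)) \<Psi>"
      unfolding \<Psi>_def using Q Q(3)[OF \<zeta>in] c by (auto intro!: continuous_intros)
    show "norm (\<Psi> x) \<le> 1" if "x \<in> frontier (cball 0 1)" for x
    proof -
      have x: "norm x = 1" "x \<in> cball 0 1" using that by auto
      have "A * norm (x - \<zeta>) powr \<gamma> = A / c * (c * norm (W x) powr \<gamma>)" using c by (simp add: nW)
      also have "\<dots> \<le> A / c * Re (W x powr of_real \<gamma>)"
        unfolding c_def using Re_powr_bounds(1)[of "W x" \<gamma>] ReW[of x] x \<gamma> A c
        by (intro mult_left_mono) (auto simp: c_def)
      finally show ?thesis using bd[OF x(1)] unfolding n\<Psi>[OF x(2)] by simp
    qed
  qed (use z in auto)
  moreover have zc: "z \<in> cball 0 1" using z by simp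
  ultimately have "ln (norm (Q z)) - ln (norm (Q \<zeta>)) \<le> A / c * Re (W z powr of_real \<gamma>)"
    unfolding n\<Psi>[OF zc] by simp
  also have "\<dots> \<le> A / c * norm (z - \<zeta>) powr \<gamma>"
    using Re_powr_bounds(2)[of "W z" \<gamma>] ReW[of z] z \<gamma> A c nW[of z] by (intro mult_left_mono) auto
  finally show ?thesis by (simp add: c_def)
qed

lemma log_modulus_barrier_abs:
  assumes Q: "Q holomorphic_on ball 0 1" "continuous_on (cball 0 1) Q" "\<And>z. z \<in> cball 0 1 \<Longrightarrow> Q z \<noteq> 0"
    and \<gamma>: "0 < \<gamma>" "\<gamma> < 1" and A: "0 \<le> A" and \<zeta>: "norm \<zeta> = 1"
    and bd: "\<And>z. norm z = 1 \<Longrightarrow> \<bar>ln (norm (Q z)) - ln (norm (Q \<zeta>))\<bar> \<le> A * norm (z - \<zeta>) powr \<gamma>"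
    and z: "z \<in> ball 0 1"
  shows "\<bar>ln (norm (Q z)) - ln (norm (Q \<zeta>))\<bar> \<le> A / cos (pi * \<gamma> / 2) * norm (z - \<zeta>) powr \<gamma>"
proof -
  have ln_inv: "ln (norm (inverse (Q x))) = - ln (norm (Q x))" if "x \<in> cball 0 1" for x
    using Q(3)[OF that] by (simp add: norm_inverse ln_inverse)
  have in1: "z \<in> cball 0 1" "\<zeta> \<in> cball 0 1" using z \<zeta> by auto
  have "ln (norm (Q z)) - ln (norm (Q \<zeta>)) \<le> A / cos (pi * \<gamma> / 2) * norm (z - \<zeta>) powr \<gamma>"
    by (rule log_modulus_barrier[OF Q \<gamma> A \<zeta> _ z]) (use bd in \<open>force simp: abs_le_iff\<close>)+
  moreover have "ln (norm (inverse (Q z))) - ln (norm (inverse (Q \<zeta>))) \<le> A / cos (pi * \<gamma> / 2) * norm (z - \<zeta>) powr \<gamma>"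
  proof (rule log_modulus_barrier[OF _ _ _ \<gamma> A \<zeta> _ z])
    show "(\<lambda>z. inverse (Q z)) holomorphic_on ball 0 1" using Q by (auto intro!: holomorphic_intros)
    show "continuous_on (cball 0 1) (\<lambda>z. inverse (Q z))" using Q by (auto intro!: continuous_intros)
    show "inverse (Q x) \<noteq> 0" if "x \<in> cball 0 1" for x using Q(3)[OF that] by simp
    show "ln (norm (inverse (Q x))) - ln (norm (inverse (Q \<zeta>))) \<le> A * norm (x - \<zeta>) powr \<gamma>" if "norm x = 1" for x
      using bd[OF that] ln_inv[of x] ln_inv[OF in1(2)] that by (simp add: abs_le_iff)
  qed
  ultimately show ?thesis using ln_inv[OF in1(1)] ln_inv[OF in1(2)] by (simp add: abs_le_iff)
qed

text \<open>K = exp ((H - k) / M) has modulus between 1/e and e on the disc. Cauchy's inequality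
  bounds K' by e / R, and H' = M K' / K; hence the factor e^2.\<close>

lemma deriv_bound_by_real_part:
  assumes H: "H holomorphic_on ball w R'" and R: "0 < R" "R < R'" and M: "0 < M"
    and bd: "\<And>z. z \<in> cball w R \<Longrightarrow> \<bar>Re (H z) - k\<bar> \<le> M"
  shows "norm (deriv H w) \<le> (exp 1)\<^sup>2 * M / R"
proof -
  define K where "K z = exp ((H z - of_real k) / of_real M)" for z
  have nK: "norm (K z) = exp ((Re (H z) - k) / M)" for z by (simp add: K_def)
  have KM: "norm (K z) \<le> exp 1" "norm (K z) \<ge> exp (- 1)" if "z \<in> cball w R" for z
    using bd[OF that] M unfolding nK by (auto simp: abs_le_iff field_simps)
  have sub: "cball w R \<subseteq> ball w R'" "ball w R \<subseteq> ball w R'" using R by auto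
  have hK: "K holomorphic_on ball w R'" unfolding K_def using H M by (auto intro!: holomorphic_intros)
  have "norm ((deriv ^^ 1) K w) \<le> fact 1 * exp 1 / R ^ 1"
  proof (rule Cauchy_inequality)
    show "K holomorphic_on ball w R" using hK sub(2) by (rule holomorphic_on_subset)
    show "continuous_on (cball w R) K"
      using holomorphic_on_imp_continuous_on[OF hK] sub(1) by (rule continuous_on_subset)
    show "norm (K x) \<le> exp 1" if "norm (w - x) = R" for x using KM(1)[of x] that by (simp add: dist_norm)
  qed (rule R)
  moreover have "deriv K w = K w * (deriv H w / of_real M)"
  proof (rule DERIV_imp_deriv)
    have "(H has_field_derivative deriv H w) (at w)"
      using H R by (intro holomorphic_derivI[OF H]) auto
    then show "(K has_field_derivative K w * (deriv H w / of_real M)) (at w)"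
      unfolding K_def using M by (auto intro!: derivative_eq_intros)
  qed
  ultimately have "norm (K w) * (norm (deriv H w) / M) \<le> exp 1 / R"
    using M by (simp add: norm_mult norm_divide)
  moreover have "exp (- 1) * (norm (deriv H w) / M) \<le> norm (K w) * (norm (deriv H w) / M)"
    using KM(2)[of w] R M by (intro mult_right_mono) auto
  ultimately have "exp (- 1) * (norm (deriv H w) / M) \<le> exp 1 / R" by linarith
  then have "exp 1 * (exp (- 1) * (norm (deriv H w) / M)) \<le> exp 1 * (exp 1 / R)"
    by (intro mult_left_mono) auto
  then have "norm (deriv H w) / M \<le> (exp 1)\<^sup>2 / R"
    by (simp add: power2_eq_square mult.assoc[symmetric] exp_add[symmetric] del: mult.assoc)
  then show ?thesis using M by (simp add: field_simps)
qed

text \<open>A quantitative form of Privalov's theorem: the barrier gives \<open>\<bar>H' z\<bar> \<le> D (1 - \<bar>z\<bar>)\<^sup>\<gamma>\<^sup>-\<^sup>1\<close>, which is integrable along radii.\<close>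

lemma holomorphic_log_oscillation:
  assumes Q: "continuous_on (cball 0 1) Q" "\<And>z. z \<in> cball 0 1 \<Longrightarrow> Q z \<noteq> 0"
    and H: "H holomorphic_on ball 0 1" "\<And>z. z \<in> ball 0 1 \<Longrightarrow> Q z = exp (H z)"
    and \<gamma>: "0 < \<gamma>" "\<gamma> < 1" and A: "0 < A"
    and bd: "\<And>\<zeta> z. norm \<zeta> = 1 \<Longrightarrow> norm z = 1 \<Longrightarrow> \<bar>ln (norm (Q z)) - ln (norm (Q \<zeta>))\<bar> \<le> A * norm (z - \<zeta>) powr \<gamma>"
    and z: "z \<in> ball 0 1"
  shows "norm (H z - H 0) \<le> 4 * (exp 1)\<^sup>2 / (\<gamma> * cos (pi * \<gamma> / 2)) * A"
proof -
  define c where "c = cos (pi * \<gamma> / 2)"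
  have c: "0 < c" unfolding c_def using \<gamma> by (rule cos_half_pi_mult_pos)
  define D where "D = 4 * (exp 1)\<^sup>2 / c * A"
  have D: "0 < D" using A c by (simp add: D_def)
  have holQ: "Q holomorphic_on ball 0 1"
    by (rule holomorphic_transform[of "\<lambda>z. exp (H z)"]) (use H in \<open>auto intro!: holomorphic_intros\<close>)
  have ReH: "ln (norm (Q y)) = Re (H y)" if "y \<in> ball 0 1" for y using H(2)[OF that] by simp
  have dH: "norm (deriv H (of_real t * \<zeta>)) \<le> D * (1 - t) powr (\<gamma> - 1)"
    if \<zeta>: "norm \<zeta> = 1" and t: "0 \<le> t" "t < 1" for t \<zeta>
  proof -
    define R where "R = 1 - t"
    have R: "0 < R" using t by (simp add: R_def)
    let ?w = "of_real t * \<zeta>"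
    have nw: "norm ?w = t" using \<zeta> t by (simp add: norm_mult)
    have w\<zeta>: "norm (?w - \<zeta>) = R"
    proof -
      have "?w - \<zeta> = - (of_real R * \<zeta>)" by (simp add: R_def algebra_simps)
      then show ?thesis using \<zeta> R by (simp add: norm_mult)
    qed
    \<comment> \<open>R is the distance of ?w to the circle. Points of the disc of radius R/2 around
      ?w are within 3R/2 \<le> 2R of \<zeta>, where the barrier bound applies.\<close>
    have "norm (deriv H ?w) \<le> (exp 1)\<^sup>2 * (A / c * (2 * R) powr \<gamma>) / (R / 2)"
    proof (rule deriv_bound_by_real_part[where R' = R and k = "ln (norm (Q \<zeta>))"])
      have "ball ?w R \<subseteq> ball 0 1"
      proof
        fix y assume "y \<in> ball ?w R"
        then show "y \<in> ball 0 1" using norm_triangle_ineq[of "y - ?w" ?w] nw by (simp add: R_def dist_norm norm_minus_commute)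
      qed
      with H(1) show "H holomorphic_on ball ?w R" by (rule holomorphic_on_subset)
      show "\<bar>Re (H y) - ln (norm (Q \<zeta>))\<bar> \<le> A / c * (2 * R) powr \<gamma>" if y: "y \<in> cball ?w (R / 2)" for y
      proof -
        have yw: "norm (y - ?w) \<le> R / 2" using y by (simp add: dist_norm norm_minus_commute)
        have y1: "y \<in> ball 0 1" using norm_triangle_ineq[of "y - ?w" ?w] nw yw R by (simp add: R_def)
        have "\<bar>ln (norm (Q y)) - ln (norm (Q \<zeta>))\<bar> \<le> A / c * norm (y - \<zeta>) powr \<gamma>"
          unfolding c_def using A bd \<zeta> by (intro log_modulus_barrier_abs[OF holQ Q \<gamma> _ \<zeta> _ y1]) auto
        also have "\<dots> \<le> A / c * (2 * R) powr \<gamma>"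
          using norm_triangle_ineq[of "y - ?w" "?w - \<zeta>"] yw w\<zeta> R A c \<gamma>
          by (intro mult_left_mono powr_mono2) auto
        finally show ?thesis using ReH[OF y1] by simp
      qed
    qed (use R A c in auto)
    also have "\<dots> = 2 * (exp 1)\<^sup>2 * A / c * (2 powr \<gamma> * (R powr \<gamma> / R))"
      using R by (simp add: powr_mult)
    also have "R powr \<gamma> / R = R powr (\<gamma> - 1)" using R by (simp add: powr_diff)
    also have "2 * (exp 1)\<^sup>2 * A / c * (2 powr \<gamma> * R powr (\<gamma> - 1)) \<le> 2 * (exp 1)\<^sup>2 * A / c * (2 * R powr (\<gamma> - 1))"
    proof -
      have "2 powr \<gamma> \<le> (2::real) powr 1" using \<gamma> by (intro powr_mono) auto
      then show ?thesis using A c by (intro mult_left_mono mult_right_mono) auto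
    qed
    also have "\<dots> = D * R powr (\<gamma> - 1)" by (simp add: D_def)
    finally show ?thesis by (simp add: R_def)
  qed
  show ?thesis
  proof (cases "z = 0")
    case True
    then show ?thesis using A c \<gamma> by (simp add: c_def[symmetric])
  next
    case False
    define \<zeta> where "\<zeta> = sgn z"
    have \<zeta>: "norm \<zeta> = 1" using False by (simp add: \<zeta>_def norm_sgn)
    have z\<zeta>: "z = of_real (norm z) * \<zeta>" using False by (simp add: \<zeta>_def sgn_div_norm scaleR_conv_of_real)
    have nz: "norm z < 1" "0 < norm z" using z False by auto
    have in_ball: "of_real t * \<zeta> \<in> ball 0 1" if "0 \<le> t" "t < 1" for t using that \<zeta> by (simp add: norm_mult)
    \<comment> \<open>A primitive of D (1 - t)^(\<gamma> - 1) that stays bounded up to t = 1; its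
      total increase is at most D / \<gamma>.\<close>
    let ?\<phi> = "\<lambda>t. - (D / \<gamma>) * (1 - t) powr \<gamma>"
    have "norm (H (of_real (norm z) * \<zeta>) - H (of_real 0 * \<zeta>)) \<le> ?\<phi> (norm z) - ?\<phi> 0"
    proof (rule differentiable_bound_general[OF nz(2)])
      show "continuous_on {0..norm z} (\<lambda>t. H (of_real t * \<zeta>))"
        using in_ball nz by (intro continuous_intros continuous_on_compose2[OF holomorphic_on_imp_continuous_on[OF H(1)]]) auto
      show "continuous_on {0..norm z} ?\<phi>" using nz by (intro continuous_intros) auto
      fix t assume t: "0 < t" "t < norm z"
      have tb: "of_real t * \<zeta> \<in> ball 0 1" using in_ball t nz by auto
      have 1: "((\<lambda>t. of_real t * \<zeta>) has_vector_derivative \<zeta>) (at t)"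
        unfolding has_vector_derivative_def by (auto intro!: derivative_eq_intros simp: scaleR_conv_of_real)
      have 2: "(H has_field_derivative deriv H (of_real t * \<zeta>)) (at (of_real t * \<zeta>))"
        by (rule holomorphic_derivI[OF H(1) open_ball tb])
      show "((\<lambda>t. H (of_real t * \<zeta>)) has_vector_derivative \<zeta> * deriv H (of_real t * \<zeta>)) (at t)"
        using field_vector_diff_chain_at[OF 1 2] unfolding o_def .
      show "(?\<phi> has_vector_derivative D * (1 - t) powr (\<gamma> - 1)) (at t)"
        unfolding has_real_derivative_iff_has_vector_derivative[symmetric]
        using t nz \<gamma> by (auto intro!: derivative_eq_intros simp: powr_diff)
      show "norm (\<zeta> * deriv H (of_real t * \<zeta>)) \<le> D * (1 - t) powr (\<gamma> - 1)"
        using dH[OF \<zeta>, of t] t nz \<zeta> by (simp add: norm_mult)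
    qed
    also have "\<dots> \<le> D / \<gamma>" using D \<gamma> by simp
    also have "D / \<gamma> = 4 * (exp 1)\<^sup>2 / (\<gamma> * cos (pi * \<gamma> / 2)) * A" by (simp add: D_def c_def)
    finally show ?thesis using z\<zeta> by simp
  qed
qed

section \<open>Stability of the domain\<close>

lemma C1_holder_on_UNIV_deriv:
  fixes \<phi> :: "real \<Rightarrow> real"
  assumes "C1_holder_on \<alpha> UNIV \<phi>" "0 < \<alpha>"
  obtains C where "\<And>s. (\<phi> has_real_derivative deriv \<phi> s) (at s)"
    "\<And>x y. \<bar>deriv \<phi> x - deriv \<phi> y\<bar> \<le> C * \<bar>x - y\<bar> powr \<alpha>" "continuous_on UNIV (deriv \<phi>)"
proof -
  obtain f' :: "real \<Rightarrow> real \<Rightarrow>\<^sub>L real" and C where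
    f': "\<And>x. (\<phi> has_derivative blinfun_apply (f' x)) (at x)"
    and C: "\<And>x y. norm (f' x - f' y) \<le> C * norm (x - y) powr \<alpha>"
    using assms unfolding C1_holder_on_def holder_on_def by auto
  have D: "(\<phi> has_real_derivative blinfun_apply (f' x) 1) (at x)" for x
  proof -
    have "blinfun_apply (f' x) h = blinfun_apply (f' x) 1 * h" for h
      using blinfun.scaleR_right[of "f' x" h 1] by simp
    then have "blinfun_apply (f' x) = (*) (blinfun_apply (f' x) 1)" by (rule ext)
    with f'[of x] show ?thesis by (simp add: has_field_derivative_def)
  qed
  then have d: "deriv \<phi> x = blinfun_apply (f' x) 1" for x by (rule DERIV_imp_deriv)
  have bd: "\<bar>deriv \<phi> x - deriv \<phi> y\<bar> \<le> C * \<bar>x - y\<bar> powr \<alpha>" for x y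
    using norm_blinfun[of "f' x - f' y" 1] C[of x y] by (simp add: d blinfun.diff_left)
  have "holder_on \<alpha> UNIV (deriv \<phi>)" unfolding holder_on_def real_norm_def using bd by blast
  then have "continuous_on UNIV (deriv \<phi>)" using assms(2) by (rule holder_on_imp_continuous_on)
  with D d bd show ?thesis by (intro that) auto
qed

lemma sup_norm_upper:
  assumes "continuous_on {0..L} \<phi>" "s \<in> {0..L}"
  shows "\<bar>\<phi> s\<bar> \<le> sup_norm {0..L} \<phi>"
proof -
  have "bdd_above ((\<lambda>x. \<bar>\<phi> x\<bar>) ` {0..L})"
    by (intro bounded_imp_bdd_above compact_imp_bounded compact_continuous_image continuous_intros assms) auto
  then show ?thesis unfolding sup_norm_def using assms(2) by (intro cSUP_upper)
qed

lemma Ck_norm_1: "Ck_norm 1 I \<phi> = sup_norm I \<phi> + sup_norm I (deriv \<phi>)"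
  by (simp add: Ck_norm_def)

text \<open>A bound on the sum of norms bounds each term only if the others are nonnegative. For the
  seminorm, a real supremum, this uses that the Hoelder quotients are bounded above, which comes
  from membership in the class.\<close>

lemma class_G1_bounds:
  assumes \<phi>: "\<phi> \<in> class_G1 \<alpha> m M0 M1 L" and \<alpha>: "0 < \<alpha>" and L: "0 < L" and s: "s \<in> {0..L}"
  shows "\<bar>\<phi> s\<bar> \<le> M1" "\<bar>deriv \<phi> s\<bar> \<le> M1"
proof -
  have "C1_holder_on \<alpha> UNIV \<phi>" and le: "Ck_holder_norm 1 \<alpha> {0..L} \<phi> \<le> M1"
    using \<phi> by (auto simp: class_G1_def)
  then obtain C where D: "\<And>s. (\<phi> has_real_derivative deriv \<phi> s) (at s)"
    and C: "\<And>x y. \<bar>deriv \<phi> x - deriv \<phi> y\<bar> \<le> C * \<bar>x - y\<bar> powr \<alpha>" and c': "continuous_on UNIV (deriv \<phi>)"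
    using C1_holder_on_UNIV_deriv \<alpha> by blast
  have c: "continuous_on {0..L} \<phi>" using D DERIV_isCont continuous_at_imp_continuous_on by blast
  note up = sup_norm_upper[OF c s] sup_norm_upper[OF continuous_on_subset[OF c' subset_UNIV] s]
  have "0 \<le> holder_seminorm 1 \<alpha> {0..L} \<phi>"
  proof -
    let ?S = "{(x, y). x \<in> {0..L} \<and> y \<in> {0..L} \<and> x \<noteq> y}"
    let ?q = "\<lambda>(x, y). \<bar>(deriv ^^ 1) \<phi> x - (deriv ^^ 1) \<phi> y\<bar> / \<bar>x - y\<bar> powr \<alpha>"
    have "bdd_above (?q ` ?S)"
    proof (rule bdd_aboveI2)
      fix p assume "p \<in> ?S"
      then show "?q p \<le> C" using C[of "fst p" "snd p"] by (auto simp: divide_le_eq)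
    qed
    moreover have "(0, L) \<in> ?S" using L by auto
    ultimately have "?q (0, L) \<le> holder_seminorm 1 \<alpha> {0..L} \<phi>"
      unfolding holder_seminorm_def by (rule cSUP_upper[rotated])
    moreover have "0 \<le> ?q (0, L)" by simp
    ultimately show ?thesis by linarith
  qed
  moreover have "sup_norm {0..L} \<phi> + sup_norm {0..L} (deriv \<phi>) + holder_seminorm 1 \<alpha> {0..L} \<phi> \<le> M1"
    using le by (simp only: Ck_holder_norm_def Ck_norm_1)
  ultimately show "\<bar>\<phi> s\<bar> \<le> M1" "\<bar>deriv \<phi> s\<bar> \<le> M1"
    using up by linarith+
qed

lemma class_G1_lipschitz:
  assumes \<phi>: "\<phi> \<in> class_G1 \<alpha> m M0 M1 L" and \<alpha>: "0 < \<alpha>" and L: "0 < L" and s: "s \<in> {0..L}" "t \<in> {0..L}"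
  shows "\<bar>\<phi> s - \<phi> t\<bar> \<le> M1 * \<bar>s - t\<bar>"
proof -
  have "C1_holder_on \<alpha> UNIV \<phi>" using \<phi> by (auto simp: class_G1_def)
  then obtain C where D: "\<And>s. (\<phi> has_real_derivative deriv \<phi> s) (at s)"
    using C1_holder_on_UNIV_deriv \<alpha> by blast
  have "norm (\<phi> s - \<phi> t) \<le> M1 * norm (s - t)"
    by (rule field_differentiable_bound[of "{0..L}" \<phi> "deriv \<phi>"])
      (use D class_G1_bounds(2)[OF \<phi> \<alpha> L] s in \<open>auto intro: has_field_derivative_at_within\<close>)
  then show ?thesis by simp
qed

text \<open>The stability estimate is carried out in the supremum norm; this inequality passes to
  the norm of the theorem, the derivative term being nonnegative.\<close>

lemma sup_norm_le_Ck_norm_1: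
  assumes \<phi>: "\<phi> \<in> class_G1 \<alpha> m M0 M1 L" and \<psi>: "\<psi> \<in> class_G1 \<alpha> m M0 M1 L" and \<alpha>: "0 < \<alpha>" and L: "0 < L"
  shows "sup_norm {0..L} (\<lambda>s. \<phi> s - \<psi> s) \<le> Ck_norm 1 {0..L} (\<lambda>s. \<phi> s - \<psi> s)"
proof -
  have "C1_holder_on \<alpha> UNIV \<phi>" "C1_holder_on \<alpha> UNIV \<psi>" using \<phi> \<psi> by (auto simp: class_G1_def)
  then obtain D: "\<And>s. (\<phi> has_real_derivative deriv \<phi> s) (at s)" "continuous_on UNIV (deriv \<phi>)"
    and E: "\<And>s. (\<psi> has_real_derivative deriv \<psi> s) (at s)" "continuous_on UNIV (deriv \<psi>)"
    using C1_holder_on_UNIV_deriv \<alpha> by metis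
  have "deriv (\<lambda>s. \<phi> s - \<psi> s) = (\<lambda>s. deriv \<phi> s - deriv \<psi> s)"
    by (rule ext, rule DERIV_imp_deriv, rule DERIV_diff, rule D, rule E)
  moreover have "continuous_on {0..L} (\<lambda>s. deriv \<phi> s - deriv \<psi> s)"
    using D(2) E(2) by (intro continuous_on_diff) (auto intro: continuous_on_subset)
  ultimately have "\<bar>deriv (\<lambda>s. \<phi> s - \<psi> s) 0\<bar> \<le> sup_norm {0..L} (deriv (\<lambda>s. \<phi> s - \<psi> s))"
    using L by (intro sup_norm_upper) auto
  then show ?thesis unfolding Ck_norm_1 by linarith
qed

text \<open>If y \<le> x reach the same integral, then the part of T1 over [y, x] makes up for the
  difference T2 - T1 over [0, y], which is at most d L. Since T1 \<ge> m, that part is at least m (x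
  - y).\<close>

lemma arclength_compare_aux:
  fixes T1 T2 :: "real \<Rightarrow> real"
  assumes T1: "continuous_on {0..L} T1" "\<And>s. s \<in> {0..L} \<Longrightarrow> m \<le> T1 s" and T2: "continuous_on {0..L} T2"
    and d: "\<And>s. s \<in> {0..L} \<Longrightarrow> \<bar>T1 s - T2 s\<bar> \<le> d"
    and x: "0 \<le> y" "y \<le> x" "x \<le> L"
    and eq: "integral {0..x} T1 = integral {0..y} T2"
  shows "m * (x - y) \<le> d * L"
proof -
  have i: "T1 integrable_on {a..b}" "T2 integrable_on {a..b}" if "0 \<le> a" "b \<le> L" for a b
    using that by (auto intro!: integrable_continuous_interval continuous_on_subset[OF T1(1)] continuous_on_subset[OF T2])
  have "integral {0..x} T1 = integral {0..y} T1 + integral {y..x} T1"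
    using x i by (intro Henstock_Kurzweil_Integration.integral_combine[symmetric]) auto
  then have "integral {y..x} T1 = integral {0..y} (\<lambda>s. T2 s - T1 s)"
    using eq x i by (simp add: Henstock_Kurzweil_Integration.integral_diff)
  also have "\<dots> \<le> integral {0..y} (\<lambda>s. d)"
    using x i d by (intro integral_le integrable_diff) (auto simp: abs_le_iff)
  also have "\<dots> = d * y" using x by simp
  also have "\<dots> \<le> d * L" using x d[of 0] by (intro mult_left_mono) auto
  finally have "integral {y..x} T1 \<le> d * L" .
  moreover have "integral {y..x} (\<lambda>s. m) \<le> integral {y..x} T1"
    using x i T1(2) by (intro integral_le) auto
  ultimately show ?thesis using x by (simp add: mult.commute)
qed

lemma integral_along_arclength:
  fixes T s :: "real \<Rightarrow> real"
  assumes T: "continuous_on {0..L} T" "\<And>x. x \<in> {0..L} \<Longrightarrow> 0 < T x"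
    and s: "s 0 = 0" "\<And>\<theta>. \<theta> \<in> {0..b} \<Longrightarrow> s \<theta> \<in> {0..L}"
      "\<And>\<theta>. \<theta> \<in> {0..b} \<Longrightarrow> (s has_real_derivative k / T (s \<theta>)) (at \<theta> within {0..b})"
    and \<theta>: "\<theta> \<in> {0..b}"
  shows "integral {0..s \<theta>} T = k * \<theta>"
proof -
  define h where "h \<theta> = integral {0..s \<theta>} T - k * \<theta>" for \<theta>
  have "(h has_real_derivative 0) (at \<theta> within {0..b})" if \<theta>: "\<theta> \<in> {0..b}" for \<theta>
  proof -
    have "((\<lambda>x. integral {0..x} T) has_real_derivative T (s \<theta>)) (at (s \<theta>) within {0..L})"
      using integral_has_real_derivative[OF T(1) s(2)[OF \<theta>]] .
    then have "((\<lambda>x. integral {0..x} T) has_real_derivative T (s \<theta>)) (at (s \<theta>) within s ` {0..b})"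
      by (rule has_field_derivative_subset) (use s(2) in auto)
    from DERIV_image_chain[OF this s(3)[OF \<theta>]]
    have "((\<lambda>\<theta>. integral {0..s \<theta>} T) has_real_derivative k) (at \<theta> within {0..b})"
      using T(2)[OF s(2)[OF \<theta>]] by (simp add: o_def)
    then have "(h has_real_derivative k - k * 1) (at \<theta> within {0..b})"
      unfolding h_def by (intro DERIV_diff DERIV_cmult DERIV_ident)
    then show ?thesis by simp
  qed
  then obtain c where "\<forall>\<theta>\<in>{0..b}. h \<theta> = c"
    using has_field_derivative_zero_constant[of "{0..b}" h] by auto
  moreover have "0 \<in> {0..b}" "h 0 = 0" using \<theta> s(1) by (auto simp: h_def)
  ultimately have "h \<theta> = 0" using \<theta> by metis
  then show ?thesis by (simp add: h_def)
qed

section \<open>Elementary inequalities, and estimates passing from the circle to the disc\<close>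

lemma ln_diff_le:
  fixes a b m :: real
  assumes "0 < m" "m \<le> a" "m \<le> b"
  shows "\<bar>ln a - ln b\<bar> \<le> \<bar>a - b\<bar> / m"
proof -
  have 1: "ln x - ln y \<le> \<bar>x - y\<bar> / m" if "m \<le> x" "m \<le> y" for x y
  proof -
    have "ln x - ln y \<le> (x - y) / y" using ln_diff_le that assms by simp
    also have "\<dots> \<le> \<bar>x - y\<bar> / y" using that assms by (intro divide_right_mono) auto
    also have "\<dots> \<le> \<bar>x - y\<bar> / m" using that assms by (intro divide_left_mono) auto
    finally show ?thesis .
  qed
  show ?thesis using 1[of a b] 1[of b a] assms by (simp add: abs_le_iff abs_minus_commute)
qed

text \<open>A rough form of Jordan's inequality: sin x \<ge> x - x^3 / 6, and x \<le> 2 gives x^3 /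
  6 \<le> 2x / 3.\<close>

lemma sin_ge_third: "0 \<le> x \<Longrightarrow> x \<le> pi / 2 \<Longrightarrow> x / 3 \<le> sin x" for x :: real
proof -
  assume x: "0 \<le> x" "x \<le> pi / 2"
  have "\<bar>sin x - (\<Sum>m<3. sin_coeff m * x ^ m)\<bar> \<le> inverse (fact 3) * \<bar>x\<bar> ^ 3"
    by (rule Maclaurin_sin_bound)
  then have "\<bar>sin x - x\<bar> \<le> x ^ 3 / 6"
    using x by (simp add: sin_coeff_def numeral_3_eq_3 fact_numeral)
  moreover have "x ^ 3 \<le> 4 * x"
  proof -
    have "x \<le> 2" using x pi_less_4 by linarith
    then have "x * x \<le> 2 * 2" using x by (intro mult_mono) auto
    then have "(x * x) * x \<le> 4 * x" using x by (intro mult_right_mono) auto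
    then show ?thesis by (simp add: power3_eq_cube)
  qed
  ultimately show ?thesis by linarith
qed

lemma norm_cis_diff: "norm (cis a - cis b) = 2 * \<bar>sin ((a - b) / 2)\<bar>"
proof -
  have "cis a - cis b = cis b * (cis (a - b) - 1)" by (simp add: algebra_simps cis_mult)
  then have "norm (cis a - cis b) = norm (cis (a - b) - 1)" by (simp add: norm_mult)
  then show ?thesis using dist_exp_i_1[of "a - b"] by (simp add: cis_conv_exp)
qed

lemma unit_circle_param:
  assumes "norm (z :: complex) = 1"
  obtains \<theta> where "0 \<le> \<theta>" "\<theta> < 2 * pi" "z = cis \<theta>"
  using Arg2pi[of z] assms by (intro that[of "Arg2pi z"]) (auto simp: is_Arg_def cis_conv_exp)

text \<open>A chord is at least a third of the shorter arc. If the parameters differ by more than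
  \<pi>, the shorter arc passes through cis 0 = cis (2 \<pi>), and the hypothesis is used on both
  sides of that point.\<close>

lemma circle_lipschitz:
  fixes h :: "complex \<Rightarrow> real"
  assumes h: "\<And>a b. a \<in> {0..2 * pi} \<Longrightarrow> b \<in> {0..2 * pi} \<Longrightarrow> \<bar>h (cis a) - h (cis b)\<bar> \<le> K * \<bar>a - b\<bar>"
    and K: "0 \<le> K" and z: "norm z = 1" "norm w = 1"
  shows "\<bar>h z - h w\<bar> \<le> 3 * K * norm (z - w)"
proof -
  have ordered: "\<bar>h (cis a) - h (cis b)\<bar> \<le> 3 * K * norm (cis a - cis b)"
    if ab: "0 \<le> a" "a \<le> b" "b < 2 * pi" for a b
  proof (cases "b - a \<le> pi")
    case True
    have "(b - a) / 2 / 3 \<le> sin ((b - a) / 2)" using True ab by (intro sin_ge_third) auto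
    then have "b - a \<le> 3 * norm (cis b - cis a)" unfolding norm_cis_diff by simp
    then have "K * (b - a) \<le> K * (3 * norm (cis b - cis a))" using K by (rule mult_left_mono)
    then show ?thesis using h[of a b] ab by (simp add: norm_minus_commute mult_ac)
  next
    case False
    have s: "sin ((b - a) / 2) = sin ((2 * pi - (b - a)) / 2)"
      by (simp add: diff_divide_distrib sin_diff)
    have "(2 * pi - (b - a)) / 2 / 3 \<le> sin ((2 * pi - (b - a)) / 2)"
      using False ab by (intro sin_ge_third) auto
    then have "2 * pi - (b - a) \<le> 3 * norm (cis b - cis a)" unfolding norm_cis_diff s by simp
    then have "K * (2 * pi - (b - a)) \<le> K * (3 * norm (cis b - cis a))" using K by (rule mult_left_mono)
    moreover have "\<bar>h (cis a) - h (cis 0)\<bar> \<le> K * a" using h[of a 0] ab by simp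
    moreover have "\<bar>h (cis 0) - h (cis b)\<bar> \<le> K * (2 * pi - b)" using h[of "2 * pi" b] ab by simp
    moreover have "K * a + K * (2 * pi - b) = K * (2 * pi - (b - a))" by (simp add: algebra_simps)
    ultimately show ?thesis by (simp add: norm_minus_commute mult_ac)
  qed
  obtain a b where "0 \<le> a" "a < 2 * pi" "z = cis a" "0 \<le> b" "b < 2 * pi" "w = cis b"
    using unit_circle_param z by metis
  then show ?thesis
    using ordered[of a b] ordered[of b a] by (cases "a \<le> b") (auto simp: norm_minus_commute abs_minus_commute)
qed

lemma norm_exp_minus_1_le: "norm (exp z - 1) \<le> norm z * exp (norm z)" for z :: complex
proof -
  have "norm (exp z - exp 0) \<le> exp (norm z) * norm (z - 0)"
    by (rule field_differentiable_bound[of "cball 0 (norm z)" exp exp])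
      (auto intro!: DERIV_exp[THEN has_field_derivative_at_within] intro: order_trans[OF complex_Re_le_cmod])
  then show ?thesis by (simp add: mult.commute)
qed

text \<open>Combines a bound that is small with one that is Lipschitz into a Hoelder bound with
  small constant.\<close>

lemma interpolation_powr:
  fixes x a b \<alpha> :: real
  assumes "0 \<le> x" "x \<le> a" "x \<le> b" "0 \<le> \<alpha>" "\<alpha> \<le> 1"
  shows "x \<le> a powr \<alpha> * b powr (1 - \<alpha>)"
proof -
  have "x = x powr \<alpha> * x powr (1 - \<alpha>)" using assms by (simp add: powr_add[symmetric])
  also have "\<dots> \<le> a powr \<alpha> * b powr (1 - \<alpha>)"
    using assms by (intro mult_mono powr_mono2) auto
  finally show ?thesis .
qed

text \<open>As Q 0 = q is positive, Q z = exp (H z - H 0 + ln q). The oscillation of H is at most E,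
  and |ln q| \<le> \<delta> by the maximum modulus principle for Q and its inverse; so the exponent
  is at most \<delta> + E in modulus.\<close>

lemma holomorphic_quotient_near_1:
  fixes Q :: "complex \<Rightarrow> complex"
  assumes Q: "Q holomorphic_on ball 0 1" "continuous_on (cball 0 1) Q" "\<And>z. z \<in> cball 0 1 \<Longrightarrow> Q z \<noteq> 0"
    and Q0: "Q 0 = of_real q" "0 < q" and \<gamma>: "0 < \<gamma>" "\<gamma> < 1" and A: "0 \<le> A"
    and sup: "\<And>z. norm z = 1 \<Longrightarrow> \<bar>ln (norm (Q z))\<bar> \<le> \<delta>"
    and bd: "\<And>\<zeta> z. norm \<zeta> = 1 \<Longrightarrow> norm z = 1 \<Longrightarrow> \<bar>ln (norm (Q z)) - ln (norm (Q \<zeta>))\<bar> \<le> A * norm (z - \<zeta>) powr \<gamma>"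
    and z: "z \<in> ball 0 1"
  defines "E \<equiv> 4 * (exp 1)\<^sup>2 / (\<gamma> * cos (pi * \<gamma> / 2)) * A"
  shows "norm (Q z - 1) \<le> exp (\<delta> + E) * (\<delta> + E)"
proof -
  have \<delta>: "0 \<le> \<delta>" using sup[of 1] by simp
  obtain H where H: "H holomorphic_on ball 0 1" "\<And>z. z \<in> ball 0 1 \<Longrightarrow> Q z = exp (H z)"
    using contractible_imp_holomorphic_log[OF Q(1) convex_imp_contractible[OF convex_ball]] Q(3)
    by (metis ball_subset_cball subsetD)
  define C where "C = 4 * (exp 1)\<^sup>2 / (\<gamma> * cos (pi * \<gamma> / 2))"
  have C: "0 < C" unfolding C_def using \<gamma> cos_half_pi_mult_pos[OF \<gamma>] by simp
  have E_eq: "E = C * A" by (simp add: E_def C_def)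
  \<comment> \<open>The oscillation bound asks for a positive constant; A + e / C with e tending to
    0 also covers A = 0.\<close>
  have osc: "norm (H z - H 0) \<le> E"
  proof (rule field_le_epsilon)
    fix e :: real assume e: "0 < e"
    have "norm (H z - H 0) \<le> C * (A + e / C)"
      unfolding C_def
    proof (rule holomorphic_log_oscillation[OF Q(2,3) H \<gamma> _ _ z], unfold C_def[symmetric])
      show "0 < A + e / C" by (intro add_nonneg_pos divide_pos_pos A e C)
      fix \<zeta> z :: complex assume "norm \<zeta> = 1" "norm z = 1"
      then have "\<bar>ln (norm (Q z)) - ln (norm (Q \<zeta>))\<bar> \<le> A * norm (z - \<zeta>) powr \<gamma>" by (rule bd)
      also have "\<dots> \<le> (A + e / C) * norm (z - \<zeta>) powr \<gamma>"
        using divide_pos_pos[OF e C] by (intro mult_right_mono) auto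
      finally show "\<bar>ln (norm (Q z)) - ln (norm (Q \<zeta>))\<bar> \<le> (A + e / C) * norm (z - \<zeta>) powr \<gamma>" .
    qed
    also have "\<dots> = E + e" using C by (simp add: E_eq distrib_left)
    finally show "norm (H z - H 0) \<le> E + e" .
  qed
  have E: "0 \<le> E" using C A by (simp add: E_eq)
  have in0: "(0::complex) \<in> cball 0 1" by simp
  have up: "norm (R 0) \<le> exp \<delta>"
    if "R holomorphic_on ball 0 1" "continuous_on (cball 0 1) R" "\<And>z. norm z = 1 \<Longrightarrow> norm (R z) \<le> exp \<delta>" for R :: "complex \<Rightarrow> complex"
    by (rule maximum_modulus_frontier[of R "cball 0 1"]) (use that in auto)
  have "norm (Q 0) \<le> exp \<delta>"
  proof (rule up[OF Q(1,2)])
    fix z :: complex assume z: "norm z = 1"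
    then have "0 < norm (Q z)" using Q(3)[of z] by simp
    then show "norm (Q z) \<le> exp \<delta>" using sup[OF z] by (metis abs_le_D1 exp_le_cancel_iff exp_ln)
  qed
  then have q1: "q \<le> exp \<delta>" using Q0 by simp
  have "norm (inverse (Q 0)) \<le> exp \<delta>"
  proof (rule up[of "\<lambda>z. inverse (Q z)"])
    show "(\<lambda>z. inverse (Q z)) holomorphic_on ball 0 1" using Q by (auto intro!: holomorphic_intros)
    show "continuous_on (cball 0 1) (\<lambda>z. inverse (Q z))" using Q by (auto intro!: continuous_intros)
    fix z :: complex assume z: "norm z = 1"
    then have *: "0 < norm (Q z)" using Q(3)[of z] by simp
    have "exp (- \<delta>) \<le> norm (Q z)" using sup[OF z] * by (metis abs_le_iff exp_le_cancel_iff exp_ln minus_le_iff)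
    then show "norm (inverse (Q z)) \<le> exp \<delta>" using le_imp_inverse_le[of "exp (- \<delta>)" "norm (Q z)"] by (simp add: norm_inverse exp_minus)
  qed
  then have q2: "inverse q \<le> exp \<delta>" using Q0 by (simp add: norm_inverse)
  have "\<bar>ln q\<bar> \<le> \<delta>"
    using q1 q2 Q0(2) ln_le_cancel_iff[of q "exp \<delta>"] ln_le_cancel_iff[of "inverse q" "exp \<delta>"]
    by (simp add: ln_inverse abs_le_iff)
  then have "norm (of_real (ln q) :: complex) \<le> \<delta>" by simp
  with osc have X: "norm (H z - H 0 + of_real (ln q)) \<le> \<delta> + E"
    using norm_triangle_ineq[of "H z - H 0" "of_real (ln q)"] by linarith
  have "Q z = exp (H z - H 0 + of_real (ln q))"
  proof -
    have "exp (H 0) = of_real q" using H(2)[of 0] Q0 by simp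
    moreover have "exp (of_real (ln q)) = (of_real q :: complex)" using Q0(2) by (simp only: exp_of_real exp_ln)
    ultimately show ?thesis using H(2)[OF z] Q0(2) by (simp add: exp_add exp_diff)
  qed
  then have "norm (Q z - 1) \<le> norm (H z - H 0 + of_real (ln q)) * exp (norm (H z - H 0 + of_real (ln q)))"
    using norm_exp_minus_1_le[of "H z - H 0 + of_real (ln q)"] by (simp only:)
  also have "\<dots> \<le> (\<delta> + E) * exp (\<delta> + E)" using X \<delta> E by (intro mult_mono) auto
  finally show ?thesis by (simp add: mult.commute)
qed

lemma hausdorff_excess_image_le:
  assumes "S \<noteq> {}" "\<And>z. z \<in> S \<Longrightarrow> dist (p z) (q z) \<le> k"
  shows "hausdorff_excess (p ` S) (q ` S) \<le> k"
  unfolding hausdorff_excess_def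
proof (rule cSUP_least)
  show "p ` S \<noteq> {}" using assms(1) by simp
  fix a assume "a \<in> p ` S"
  then obtain z where z: "z \<in> S" "a = p z" by blast
  have "infdist a (q ` S) \<le> dist a (q z)" using z(1) by (intro infdist_le imageI)
  with assms(2)[OF z(1)] z(2) show "infdist a (q ` S) \<le> k" by simp
qed

section \<open>Estimates for a single domain under the a priori bounds\<close>

locale regular_conformal_disc = conformal_disc +
  fixes \<alpha> m M0 M1 L :: real
  assumes T: "op_T f \<in> class_G1 \<alpha> m M0 M1 L" and \<alpha>: "0 < \<alpha>" and m: "0 < m" and L: "perimeter f = L"
begin

lemma L_pos: "0 < L"
  using perimeter_pos L by simp

lemma op_T_ge: "m \<le> op_T f s"
  using T by (simp add: class_G1_def class_G0_def)

lemma op_T_pos: "0 < op_T f s"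
  using op_T_ge[of s] m by linarith

lemma op_T_periodic: "op_T f (s + perimeter f) = op_T f s"
  using T L by (simp add: class_G1_def class_G0_def)

lemma op_T_continuous: "continuous_on A (op_T f)"
proof -
  have "C1_holder_on \<alpha> UNIV (op_T f)" using T by (simp add: class_G1_def)
  then show ?thesis
    using C1_holder_on_UNIV_deriv[OF _ \<alpha>] by (metis DERIV_isCont continuous_at_imp_continuous_on)
qed

lemma arclength_in: "\<theta> \<in> {0..2 * pi} \<Longrightarrow> boundary_arclength f \<theta> \<in> {0..L}"
  using boundary_arclength_strict_mono[of 0 \<theta>] boundary_arclength_strict_mono[of \<theta> "2 * pi"] L perimeter_pos
  by (cases "\<theta> = 0"; cases "\<theta> = 2 * pi") (auto simp: perimeter_def boundary_arclength_eq)

lemma speed: "\<theta> \<in> {0..2 * pi} \<Longrightarrow> norm (F (cis \<theta>)) = 1 / (2 * pi * op_T f (boundary_arclength f \<theta>))"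
  using boundary_speed(2)[OF op_T_pos op_T_periodic] by simp

lemma speed_le: "norm z = 1 \<Longrightarrow> norm (F z) \<le> 1 / (2 * pi * m)"
proof -
  assume "norm z = 1"
  then obtain \<theta> where \<theta>: "0 \<le> \<theta>" "\<theta> < 2 * pi" "z = cis \<theta>" by (rule unit_circle_param)
  have "norm (F z) = 1 / (2 * pi * op_T f (boundary_arclength f \<theta>))" using \<theta> speed[of \<theta>] by simp
  also have "\<dots> \<le> 1 / (2 * pi * m)"
    using m op_T_ge op_T_pos by (intro divide_left_mono mult_left_mono mult_pos_pos) auto
  finally show ?thesis .
qed

lemma norm_F_le: "z \<in> ball 0 1 \<Longrightarrow> norm (F z) \<le> 1 / (2 * pi * m)"
  by (rule maximum_modulus_frontier[of F "cball 0 1"]) (auto simp: holF contF speed_le)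

lemma F_nonzero_cball:
  assumes z: "z \<in> cball 0 1"
  shows "F z \<noteq> 0"
proof (cases "norm z = 1")
  case True
  then obtain \<theta> where "z = cis \<theta>" by (rule unit_circle_param)
  then show ?thesis using boundary_speed(1)[OF op_T_pos op_T_periodic] by simp
next
  case False
  then have "z \<in> ball 0 1" using z by (simp add: less_le)
  then show ?thesis by (rule F_nonzero)
qed

lemma ln_speed:
  "\<theta> \<in> {0..2 * pi} \<Longrightarrow> ln (norm (F (cis \<theta>))) = - ln (2 * pi) - ln (op_T f (boundary_arclength f \<theta>))"
  using op_T_pos[of "boundary_arclength f \<theta>"] by (simp add: speed ln_div ln_mult)

text \<open>Up to a constant, ln |F| is minus the logarithm of \<open>op_T\<close> at the arclength.
  The Lipschitz constants multiply: 1 / (2 \<pi> m) for the arclength, M1 for \<open>op_T\<close>,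
  and 1/m for the logarithm on [m, \<infinity>).\<close>

lemma ln_speed_lipschitz:
  assumes "a \<in> {0..2 * pi}" "b \<in> {0..2 * pi}"
  shows "\<bar>ln (norm (F (cis a))) - ln (norm (F (cis b)))\<bar> \<le> M1 / (2 * pi * m\<^sup>2) * \<bar>a - b\<bar>"
proof -
  let ?s = "boundary_arclength f"
  have M1: "0 \<le> M1" using class_G1_bounds(1)[OF T \<alpha> L_pos, of 0] L_pos by simp
  have "norm (?s a - ?s b) \<le> 1 / (2 * pi * m) * norm (a - b)"
    by (rule field_differentiable_bound[of "{0..2 * pi}" ?s "\<lambda>\<theta>. norm (F (cis \<theta>))"])
      (use assms boundary_arclength_deriv speed_le in auto)
  then have s: "\<bar>?s a - ?s b\<bar> \<le> 1 / (2 * pi * m) * \<bar>a - b\<bar>" by simp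
  have "\<bar>ln (norm (F (cis a))) - ln (norm (F (cis b)))\<bar> = \<bar>ln (op_T f (?s a)) - ln (op_T f (?s b))\<bar>"
    using assms by (simp add: ln_speed abs_minus_commute)
  also have "\<dots> \<le> \<bar>op_T f (?s a) - op_T f (?s b)\<bar> / m"
    by (intro ln_diff_le m op_T_ge)
  also have "\<dots> \<le> (M1 * \<bar>?s a - ?s b\<bar>) / m"
    using m assms by (intro divide_right_mono class_G1_lipschitz[OF T \<alpha> L_pos] arclength_in) auto
  also have "\<dots> \<le> (M1 * (1 / (2 * pi * m) * \<bar>a - b\<bar>)) / m"
    using m M1 s by (intro divide_right_mono mult_left_mono) auto
  also have "\<dots> = M1 / (2 * pi * m\<^sup>2) * \<bar>a - b\<bar>" by (simp add: power2_eq_square)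
  finally show ?thesis .
qed

lemma integral_op_T: "\<theta> \<in> {0..2 * pi} \<Longrightarrow> integral {0..boundary_arclength f \<theta>} (op_T f) = 1 / (2 * pi) * \<theta>"
proof (rule integral_along_arclength[of L])
  show "(boundary_arclength f has_real_derivative 1 / (2 * pi) / op_T f (boundary_arclength f \<theta>))
     (at \<theta> within {0..2 * pi})" if "\<theta> \<in> {0..2 * pi}" for \<theta>
    using boundary_arclength_deriv[OF that] by (simp add: speed[OF that])
  show "boundary_arclength f 0 = 0" by (simp add: boundary_arclength_eq)
  show "boundary_arclength f \<theta> \<in> {0..L}" if "\<theta> \<in> {0..2 * pi}" for \<theta>
    using that by (rule arclength_in)
qed (auto simp: op_T_continuous op_T_pos)

end

section \<open>Comparison of two domains\<close>

lemma arclength_compare: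
  assumes D1: "regular_conformal_disc f1 F1 \<alpha> m M0 M1 L" and D2: "regular_conformal_disc f2 F2 \<alpha> m M0 M1 L"
    and d: "\<And>s. s \<in> {0..L} \<Longrightarrow> \<bar>op_T f1 s - op_T f2 s\<bar> \<le> d" and \<theta>: "\<theta> \<in> {0..2 * pi}"
  shows "\<bar>boundary_arclength f1 \<theta> - boundary_arclength f2 \<theta>\<bar> \<le> d * L / m"
proof -
  interpret D1: regular_conformal_disc f1 F1 \<alpha> m M0 M1 L by (rule D1)
  interpret D2: regular_conformal_disc f2 F2 \<alpha> m M0 M1 L by (rule D2)
  let ?s1 = "boundary_arclength f1 \<theta>" and ?s2 = "boundary_arclength f2 \<theta>"
  have "m * \<bar>?s1 - ?s2\<bar> \<le> d * L"
  proof (cases "?s2 \<le> ?s1")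
    case True
    have "m * (?s1 - ?s2) \<le> d * L"
      by (rule arclength_compare_aux[OF D1.op_T_continuous D1.op_T_ge D2.op_T_continuous d])
        (use D1.arclength_in[OF \<theta>] D2.arclength_in[OF \<theta>] D1.integral_op_T[OF \<theta>] D2.integral_op_T[OF \<theta>] True in auto)
    then show ?thesis using True by simp
  next
    case False
    have "m * (?s2 - ?s1) \<le> d * L"
      by (rule arclength_compare_aux[OF D2.op_T_continuous D2.op_T_ge D1.op_T_continuous])
        (use D1.arclength_in[OF \<theta>] D2.arclength_in[OF \<theta>] D1.integral_op_T[OF \<theta>] D2.integral_op_T[OF \<theta>] False d
          in \<open>auto simp: abs_minus_commute\<close>)
    then show ?thesis using False by simp
  qed
  then show ?thesis using D1.m by (simp add: field_simps)
qed

text \<open>\<open>C1\<close> d bounds ln |F1 / F2| on the circle, and \<open>C2\<close> d^\<alpha>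
  is the oscillation bound with exponent \<gamma> = 1 - \<alpha>. The remaining factors come from d
  \<le> 2 M1 and from |F2| \<le> 1 / (2 \<pi> m).\<close>

lemma derivative_difference_bound:
  fixes \<alpha> m M0 M1 L :: real
  assumes D1: "regular_conformal_disc f1 F1 \<alpha> m M0 M1 L" and D2: "regular_conformal_disc f2 F2 \<alpha> m M0 M1 L"
    and \<alpha>1: "\<alpha> < 1" and z: "z \<in> ball 0 1"
  defines "d \<equiv> sup_norm {0..L} (\<lambda>s. op_T f1 s - op_T f2 s)"
    and "C1 \<equiv> (1 + M1 * L / m) / m"
    and "C2 \<equiv> 4 * (exp 1)\<^sup>2 / ((1 - \<alpha>) * cos (pi * (1 - \<alpha>) / 2)) *
      ((2 * ((1 + M1 * L / m) / m)) powr \<alpha> * (3 * (M1 / (pi * m\<^sup>2))) powr (1 - \<alpha>))"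
  shows "norm (cis (Arg (F2 0 / F1 0)) * F1 z - F2 z)
    \<le> 1 / (2 * pi * m) * (exp (C1 * (2 * M1) + C2 * (2 * M1) powr \<alpha>) * (C1 * (2 * M1) powr (1 - \<alpha>) + C2)) * d powr \<alpha>"
proof -
  interpret D1: regular_conformal_disc f1 F1 \<alpha> m M0 M1 L by (rule D1)
  interpret D2: regular_conformal_disc f2 F2 \<alpha> m M0 M1 L by (rule D2)
  note disc1 = D1.contF D1.holF D1.F_nonzero_cball and disc2 = D2.contF D2.holF D2.F_nonzero_cball
  note \<alpha> = D1.\<alpha> \<alpha>1 and m = D1.m and Lpos = D1.L_pos and T1 = D1.T and T2 = D2.T
  let ?X = "exp (C1 * (2 * M1) + C2 * (2 * M1) powr \<alpha>)" and ?Y = "C1 * (2 * M1) powr (1 - \<alpha>) + C2"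
    and ?C = "4 * (exp 1)\<^sup>2 / ((1 - \<alpha>) * cos (pi * (1 - \<alpha>) / 2))"
  have M1: "0 \<le> M1" using class_G1_bounds(1)[OF T1 \<alpha>(1) Lpos, of 0] Lpos by simp
  have cont: "continuous_on {0..L} (\<lambda>s. op_T f1 s - op_T f2 s)"
    by (intro continuous_on_diff D1.op_T_continuous
        D2.op_T_continuous)
  have d: "\<bar>op_T f1 s - op_T f2 s\<bar> \<le> d" if "s \<in> {0..L}" for s
    unfolding d_def using sup_norm_upper[OF cont that] .
  have d0: "0 \<le> d" using d[of 0] Lpos by simp
  have d2: "d \<le> 2 * M1" unfolding d_def sup_norm_def
  proof (rule cSUP_least)
    show "{0..L} \<noteq> {}" using Lpos by simp
    fix s assume "s \<in> {0..L}"
    then have "\<bar>op_T f1 s\<bar> \<le> M1" "\<bar>op_T f2 s\<bar> \<le> M1"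
      using class_G1_bounds(1)[OF T1 \<alpha>(1) Lpos] class_G1_bounds(1)[OF T2 \<alpha>(1) Lpos] by auto
    then show "\<bar>op_T f1 s - op_T f2 s\<bar> \<le> 2 * M1" by linarith
  qed
  have C1: "0 < C1" unfolding C1_def using m M1 Lpos by (simp add: add_pos_nonneg)
  define \<Delta> where "\<Delta> z = ln (norm (F1 z)) - ln (norm (F2 z))" for z
  have \<Delta>_le: "\<bar>\<Delta> z\<bar> \<le> C1 * d" if z: "norm z = 1" for z
  proof -
    obtain \<theta> where \<theta>: "0 \<le> \<theta>" "\<theta> < 2 * pi" "z = cis \<theta>" using z by (rule unit_circle_param)
    then have \<theta>in: "\<theta> \<in> {0..2 * pi}" by simp
    let ?s1 = "boundary_arclength f1 \<theta>" and ?s2 = "boundary_arclength f2 \<theta>"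
    have s: "?s1 \<in> {0..L}" "?s2 \<in> {0..L}"
      using D1.arclength_in[OF \<theta>in] D2.arclength_in[OF \<theta>in] .
    have "\<Delta> z = ln (op_T f2 ?s2) - ln (op_T f1 ?s1)"
      unfolding \<Delta>_def \<theta>(3) D1.ln_speed[OF \<theta>in]
        D2.ln_speed[OF \<theta>in] by simp
    then have "\<bar>\<Delta> z\<bar> \<le> \<bar>op_T f2 ?s2 - op_T f1 ?s1\<bar> / m"
      using ln_diff_le[OF m D2.op_T_ge[of ?s2]
          D1.op_T_ge[of ?s1]] by simp
    \<comment> \<open>The term d compares the two functions at the same arclength ?s2; the other
      moves the first one from ?s1 to ?s2.\<close>
    also have "\<dots> \<le> (d + M1 * (d * L / m)) / m"
    proof (rule divide_right_mono)
      have "\<bar>op_T f1 ?s1 - op_T f1 ?s2\<bar> \<le> M1 * \<bar>?s1 - ?s2\<bar>"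
        by (rule class_G1_lipschitz[OF T1 \<alpha>(1) Lpos s])
      also have "\<dots> \<le> M1 * (d * L / m)"
        by (rule mult_left_mono[OF arclength_compare[OF D1 D2 d \<theta>in] M1])
      finally show "\<bar>op_T f2 ?s2 - op_T f1 ?s1\<bar> \<le> d + M1 * (d * L / m)" using d[OF s(2)] by linarith
    qed (use m in simp)
    also have "\<dots> = C1 * d" by (simp add: C1_def field_simps)
    finally show ?thesis .
  qed
  \<comment> \<open>Twice the Lipschitz constant of ln |F| in the angle, one for each
    domain.\<close>
  define K where "K = M1 / (pi * m\<^sup>2)"
  have K: "0 \<le> K" using M1 m by (simp add: K_def)
  have \<Delta>_lip: "\<bar>\<Delta> z - \<Delta> w\<bar> \<le> 3 * K * norm (z - w)" if "norm z = 1" "norm w = 1" for z w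
  proof (rule circle_lipschitz[OF _ K that])
    fix a b assume ab: "a \<in> {0..2 * pi}" "b \<in> {0..2 * pi}"
    have "\<bar>\<Delta> (cis a) - \<Delta> (cis b)\<bar> \<le> M1 / (2 * pi * m\<^sup>2) * \<bar>a - b\<bar> + M1 / (2 * pi * m\<^sup>2) * \<bar>a - b\<bar>"
      using D1.ln_speed_lipschitz[OF ab]
        D2.ln_speed_lipschitz[OF ab]
      unfolding \<Delta>_def by linarith
    also have "\<dots> = K * \<bar>a - b\<bar>" by (simp add: K_def)
    finally show "\<bar>\<Delta> (cis a) - \<Delta> (cis b)\<bar> \<le> K * \<bar>a - b\<bar>" .
  qed
  \<comment> \<open>Interpolation of |\<Delta> z - \<Delta> w| between 2 C1 d, with weight \<alpha>,
    and 3 K |z - w|, with weight 1 - \<alpha>.\<close>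
  define A where "A = (2 * C1) powr \<alpha> * (3 * K) powr (1 - \<alpha>) * d powr \<alpha>"
  have A: "0 \<le> A" by (simp add: A_def)
  have \<Delta>_hoelder: "\<bar>\<Delta> z - \<Delta> w\<bar> \<le> A * norm (z - w) powr (1 - \<alpha>)" if "norm z = 1" "norm w = 1" for z w
  proof -
    have "\<bar>\<Delta> z - \<Delta> w\<bar> \<le> (2 * C1 * d) powr \<alpha> * (3 * K * norm (z - w)) powr (1 - \<alpha>)"
      using \<Delta>_le[OF that(1)] \<Delta>_le[OF that(2)] \<Delta>_lip[OF that] \<alpha>
      by (intro interpolation_powr) auto
    also have "\<dots> = A * norm (z - w) powr (1 - \<alpha>)"
      using C1 K d0 by (simp add: A_def powr_mult)
    finally show ?thesis .
  qed
  \<comment> \<open>The rotation that makes cis \<beta> F1 / F2 positive at the origin.\<close>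
  define \<beta> where "\<beta> = Arg (F2 0 / F1 0)"
  define Q where "Q z = cis \<beta> * F1 z / F2 z" for z
  have lnQ: "ln (norm (Q z)) = \<Delta> z" if "norm z = 1" for z
    using disc1(3)[of z] disc2(3)[of z] that by (simp add: Q_def \<Delta>_def norm_mult norm_divide ln_div)
  have F0: "F1 0 \<noteq> 0" "F2 0 \<noteq> 0" using disc1(3)[of 0] disc2(3)[of 0] by auto
  have Q0: "Q 0 = of_real (norm (F1 0) / norm (F2 0))"
  proof -
    have "cis \<beta> = sgn (F2 0 / F1 0)" unfolding \<beta>_def using F0 by (simp add: cis_Arg)
    also have "\<dots> = (F2 0 / F1 0) * of_real (norm (F1 0) / norm (F2 0))"
      using F0 by (simp add: sgn_div_norm scaleR_conv_of_real norm_divide mult.commute)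
    finally have "Q 0 = (F2 0 / F1 0 * of_real (norm (F1 0) / norm (F2 0))) * F1 0 / F2 0"
      by (simp only: Q_def)
    moreover have "(a / b * r) * b / a = r" if "a \<noteq> 0" "b \<noteq> 0" for a b r :: complex
      using that by simp
    ultimately show ?thesis using F0 by simp
  qed
  define E where "E = C2 * d powr \<alpha>"
  have Q1: "norm (Q z - 1) \<le> exp (C1 * d + E) * (C1 * d + E)"
  proof -
    have "norm (Q z - 1) \<le> exp (C1 * d + ?C * A)
        * (C1 * d + ?C * A)"
    proof (rule holomorphic_quotient_near_1[where Q = Q, OF _ _ _ Q0 _ _ _ A _ _ z])
      show "Q holomorphic_on ball 0 1" unfolding Q_def using disc1 disc2 by (auto intro!: holomorphic_intros)
      show "continuous_on (cball 0 1) Q" unfolding Q_def using disc1 disc2 by (auto intro!: continuous_intros)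
      show "Q z \<noteq> 0" if "z \<in> cball 0 1" for z using disc1(3)[OF that] disc2(3)[OF that] by (simp add: Q_def)
      show "0 < norm (F1 0) / norm (F2 0)" using F0 by simp
    qed (use \<alpha> \<Delta>_le \<Delta>_hoelder in \<open>auto simp: lnQ\<close>)
    moreover have "?C * A = E"
      by (simp add: E_def C2_def A_def C1_def K_def)
    ultimately show ?thesis by simp
  qed
  have C2: "0 \<le> C2" unfolding C2_def using \<alpha> cos_half_pi_mult_pos[of "1 - \<alpha>"] by simp
  have "d powr \<alpha> \<le> (2 * M1) powr \<alpha>" using d0 d2 \<alpha> by (intro powr_mono2) auto
  then have E_le: "E \<le> C2 * (2 * M1) powr \<alpha>" unfolding E_def using C2 by (rule mult_left_mono)
  have d_le: "C1 * d \<le> C1 * (2 * M1)" using d2 C1 by (intro mult_left_mono) auto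
  \<comment> \<open>Trades the linear term for a multiple of d^\<alpha> by means of d \<le> 2
    M1.\<close>
  have "d = d powr (1 - \<alpha>) * d powr \<alpha>" using d0 by (simp add: powr_add[symmetric])
  also have "\<dots> \<le> (2 * M1) powr (1 - \<alpha>) * d powr \<alpha>" using d0 d2 \<alpha> by (intro mult_right_mono powr_mono2) auto
  finally have "C1 * d \<le> C1 * ((2 * M1) powr (1 - \<alpha>) * d powr \<alpha>)" using C1 by (intro mult_left_mono) auto
  then have lin: "C1 * d + E \<le> ?Y * d powr \<alpha>"
    by (simp add: E_def distrib_right)
  have nn: "0 \<le> C1 * d + E" using C1 C2 d0 by (simp add: E_def)
  have "exp (C1 * d + E) * (C1 * d + E)
      \<le> ?X * (?Y * d powr \<alpha>)"
    using E_le d_le lin nn by (intro mult_mono) auto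
  with Q1 have Q2: "norm (Q z - 1)
      \<le> ?X * (?Y * d powr \<alpha>)"
    by linarith
  have zc: "z \<in> cball 0 1" using z by simp
  have "cis \<beta> * F1 z - F2 z = F2 z * (Q z - 1)" using disc2(3)[OF zc] by (simp add: Q_def algebra_simps)
  then have "norm (cis \<beta> * F1 z - F2 z) = norm (F2 z) * norm (Q z - 1)" by (simp add: norm_mult)
  also have "\<dots> \<le> 1 / (2 * pi * m) *
     (?X * (?Y * d powr \<alpha>))"
    using D2.norm_F_le[OF z] Q2 m by (intro mult_mono) auto
  finally show ?thesis by (simp add: \<beta>_def mult.assoc)
qed

text \<open>The rotated f1 and f2 agree at 0, so a bound on the difference of derivatives bounds
  their distance at every z of the unit disc. Pairing the points with the same parameter bounds both
  excesses.\<close>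

lemma hausdorff_dist_rotated_images_le:
  assumes f1: "conformal_disc f1 F1" and f2: "conformal_disc f2 F2" and c: "f1 0 = c" "f2 0 = c"
    and bd: "\<And>z. z \<in> ball 0 1 \<Longrightarrow> norm (cis \<beta> * F1 z - F2 z) \<le> B"
  shows "hausdorff_dist (rotation_about c \<beta> ` (f1 ` ball 0 1)) (f2 ` ball 0 1) \<le> B"
proof -
  have near: "dist (rotation_about c \<beta> (f1 z)) (f2 z) \<le> B" if z: "z \<in> ball 0 1" for z
  proof -
    let ?h = "\<lambda>z. cis \<beta> * f1 z - f2 z"
    have "norm (cis \<beta> * F1 0 - F2 0) \<le> B" by (rule bd) simp
    then have B: "0 \<le> B" using norm_ge_zero[of "cis \<beta> * F1 0 - F2 0"] by linarith
    have "norm (?h z - ?h 0) \<le> B * norm (z - 0)"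
    proof (rule field_differentiable_bound[of "ball 0 1" ?h "\<lambda>w. cis \<beta> * F1 w - F2 w"])
      show "(?h has_field_derivative cis \<beta> * F1 w - F2 w) (at w within ball 0 1)" if "w \<in> ball 0 1" for w
        by (rule has_field_derivative_at_within, rule DERIV_diff, rule DERIV_cmult)
          (rule conformal_disc.deriv_at[OF f1 that] conformal_disc.deriv_at[OF f2 that])+
      show "norm (cis \<beta> * F1 w - F2 w) \<le> B" if "w \<in> ball 0 1" for w
        using that by (rule bd)
    qed (use z in auto)
    also have "\<dots> \<le> B * 1" using z B by (intro mult_left_mono) auto
    finally show ?thesis by (simp add: rotation_about_def dist_norm c algebra_simps)
  qed
  have ne: "ball 0 1 \<noteq> ({} :: complex set)" by simp
  have "hausdorff_excess (rotation_about c \<beta> ` (f1 ` ball 0 1)) (f2 ` ball 0 1) \<le> B"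
    unfolding image_image using near by (rule hausdorff_excess_image_le[OF ne])
  moreover have "hausdorff_excess (f2 ` ball 0 1) (rotation_about c \<beta> ` (f1 ` ball 0 1)) \<le> B"
    unfolding image_image using near by (intro hausdorff_excess_image_le[OF ne]) (simp add: dist_commute)
  ultimately show ?thesis by (simp add: hausdorff_dist_def)
qed

theorem theorem1p2:
  fixes \<alpha> m M1 L :: real
  assumes "0 < \<alpha>" "\<alpha> < 1" "0 < m" "0 < M1" "0 < L"
  shows "\<exists>K :: real. \<forall>M0 > 0. \<forall>\<zeta>o \<zeta>b \<Omega>1 \<Omega>2 f1 f2.
           \<zeta>o \<noteq> \<zeta>b \<and>
           \<Omega>1 \<in> class_O \<alpha> \<zeta>o \<zeta>b \<and> \<Omega>2 \<in> class_O \<alpha> \<zeta>o \<zeta>b \<and>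
           f1 \<in> class_F \<alpha> \<zeta>o \<zeta>b \<and> f1 ` ball 0 1 = \<Omega>1 \<and>
           f2 \<in> class_F \<alpha> \<zeta>o \<zeta>b \<and> f2 ` ball 0 1 = \<Omega>2 \<and>
           perimeter f1 = L \<and> perimeter f2 = L \<and>
           op_T f1 \<in> class_G1 \<alpha> m M0 M1 L \<and> op_T f2 \<in> class_G1 \<alpha> m M0 M1 L
           \<longrightarrow> (\<exists>\<beta>. hausdorff_dist (rotation_about \<zeta>o \<beta> ` \<Omega>1) \<Omega>2
                  \<le> K * Ck_norm 1 {0..L} (\<lambda>s. op_T f1 s - op_T f2 s) powr \<alpha>)"
proof -
  \<comment> \<open>The constants are built from \<alpha>, m, M1 and L alone, so K is fixed before
    the domains and M0 are introduced.\<close>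
  define C1 where "C1 = (1 + M1 * L / m) / m"
  define C2 where "C2 = 4 * (exp 1)\<^sup>2 / ((1 - \<alpha>) * cos (pi * (1 - \<alpha>) / 2)) *
      ((2 * ((1 + M1 * L / m) / m)) powr \<alpha> * (3 * (M1 / (pi * m\<^sup>2))) powr (1 - \<alpha>))"
  define K where "K = 1 / (2 * pi * m) *
      (exp (C1 * (2 * M1) + C2 * (2 * M1) powr \<alpha>) * (C1 * (2 * M1) powr (1 - \<alpha>) + C2))"
  have "0 \<le> C1" "0 \<le> C2"
    unfolding C1_def C2_def using assms cos_half_pi_mult_pos[of "1 - \<alpha>"] by auto
  then have K: "0 \<le> K" unfolding K_def using assms by simp
  show ?thesis
  proof (rule exI[of _ K], intro allI impI, elim conjE)
    fix M0 :: real and \<zeta>o \<zeta>b \<Omega>1 \<Omega>2 f1 f2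
    assume F: "f1 \<in> class_F \<alpha> \<zeta>o \<zeta>b" "f2 \<in> class_F \<alpha> \<zeta>o \<zeta>b" and \<Omega>: "f1 ` ball 0 1 = \<Omega>1" "f2 ` ball 0 1 = \<Omega>2"
      and L: "perimeter f1 = L" "perimeter f2 = L"
      and T: "op_T f1 \<in> class_G1 \<alpha> m M0 M1 L" "op_T f2 \<in> class_G1 \<alpha> m M0 M1 L"
    obtain F1 F2 where disc: "conformal_disc f1 F1" "conformal_disc f2 F2"
      using class_F_conformal_disc[OF F(1) assms(1)] class_F_conformal_disc[OF F(2) assms(1)] by metis
    have reg: "regular_conformal_disc f1 F1 \<alpha> m M0 M1 L" "regular_conformal_disc f2 F2 \<alpha> m M0 M1 L"
      using disc T L assms by (auto intro!: regular_conformal_disc.intro regular_conformal_disc_axioms.intro)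
    let ?d = "sup_norm {0..L} (\<lambda>s. op_T f1 s - op_T f2 s)"
    have 0: "f1 0 = \<zeta>o" "f2 0 = \<zeta>o" using F by (auto simp: class_F_def)
    have "hausdorff_dist (rotation_about \<zeta>o (Arg (F2 0 / F1 0)) ` \<Omega>1) \<Omega>2 \<le> K * ?d powr \<alpha>"
      unfolding \<Omega>[symmetric]
    proof (rule hausdorff_dist_rotated_images_le[OF disc 0])
      fix z :: complex assume "z \<in> ball 0 1"
      from derivative_difference_bound[OF reg assms(2) this]
      show "norm (cis (Arg (F2 0 / F1 0)) * F1 z - F2 z) \<le> K * ?d powr \<alpha>"
        unfolding K_def C1_def C2_def .
    qed
    also have "\<dots> \<le> K * Ck_norm 1 {0..L} (\<lambda>s. op_T f1 s - op_T f2 s) powr \<alpha>"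
    proof (intro mult_left_mono K powr_mono2)
      show "0 \<le> ?d"
        using assms(5) by (intro order_trans[OF abs_ge_zero sup_norm_upper[of L _ 0]] continuous_on_diff
            reg[THEN regular_conformal_disc.op_T_continuous]) auto
      show "?d \<le> Ck_norm 1 {0..L} (\<lambda>s. op_T f1 s - op_T f2 s)"
        by (rule sup_norm_le_Ck_norm_1[OF T assms(1,5)])
    qed (use assms in auto)
    finally show "\<exists>\<beta>. hausdorff_dist (rotation_about \<zeta>o \<beta> ` \<Omega>1) \<Omega>2
         \<le> K * Ck_norm 1 {0..L} (\<lambda>s. op_T f1 s - op_T f2 s) powr \<alpha>" by blast
  qed
qed

end
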